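(* Let $\mathrm{pr}:P\to M$ be a fibered manifold, where $M$ is a Poisson manifold whose Poisson bracket $\{\cdot,\cdot\}$ is symplectic, and let $\{\cdot\,|\,\cdot\}:C^\infty(M)\times C^\infty(P)\to C^\infty(P)$ be a natural semi-Poisson bracket on $P$. Then the connection on $P$ whose horizontal lift is given on Hamiltonian vector fields by $X_a^h(f)=\{a\,|\,f\}$, for $a\in C^\infty(M)$ and $f\in C^\infty(P)$, is flat. Consequently, given a fibered manifold $P$ over a symplectic manifold $M$, a bimodule deformation with natural semi-Poisson bracket can only exist if $P$ admits a flat connection.
   Context: A fibered manifold is a surjective submersion $\mathrm{pr}:P\to M$. $C^\infty$ denotes smooth complex-valued functions (needed for the factor $\mathrm i/2$ below); vector fields, horizontal lifts and connections are understood over the same scalars, i.e. vector fields are derivations of $C^\infty$. Semi-Poisson bracket: a bilinear map $\{\cdot\,|\,\cdot\}:C^\infty(M)\times C^\infty(P)\to C^\infty(P)$ with, for all $a,b\in C^\infty(M)$, $f\in C^\infty(P)$: (i) $\{ab\,|\,f\}=\mathrm{pr}^*a\{b\,|\,f\}+\mathrm{pr}^*b\{a\,|\,f\}$; (ii) $\{a\,|\,\mathrm{pr}^*b\,f\}=\mathrm{pr}^*\{a,b\}\,f+\mathrm{pr}^*b\{a\,|\,f\}$; (iii) $\{a\,|\,\{b\,|\,f\}\}-\{b\,|\,\{a\,|\,f\}\}-\{\{a,b\}\,|\,f\}=0$. It is natural if $\{a\,|\,fg\}=\{a\,|\,f\}g+\{a\,|\,g\}f$ for all $f,g\in C^\infty(P)$.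 The Hamiltonian vector field of $a\in C^\infty(M)$ is $X_a(b)=\{a,b\}$. A connection on $P$ is given by its horizontal lift, a $C^\infty(M)$-linear map $X\mapsto X^h$ from vector fields on $M$ to vector fields on $P$ with $X^h(\mathrm{pr}^*b)=\mathrm{pr}^*(X(b))$. In the symplectic case a natural semi-Poisson bracket determines such a horizontal lift by $X_a^h(f)=\{a\,|\,f\}$. Its curvature is $R(X,Y)=[X^h,Y^h]-[X,Y]^h$; flat means $R=0$. Star product $\star$ on $M$: a $\mathbb C[[\lambda]]$-bilinear associative product on $C^\infty(M)[[\lambda]]$, $a\star b=\sum_{k\ge0}\lambda^kC_k(a,b)$, with $C_k$ bidifferential operators, $C_0(a,b)=ab$, $1\star a=a\star1=a$; its Poisson bracket is $\{a,b\}=\frac{\mathrm i}{2}(C_1(a,b)-C_1(b,a))$. A bimodule deformation of $P$ is a $(C^\infty(M)[[\lambda]],\star)$-bimodule structure on $C^\infty(P)[[\lambda]]$ with left and right actions $a\bullet f=\mathrm{pr}^*a\,f+\sum_{k\ge1}\lambda^kL_k(a,f)$ and $f\bullet a=\mathrm{pr}^*a\,f+\sum_{k\ge1}\lambda^kR_k(f,a)$, $L_k,R_k$ bidifferential operators. Its semi-Poisson bracket is $\{a\,|\,f\}=\frac{\mathrm i}{2}(L_1(a,f)-R_1(f,a))$; "bimodule deformation over a symplectic manifold" means that the Poisson bracket of $\star$ is the symplectic one. *)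

theory Defs
  imports "HOL-Analysis.Analysis" "HOL-Library.Function_Algebras"
    "HOL-Computational_Algebra.Formal_Power_Series"
begin

text \<open>
  Complex-valued functions carry the pointwise ring structure of
  \<^theory>\<open>HOL-Library.Function_Algebras\<close>.  The constant function with value c is written
  \<open>\<lambda>_. c\<close>, and the pull-back of a along pr is \<open>a \<circ> pr\<close>.
\<close>

section \<open>Smooth maps and manifolds\<close>

text \<open>On an open set, and for a finite-dimensional domain, the following is the usual
  notion of a k times continuously differentiable map.\<close>

primrec Ck_on :: "nat \<Rightarrow> 'e::real_normed_vector set \<Rightarrow> ('e \<Rightarrow> 'f::real_normed_vector) \<Rightarrow> bool" where
  "Ck_on 0 S f \<longleftrightarrow> continuous_on S f"
| "Ck_on (Suc k) S f \<longleftrightarrow> (\<forall>x\<in>S. f differentiable (at x)) \<and>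
     (\<forall>v. Ck_on k S (\<lambda>x. frechet_derivative f (at x) v))"

definition smooth_on :: "'e::real_normed_vector set \<Rightarrow> ('e \<Rightarrow> 'f::real_normed_vector) \<Rightarrow> bool" where
  "smooth_on S f \<longleftrightarrow> (\<forall>k. Ck_on k S f)"

text \<open>A chart is its domain together with its coordinate map.  A manifold is a whole type
  \<open>'m\<close> with an atlas modelled on a Euclidean space \<open>'e\<close>.  The latter is a finite-dimensional
  real inner product space rather than an instance of class \<^class>\<open>euclidean_space\<close>, because the
  axioms of that class exclude dimension 0.\<close>

type_synonym ('m, 'e) chart = "'m set \<times> ('m \<Rightarrow> 'e)"

definition is_chart :: "('m::topological_space, 'e::real_inner) chart \<Rightarrow> bool" where
  "is_chart = (\<lambda>(U, \<phi>). open U \<and> open (\<phi> ` U) \<and> homeomorphism U (\<phi> ` U) \<phi> (inv_into U \<phi>))"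

definition smooth_atlas ::
    "('m::{t2_space,second_countable_topology}, 'e::real_inner) chart set \<Rightarrow> bool" where
  "smooth_atlas A \<longleftrightarrow>
     (\<exists>B::'e set. finite B \<and> span B = UNIV) \<and>
     (\<forall>c\<in>A. is_chart c) \<and> (\<Union>(U, \<phi>)\<in>A. U) = UNIV \<and>
     (\<forall>(U, \<phi>)\<in>A. \<forall>(V, \<psi>)\<in>A. smooth_on (\<phi> ` (U \<inter> V)) (\<psi> \<circ> inv_into U \<phi>))"

definition smooth_functions ::
    "('m::topological_space, 'e::real_inner) chart set \<Rightarrow> ('m \<Rightarrow> complex) set" where
  "smooth_functions A = {a. \<forall>(U, \<phi>)\<in>A. smooth_on (\<phi> ` U) (a \<circ> inv_into U \<phi>)}"

definition smooth_map ::
    "('p::topological_space, 'f::real_inner) chart set \<Rightarrow>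
     ('m::topological_space, 'e::real_inner) chart set \<Rightarrow> ('p \<Rightarrow> 'm) \<Rightarrow> bool" where
  "smooth_map AP AM F \<longleftrightarrow> continuous_on UNIV F \<and>
     (\<forall>(V, \<psi>)\<in>AP. \<forall>(U, \<phi>)\<in>AM. smooth_on (\<psi> ` (V \<inter> F -` U)) (\<phi> \<circ> F \<circ> inv_into V \<psi>))"

definition submersion ::
    "('p::topological_space, 'f::real_inner) chart set \<Rightarrow>
     ('m::topological_space, 'e::real_inner) chart set \<Rightarrow> ('p \<Rightarrow> 'm) \<Rightarrow> bool" where
  "submersion AP AM F \<longleftrightarrow> smooth_map AP AM F \<and>
     (\<forall>(V, \<psi>)\<in>AP. \<forall>(U, \<phi>)\<in>AM. \<forall>q\<in>V \<inter> F -` U.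
        surj (frechet_derivative (\<phi> \<circ> F \<circ> inv_into V \<psi>) (at (\<psi> q))))"

definition fibered_manifold ::
    "('m::{t2_space,second_countable_topology}, 'e::real_inner) chart set \<Rightarrow>
     ('p::{t2_space,second_countable_topology}, 'f::real_inner) chart set \<Rightarrow> ('p \<Rightarrow> 'm) \<Rightarrow> bool" where
  "fibered_manifold AM AP pr \<longleftrightarrow>
     smooth_atlas AM \<and> smooth_atlas AP \<and> surj pr \<and> submersion AP AM pr"

section \<open>Vector fields\<close>

text \<open>Derivations of the algebra of smooth functions.  The value on non-smooth functions is
  normalized to 0, so that equality of vector fields is equality of HOL functions; this
  normalization is preserved by pointwise sums, by \<open>\<lambda>b. a * X b\<close> and by commutators.\<close>

type_synonym 'm vfield = "('m \<Rightarrow> complex) \<Rightarrow> ('m \<Rightarrow> complex)"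

definition vector_fields ::
    "('m::topological_space, 'e::real_inner) chart set \<Rightarrow> 'm vfield set" where
  "vector_fields A = {X.
     (\<forall>a\<in>smooth_functions A. X a \<in> smooth_functions A) \<and>
     (\<forall>a\<in>smooth_functions A. \<forall>b\<in>smooth_functions A. X (a + b) = X a + X b) \<and>
     (\<forall>c. \<forall>a\<in>smooth_functions A. X ((\<lambda>_. c) * a) = (\<lambda>_. c) * X a) \<and>
     (\<forall>a\<in>smooth_functions A. \<forall>b\<in>smooth_functions A. X (a * b) = X a * b + a * X b) \<and>
     (\<forall>a. a \<notin> smooth_functions A \<longrightarrow> X a = 0)}"

definition lie_bracket :: "'m vfield \<Rightarrow> 'm vfield \<Rightarrow> 'm vfield" where
  "lie_bracket X Y = (\<lambda>a. X (Y a) - Y (X a))"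

definition vf_scale :: "('m \<Rightarrow> complex) \<Rightarrow> 'm vfield \<Rightarrow> 'm vfield" where
  "vf_scale a X = (\<lambda>b. a * X b)"

section \<open>Poisson and symplectic structures\<close>

definition poisson_bracket ::
    "('m::topological_space, 'e::real_inner) chart set \<Rightarrow>
     (('m \<Rightarrow> complex) \<Rightarrow> ('m \<Rightarrow> complex) \<Rightarrow> ('m \<Rightarrow> complex)) \<Rightarrow> bool" where
  "poisson_bracket A br \<longleftrightarrow>
     (\<forall>a\<in>smooth_functions A. \<forall>b\<in>smooth_functions A. br a b \<in> smooth_functions A) \<and>
     (\<forall>a\<in>smooth_functions A. \<forall>b\<in>smooth_functions A. \<forall>c\<in>smooth_functions A.
        br (a + b) c = br a c + br b c) \<and>
     (\<forall>z. \<forall>a\<in>smooth_functions A. \<forall>b\<in>smooth_functions A. br ((\<lambda>_. z) * a) b = (\<lambda>_. z) * br a b) \<and>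
     (\<forall>a\<in>smooth_functions A. \<forall>b\<in>smooth_functions A. br a b = - br b a) \<and>
     (\<forall>a\<in>smooth_functions A. \<forall>b\<in>smooth_functions A. \<forall>c\<in>smooth_functions A.
        br a (b * c) = br a b * c + b * br a c) \<and>
     (\<forall>a\<in>smooth_functions A. \<forall>b\<in>smooth_functions A. \<forall>c\<in>smooth_functions A.
        br a (br b c) + br b (br c a) + br c (br a b) = 0)"

definition hamiltonian_vf ::
    "('m::topological_space, 'e::real_inner) chart set \<Rightarrow>
     (('m \<Rightarrow> complex) \<Rightarrow> ('m \<Rightarrow> complex) \<Rightarrow> ('m \<Rightarrow> complex)) \<Rightarrow> ('m \<Rightarrow> complex) \<Rightarrow> 'm vfield" where
  "hamiltonian_vf A br a = (\<lambda>b. if b \<in> smooth_functions A then br a b else 0)"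

text \<open>A symplectic form: a 2-form (an alternating map on vector fields, linear over the smooth
  functions; linearity in the second argument follows from antisymmetry) that is pointwise
  nondegenerate and closed.  A vector field vanishes at p as a tangent vector iff
  \<open>X a p = 0\<close> for all smooth a.  The last clause is \<open>(d\<omega>)(X, Y, Z) = 0\<close>.\<close>

definition symplectic_form ::
    "('m::topological_space, 'e::real_inner) chart set \<Rightarrow>
     ('m vfield \<Rightarrow> 'm vfield \<Rightarrow> ('m \<Rightarrow> complex)) \<Rightarrow> bool" where
  "symplectic_form A \<omega> \<longleftrightarrow>
     (\<forall>X\<in>vector_fields A. \<forall>Y\<in>vector_fields A. \<omega> X Y \<in> smooth_functions A) \<and>
     (\<forall>X\<in>vector_fields A. \<forall>Y\<in>vector_fields A. \<forall>Z\<in>vector_fields A.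
        \<omega> (X + Y) Z = \<omega> X Z + \<omega> Y Z) \<and>
     (\<forall>a\<in>smooth_functions A. \<forall>X\<in>vector_fields A. \<forall>Y\<in>vector_fields A.
        \<omega> (vf_scale a X) Y = a * \<omega> X Y) \<and>
     (\<forall>X\<in>vector_fields A. \<forall>Y\<in>vector_fields A. \<omega> X Y = - \<omega> Y X) \<and>
     (\<forall>p. \<forall>X\<in>vector_fields A. (\<forall>Y\<in>vector_fields A. \<omega> X Y p = 0) \<longrightarrow>
        (\<forall>a\<in>smooth_functions A. X a p = 0)) \<and>
     (\<forall>X\<in>vector_fields A. \<forall>Y\<in>vector_fields A. \<forall>Z\<in>vector_fields A.
        X (\<omega> Y Z) + Y (\<omega> Z X) + Z (\<omega> X Y)
        - \<omega> (lie_bracket X Y) Z - \<omega> (lie_bracket Y Z) X - \<omega> (lie_bracket Z X) Y = 0)"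

text \<open>The bracket comes from a symplectic form: \<open>\<omega>(X\<^sub>a, Y) = Y(a)\<close>.  The opposite sign
  convention amounts to replacing \<open>\<omega>\<close> by \<open>- \<omega>\<close> and yields the same predicate.\<close>

definition symplectic_bracket ::
    "('m::topological_space, 'e::real_inner) chart set \<Rightarrow>
     (('m \<Rightarrow> complex) \<Rightarrow> ('m \<Rightarrow> complex) \<Rightarrow> ('m \<Rightarrow> complex)) \<Rightarrow> bool" where
  "symplectic_bracket A br \<longleftrightarrow> (\<exists>\<omega>. symplectic_form A \<omega> \<and>
     (\<forall>a\<in>smooth_functions A. hamiltonian_vf A br a \<in> vector_fields A \<and>
        (\<forall>Y\<in>vector_fields A. \<omega> (hamiltonian_vf A br a) Y = Y a)))"

section \<open>Semi-Poisson brackets and connections\<close>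

definition semi_poisson_bracket ::
    "('m::topological_space, 'e::real_inner) chart set \<Rightarrow>
     ('p::topological_space, 'f::real_inner) chart set \<Rightarrow> ('p \<Rightarrow> 'm) \<Rightarrow>
     (('m \<Rightarrow> complex) \<Rightarrow> ('m \<Rightarrow> complex) \<Rightarrow> ('m \<Rightarrow> complex)) \<Rightarrow>
     (('m \<Rightarrow> complex) \<Rightarrow> ('p \<Rightarrow> complex) \<Rightarrow> ('p \<Rightarrow> complex)) \<Rightarrow> bool" where
  "semi_poisson_bracket AM AP pr br sb \<longleftrightarrow>
     (\<forall>a\<in>smooth_functions AM. \<forall>f\<in>smooth_functions AP. sb a f \<in> smooth_functions AP) \<and>
     (\<forall>a\<in>smooth_functions AM. \<forall>b\<in>smooth_functions AM. \<forall>f\<in>smooth_functions AP.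
        sb (a + b) f = sb a f + sb b f) \<and>
     (\<forall>a\<in>smooth_functions AM. \<forall>f\<in>smooth_functions AP. \<forall>g\<in>smooth_functions AP.
        sb a (f + g) = sb a f + sb a g) \<and>
     (\<forall>z. \<forall>a\<in>smooth_functions AM. \<forall>f\<in>smooth_functions AP.
        sb ((\<lambda>_. z) * a) f = (\<lambda>_. z) * sb a f \<and> sb a ((\<lambda>_. z) * f) = (\<lambda>_. z) * sb a f) \<and>
     (\<forall>a\<in>smooth_functions AM. \<forall>b\<in>smooth_functions AM. \<forall>f\<in>smooth_functions AP.
        sb (a * b) f = (a \<circ> pr) * sb b f + (b \<circ> pr) * sb a f) \<and>
     (\<forall>a\<in>smooth_functions AM. \<forall>b\<in>smooth_functions AM. \<forall>f\<in>smooth_functions AP.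
        sb a ((b \<circ> pr) * f) = (br a b \<circ> pr) * f + (b \<circ> pr) * sb a f) \<and>
     (\<forall>a\<in>smooth_functions AM. \<forall>b\<in>smooth_functions AM. \<forall>f\<in>smooth_functions AP.
        sb a (sb b f) - sb b (sb a f) - sb (br a b) f = 0)"

definition natural_bracket ::
    "('m::topological_space, 'e::real_inner) chart set \<Rightarrow>
     ('p::topological_space, 'f::real_inner) chart set \<Rightarrow>
     (('m \<Rightarrow> complex) \<Rightarrow> ('p \<Rightarrow> complex) \<Rightarrow> ('p \<Rightarrow> complex)) \<Rightarrow> bool" where
  "natural_bracket AM AP sb \<longleftrightarrow>
     (\<forall>a\<in>smooth_functions AM. \<forall>f\<in>smooth_functions AP. \<forall>g\<in>smooth_functions AP.
        sb a (f * g) = sb a f * g + sb a g * f)"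

text \<open>A connection, given by its horizontal lift h.  Outside the vector fields of the base,
  h is normalized to 0, which makes uniqueness of h literal.\<close>

definition horizontal_lift ::
    "('m::topological_space, 'e::real_inner) chart set \<Rightarrow>
     ('p::topological_space, 'f::real_inner) chart set \<Rightarrow> ('p \<Rightarrow> 'm) \<Rightarrow>
     ('m vfield \<Rightarrow> 'p vfield) \<Rightarrow> bool" where
  "horizontal_lift AM AP pr h \<longleftrightarrow>
     (\<forall>X\<in>vector_fields AM. h X \<in> vector_fields AP) \<and>
     (\<forall>X\<in>vector_fields AM. \<forall>Y\<in>vector_fields AM. h (X + Y) = h X + h Y) \<and>
     (\<forall>a\<in>smooth_functions AM. \<forall>X\<in>vector_fields AM.
        h (vf_scale a X) = vf_scale (a \<circ> pr) (h X)) \<and>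
     (\<forall>X\<in>vector_fields AM. \<forall>b\<in>smooth_functions AM. h X (b \<circ> pr) = X b \<circ> pr) \<and>
     (\<forall>X. X \<notin> vector_fields AM \<longrightarrow> h X = 0)"

definition curvature :: "('m vfield \<Rightarrow> 'p vfield) \<Rightarrow> 'm vfield \<Rightarrow> 'm vfield \<Rightarrow> 'p vfield" where
  "curvature h X Y = lie_bracket (h X) (h Y) - h (lie_bracket X Y)"

definition flat_connection ::
    "('m::topological_space, 'e::real_inner) chart set \<Rightarrow> ('m vfield \<Rightarrow> 'p vfield) \<Rightarrow> bool" where
  "flat_connection AM h \<longleftrightarrow>
     (\<forall>X\<in>vector_fields AM. \<forall>Y\<in>vector_fields AM. curvature h X Y = 0)"

definition lifts_hamiltonians ::
    "('m::topological_space, 'e::real_inner) chart set \<Rightarrow>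
     ('p::topological_space, 'f::real_inner) chart set \<Rightarrow>
     (('m \<Rightarrow> complex) \<Rightarrow> ('m \<Rightarrow> complex) \<Rightarrow> ('m \<Rightarrow> complex)) \<Rightarrow>
     (('m \<Rightarrow> complex) \<Rightarrow> ('p \<Rightarrow> complex) \<Rightarrow> ('p \<Rightarrow> complex)) \<Rightarrow>
     ('m vfield \<Rightarrow> 'p vfield) \<Rightarrow> bool" where
  "lifts_hamiltonians AM AP br sb h \<longleftrightarrow>
     (\<forall>a\<in>smooth_functions AM. \<forall>f\<in>smooth_functions AP. h (hamiltonian_vf AM br a) f = sb a f)"

section \<open>Star products and bimodule deformations\<close>

primrec iter_deriv :: "'e::real_normed_vector list \<Rightarrow> ('e \<Rightarrow> complex) \<Rightarrow> 'e \<Rightarrow> complex" where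
  "iter_deriv [] F = F"
| "iter_deriv (v # vs) F = (\<lambda>x. frechet_derivative (iter_deriv vs F) (at x) v)"

text \<open>Bidifferential operators along \<open>F : N \<rightarrow> M\<close>: near every point of N, \<open>D(a, f)\<close> is, in
  charts, a finite sum of terms c times a partial derivative of a (pulled back along F) times a
  partial derivative of f, with smooth coefficient functions c on N.  Partial derivatives are
  iterated directional derivatives in the model space.  The orders are locally bounded.\<close>

definition bidifferential ::
    "('m::topological_space, 'e::real_inner) chart set \<Rightarrow>
     ('n::topological_space, 'f::real_inner) chart set \<Rightarrow> ('n \<Rightarrow> 'm) \<Rightarrow>
     (('m \<Rightarrow> complex) \<Rightarrow> ('n \<Rightarrow> complex) \<Rightarrow> ('n \<Rightarrow> complex)) \<Rightarrow> bool" where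
  "bidifferential AM AN F D \<longleftrightarrow>
     (\<forall>q. \<exists>(U, \<phi>)\<in>AM. \<exists>(V, \<psi>)\<in>AN. \<exists>W T.
        open W \<and> q \<in> W \<and> W \<subseteq> V \<inter> F -` U \<and> finite T \<and>
        (\<forall>(c, us, vs)\<in>T. smooth_on (\<psi> ` W) (c \<circ> inv_into V \<psi>)) \<and>
        (\<forall>a\<in>smooth_functions AM. \<forall>f\<in>smooth_functions AN. \<forall>x\<in>W.
           D a f x = (\<Sum>(c, us, vs)\<in>T. c x *
              iter_deriv us (a \<circ> inv_into U \<phi>) (\<phi> (F x)) *
              iter_deriv vs (f \<circ> inv_into V \<psi>) (\<psi> x))))"

definition formal_functions ::
    "('m::topological_space, 'e::real_inner) chart set \<Rightarrow> ('m \<Rightarrow> complex) fps set" where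
  "formal_functions A = {f. \<forall>n. fps_nth f n \<in> smooth_functions A}"

text \<open>The image of a formal scalar under the inclusion of constant functions.\<close>

definition formal_scalar :: "complex fps \<Rightarrow> ('m \<Rightarrow> complex) fps" where
  "formal_scalar z = Abs_fps (\<lambda>n. (\<lambda>_. fps_nth z n))"

definition formal_bilinear ::
    "('m \<Rightarrow> complex) fps set \<Rightarrow> ('n \<Rightarrow> complex) fps set \<Rightarrow> ('k \<Rightarrow> complex) fps set \<Rightarrow>
     (('m \<Rightarrow> complex) fps \<Rightarrow> ('n \<Rightarrow> complex) fps \<Rightarrow> ('k \<Rightarrow> complex) fps) \<Rightarrow> bool" where
  "formal_bilinear S T R m \<longleftrightarrow>
     (\<forall>a\<in>S. \<forall>f\<in>T. m a f \<in> R) \<and>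
     (\<forall>a\<in>S. \<forall>b\<in>S. \<forall>f\<in>T. m (a + b) f = m a f + m b f) \<and>
     (\<forall>a\<in>S. \<forall>f\<in>T. \<forall>g\<in>T. m a (f + g) = m a f + m a g) \<and>
     (\<forall>z. \<forall>a\<in>S. \<forall>f\<in>T. m (formal_scalar z * a) f = formal_scalar z * m a f \<and>
        m a (formal_scalar z * f) = formal_scalar z * m a f)"

text \<open>The coefficient of \<open>\<lambda>\<^sup>k\<close> on functions without \<open>\<lambda>\<close>; for a star product this is \<open>C\<^sub>k\<close>,
  for the two actions it is \<open>L\<^sub>k\<close> and \<open>R\<^sub>k\<close>.\<close>

definition order_term ::
    "(('m \<Rightarrow> complex) fps \<Rightarrow> ('n \<Rightarrow> complex) fps \<Rightarrow> ('k \<Rightarrow> complex) fps) \<Rightarrow> nat \<Rightarrow>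
     ('m \<Rightarrow> complex) \<Rightarrow> ('n \<Rightarrow> complex) \<Rightarrow> ('k \<Rightarrow> complex)" where
  "order_term m k a f = fps_nth (m (fps_const a) (fps_const f)) k"

definition star_product ::
    "('m::topological_space, 'e::real_inner) chart set \<Rightarrow>
     (('m \<Rightarrow> complex) fps \<Rightarrow> ('m \<Rightarrow> complex) fps \<Rightarrow> ('m \<Rightarrow> complex) fps) \<Rightarrow> bool" where
  "star_product A star \<longleftrightarrow>
     formal_bilinear (formal_functions A) (formal_functions A) (formal_functions A) star \<and>
     (\<forall>a\<in>formal_functions A. \<forall>b\<in>formal_functions A. \<forall>c\<in>formal_functions A.
        star (star a b) c = star a (star b c)) \<and>
     (\<forall>a\<in>formal_functions A. star 1 a = a \<and> star a 1 = a) \<and>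
     (\<forall>a\<in>smooth_functions A. \<forall>b\<in>smooth_functions A. order_term star 0 a b = a * b) \<and>
     (\<forall>k. bidifferential A A id (order_term star k))"

definition star_bracket ::
    "(('m \<Rightarrow> complex) fps \<Rightarrow> ('m \<Rightarrow> complex) fps \<Rightarrow> ('m \<Rightarrow> complex) fps) \<Rightarrow>
     ('m \<Rightarrow> complex) \<Rightarrow> ('m \<Rightarrow> complex) \<Rightarrow> ('m \<Rightarrow> complex)" where
  "star_bracket star a b = (\<lambda>_. \<i> / 2) * (order_term star 1 a b - order_term star 1 b a)"

definition bimodule_deformation ::
    "('m::topological_space, 'e::real_inner) chart set \<Rightarrow>
     ('p::topological_space, 'f::real_inner) chart set \<Rightarrow> ('p \<Rightarrow> 'm) \<Rightarrow>
     (('m \<Rightarrow> complex) fps \<Rightarrow> ('m \<Rightarrow> complex) fps \<Rightarrow> ('m \<Rightarrow> complex) fps) \<Rightarrow>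
     (('m \<Rightarrow> complex) fps \<Rightarrow> ('p \<Rightarrow> complex) fps \<Rightarrow> ('p \<Rightarrow> complex) fps) \<Rightarrow>
     (('p \<Rightarrow> complex) fps \<Rightarrow> ('m \<Rightarrow> complex) fps \<Rightarrow> ('p \<Rightarrow> complex) fps) \<Rightarrow> bool" where
  "bimodule_deformation AM AP pr star lact ract \<longleftrightarrow>
     formal_bilinear (formal_functions AM) (formal_functions AP) (formal_functions AP) lact \<and>
     formal_bilinear (formal_functions AP) (formal_functions AM) (formal_functions AP) ract \<and>
     (\<forall>a\<in>formal_functions AM. \<forall>b\<in>formal_functions AM. \<forall>f\<in>formal_functions AP.
        lact (star a b) f = lact a (lact b f) \<and>
        ract f (star a b) = ract (ract f a) b \<and>
        ract (lact a f) b = lact a (ract f b)) \<and>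
     (\<forall>f\<in>formal_functions AP. lact 1 f = f \<and> ract f 1 = f) \<and>
     (\<forall>a\<in>smooth_functions AM. \<forall>f\<in>smooth_functions AP.
        order_term lact 0 a f = (a \<circ> pr) * f \<and> order_term ract 0 f a = (a \<circ> pr) * f) \<and>
     (\<forall>k. bidifferential AM AP pr (order_term lact k) \<and>
          bidifferential AM AP pr (\<lambda>a f. order_term ract k f a))"

definition bimodule_bracket ::
    "(('m \<Rightarrow> complex) fps \<Rightarrow> ('p \<Rightarrow> complex) fps \<Rightarrow> ('p \<Rightarrow> complex) fps) \<Rightarrow>
     (('p \<Rightarrow> complex) fps \<Rightarrow> ('m \<Rightarrow> complex) fps \<Rightarrow> ('p \<Rightarrow> complex) fps) \<Rightarrow>
     ('m \<Rightarrow> complex) \<Rightarrow> ('p \<Rightarrow> complex) \<Rightarrow> ('p \<Rightarrow> complex)" where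
  "bimodule_bracket lact ract a f =
     (\<lambda>_. \<i> / 2) * (order_term lact 1 a f - order_term ract 1 f a)"

end

theory Submission
  imports Defs
begin

text \<open>
  Let \<open>X\<^sub>a\<close> denote the Hamiltonian vector field of a function \<open>a\<close> on M, and \<open>{a | f}\<close> the natural
  semi-Poisson bracket.

  Nondegeneracy of the symplectic form identifies tangent vectors with covectors, and \<open>X\<^sub>a\<close> at \<open>p\<close>
  corresponds to the differential of \<open>a\<close> at \<open>p\<close>.  So every tangent vector is the value of some \<open>X\<^sub>b\<close>.  By
  the first rule of a semi-Poisson bracket, \<open>a \<mapsto> {a | f}(q)\<close> is a derivation at \<open>pr q\<close>, so it too
  depends only on the differential of \<open>a\<close>.  Therefore \<open>X\<^sup>h(f)(q) = {b | f}(q)\<close>, for any \<open>b\<close> such that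
  \<open>X\<^sub>b\<close> and X agree at \<open>pr q\<close>, is a valid definition (\<open>lift_eq\<close>).  Naturality makes \<open>X\<^sup>h\<close> a
  derivation, the second rule makes it a lift of X, and it preserves smoothness because near a point
  \<open>b\<close> can be taken to be \<open>\<Sum>\<^sub>i \<omega>(X, E\<^sub>i)(pr q) \<xi>\<^sub>i\<close>, with coordinates \<open>\<xi>\<^sub>i\<close> and partial derivatives
  \<open>E\<^sub>i\<close> (\<open>frame_potential\<close>, \<open>lift_smooth\<close>).

  A map on vector fields that is linear over functions depends pointwise on its argument
  (\<open>tensorial_at_point\<close>).  This applies to any horizontal lift \<open>h\<close> and to its curvature in each
  argument.  Hence \<open>h\<close> is determined by its values \<open>{a | f}\<close> on Hamiltonian vector fields, and the
  curvature vanishes as soon as \<open>R(X\<^sub>a, X\<^sub>b)(f) = {a | {b | f}} - {b | {a | f}} - {{a, b} | f}\<close> does,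
  which is the third rule (\<open>curvature_hamiltonian\<close>, \<open>hlift_unique\<close>, \<open>hlift_flat\<close>).

  Vector fields and brackets are derivations of the algebra of global smooth functions, so it has to
  be proved that a derivation at a point factors through the differential and that vector fields
  have local frames.  Both are contained in \<open>local_frame\<close>, which combines Hadamard's lemma with cut-off
  functions; the calculus at the beginning serves this lemma.

  For a bimodule deformation, the commutator \<open>D\<^sub>a f = a \<bullet> f - f \<bullet> a\<close> starts in order 1 with
  \<open>{a | f}\<close>, up to the factor \<open>\<i> / 2\<close>, and the leading orders of
  \<open>D(a \<star> b) f = a \<bullet> D\<^sub>b f + (D\<^sub>a f) \<bullet> b\<close>, \<open>D\<^sub>a (b \<bullet> f) = [a, b] \<bullet> f + b \<bullet> D\<^sub>a f\<close> and
  \<open>[D\<^sub>a, D\<^sub>b] = D([a, b])\<close> are the three rules (\<open>bimodule_bracket_semi_poisson\<close>).  So the existence of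
  a flat connection follows from the first part.
\<close>

section \<open>Calculus on finite-dimensional inner product spaces\<close>

text \<open>
  An orthonormal basis has this reconstruction property, and it is the property through which
  coordinates are used; in dimension 0 the empty set has it.\<close>

definition parseval_frame :: "'e::real_inner set \<Rightarrow> bool" where
  "parseval_frame C \<longleftrightarrow> finite C \<and> (\<forall>v. (\<Sum>c\<in>C. (v \<bullet> c) *\<^sub>R c) = v)"

lemma parseval_frame_exists:
  assumes "finite (B::'e::real_inner set)" "span B = UNIV"
  shows "\<exists>C::'e set. parseval_frame C"
proof -
  obtain D :: "'e set" where D: "finite D" "span D = UNIV" "pairwise orthogonal D"
    using basis_orthogonal[OF assms(1)] assms(2) by metis
  define C where "C = (\<lambda>d. d /\<^sub>R norm d) ` (D - {0})"
  have inj: "inj_on (\<lambda>d. d /\<^sub>R norm d) (D - {0})"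
  proof (rule inj_onI, rule ccontr)
    fix d d' assume d: "d \<in> D - {0}" "d' \<in> D - {0}" "d /\<^sub>R norm d = d' /\<^sub>R norm d'" "d \<noteq> d'"
    then have "d \<bullet> d' = 0" using D(3) by (auto simp: pairwise_def orthogonal_def)
    moreover have "(d /\<^sub>R norm d) \<bullet> (d' /\<^sub>R norm d') = (d /\<^sub>R norm d) \<bullet> (d /\<^sub>R norm d)"
      using d(3) by simp
    ultimately have "(d /\<^sub>R norm d) \<bullet> (d /\<^sub>R norm d) = 0" by simp
    then show False using d(1) by simp
  qed
  have *: "(\<Sum>c\<in>C. (v \<bullet> c) *\<^sub>R c) = (\<Sum>d\<in>D. ((v \<bullet> d) / (d \<bullet> d)) *\<^sub>R d)" for v
  proof -
    have "(\<Sum>c\<in>C. (v \<bullet> c) *\<^sub>R c) = (\<Sum>d\<in>D - {0}. ((v \<bullet> d) / (d \<bullet> d)) *\<^sub>R d)"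
      unfolding C_def
      by (subst sum.reindex[OF inj], rule sum.cong)
         (auto simp: power2_norm_eq_inner[symmetric] power2_eq_square field_simps)
    also have "\<dots> = (\<Sum>d\<in>D. ((v \<bullet> d) / (d \<bullet> d)) *\<^sub>R d)"
      by (rule sum.mono_neutral_left) (use D(1) in auto)
    finally show ?thesis .
  qed
  have "(\<Sum>d\<in>D. ((v \<bullet> d) / (d \<bullet> d)) *\<^sub>R d) = v" for v
  proof -
    have "v \<in> span D" using D(2) by simp
    then show ?thesis
    proof (induction rule: span_induct_alt)
      case base show ?case by simp
    next
      case (step a x y)
      have "(\<Sum>d\<in>D. ((x \<bullet> d) / (d \<bullet> d)) *\<^sub>R d) = (\<Sum>d\<in>D. if d = x then x else 0)"
        by (rule sum.cong[OF refl]) (use D(3) step(1) in \<open>auto simp: pairwise_def orthogonal_def\<close>)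
      also have "\<dots> = x" using D(1) step(1) by simp
      finally have x: "(\<Sum>d\<in>D. ((x \<bullet> d) / (d \<bullet> d)) *\<^sub>R d) = x" .
      have "(\<Sum>d\<in>D. (((a *\<^sub>R x + y) \<bullet> d) / (d \<bullet> d)) *\<^sub>R d)
          = a *\<^sub>R (\<Sum>d\<in>D. ((x \<bullet> d) / (d \<bullet> d)) *\<^sub>R d) + (\<Sum>d\<in>D. ((y \<bullet> d) / (d \<bullet> d)) *\<^sub>R d)"
        by (simp add: inner_add_left add_divide_distrib scaleR_add_left sum.distrib scaleR_sum_right)
      then show ?case using x step(2) by simp
    qed
  qed
  then show ?thesis unfolding parseval_frame_def
    by (intro exI[of _ C]) (use D(1) * in \<open>auto simp: C_def\<close>)
qed

lemma parseval_frame_linear: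
  assumes "parseval_frame C" "linear L"
  shows "L w = (\<Sum>c\<in>C. (w \<bullet> c) *\<^sub>R L c)"
proof -
  have "L w = L (\<Sum>c\<in>C. (w \<bullet> c) *\<^sub>R c)" using assms(1) by (simp add: parseval_frame_def)
  also have "\<dots> = (\<Sum>c\<in>C. (w \<bullet> c) *\<^sub>R L c)"
    using assms(2) by (simp add: linear_sum linear_scale)
  finally show ?thesis .
qed

lemma parseval_frame_real: "parseval_frame {1::real}"
  by (simp add: parseval_frame_def)

text \<open>
  A ball lies in a cube in the coordinates of a frame, and a cube is a finite sum of compact
  segments.  Compactness is what makes the support of a cut-off function closed in a manifold, and
  what makes derivatives uniformly continuous in Hadamard's lemma.\<close>

lemma compact_cball_finite_dim:
  assumes "parseval_frame (C::'e::real_inner set)"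
  shows "compact (cball (x::'e) r)"
proof -
  have fin: "finite C" using assms by (simp add: parseval_frame_def)
  have cube: "compact {\<Sum>c\<in>D. t c *\<^sub>R c | t. \<forall>c\<in>D. \<bar>t c\<bar> \<le> R}" if "finite D" for D :: "'e set" and R
    using that
  proof (induction D)
    case empty show ?case by simp
  next
    case (insert d D)
    have "compact ((\<lambda>t. t *\<^sub>R d) ` {-R..R})"
      by (intro compact_continuous_image continuous_intros) auto
    then have "compact {x + y | x y. x \<in> (\<lambda>t. t *\<^sub>R d) ` {-R..R} \<and>
        y \<in> {\<Sum>c\<in>D. t c *\<^sub>R c | t. \<forall>c\<in>D. \<bar>t c\<bar> \<le> R}}"
      using insert.IH by (rule compact_sums)
    also have "{x + y | x y. x \<in> (\<lambda>t. t *\<^sub>R d) ` {-R..R} \<and>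
        y \<in> {\<Sum>c\<in>D. t c *\<^sub>R c | t. \<forall>c\<in>D. \<bar>t c\<bar> \<le> R}}
      = {\<Sum>c\<in>insert d D. t c *\<^sub>R c | t. \<forall>c\<in>insert d D. \<bar>t c\<bar> \<le> R}" (is "?L = ?R")
    proof (intro equalityI subsetI)
      fix z assume "z \<in> ?L"
      then obtain s t where st: "z = s *\<^sub>R d + (\<Sum>c\<in>D. t c *\<^sub>R c)" "\<bar>s\<bar> \<le> R" "\<forall>c\<in>D. \<bar>t c\<bar> \<le> R"
        by (auto simp: abs_le_iff)
      have "(\<Sum>c\<in>D. (if c = d then s else t c) *\<^sub>R c) = (\<Sum>c\<in>D. t c *\<^sub>R c)"
        by (rule sum.cong) (use insert.hyps in auto)
      then have "z = (\<Sum>c\<in>insert d D. (if c = d then s else t c) *\<^sub>R c)"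
        using insert.hyps st(1) by simp
      then show "z \<in> ?R" using st by (auto intro!: exI[of _ "\<lambda>c. if c = d then s else t c"])
    next
      fix z assume "z \<in> ?R"
      then obtain t where t: "z = (\<Sum>c\<in>insert d D. t c *\<^sub>R c)" "\<forall>c\<in>insert d D. \<bar>t c\<bar> \<le> R" by auto
      have "z = t d *\<^sub>R d + (\<Sum>c\<in>D. t c *\<^sub>R c)" "t d \<in> {-R..R}"
        using t insert.hyps by (auto simp: abs_le_iff)
      then show "z \<in> ?L" using t(2) by blast
    qed
    finally show ?case .
  qed
  define R where "R = (\<Sum>c\<in>C. (norm x + r) * norm c)"
  have "cball x r \<subseteq> {\<Sum>c\<in>C. t c *\<^sub>R c | t. \<forall>c\<in>C. \<bar>t c\<bar> \<le> R}"
  proof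
    fix y assume y: "y \<in> cball x r"
    then have r: "0 \<le> r" "norm y \<le> norm x + r"
      using norm_triangle_sub[of y x] by (auto simp: dist_norm norm_minus_commute intro: order_trans[OF norm_ge_zero])
    have "\<bar>y \<bullet> c\<bar> \<le> R" if "c \<in> C" for c
    proof -
      have "\<bar>y \<bullet> c\<bar> \<le> norm y * norm c" by (rule Cauchy_Schwarz_ineq2)
      also have "\<dots> \<le> (norm x + r) * norm c" using r by (intro mult_right_mono) auto
      also have "\<dots> \<le> R" unfolding R_def
        by (rule member_le_sum[OF that _ fin]) (use r in auto)
      finally show ?thesis .
    qed
    moreover have "y = (\<Sum>c\<in>C. (y \<bullet> c) *\<^sub>R c)" using assms by (simp add: parseval_frame_def)
    ultimately show "y \<in> {\<Sum>c\<in>C. t c *\<^sub>R c | t. \<forall>c\<in>C. \<bar>t c\<bar> \<le> R}" by (auto intro!: exI[of _ "\<lambda>c. y \<bullet> c"])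
  qed
  moreover have "closed (cball x r)" by simp
  ultimately show ?thesis using compact_Int_closed[OF cube[OF fin, of R], of "cball x r"]
    by (simp add: inf.absorb2)
qed

lemma Ck_on_subset: "Ck_on k T f \<Longrightarrow> S \<subseteq> T \<Longrightarrow> Ck_on k S f"
  by (induction k arbitrary: f) (auto intro: continuous_on_subset)

text \<open>
  The last premise is an instance of the congruence rule at level \<open>k\<close>, which is itself proved by
  induction with the help of this lemma; on open sets it is discharged once and for all in
  \<open>Ck_on_Suc_derivI\<close>.\<close>

lemma Ck_on_SucI:
  fixes f :: "'e::real_normed_vector \<Rightarrow> 'f::real_normed_vector"
  assumes "\<And>x. x \<in> S \<Longrightarrow> (f has_derivative f' x) (at x)"
    and "\<And>v. Ck_on k S (\<lambda>x. f' x v)"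
    and "\<And>g g' :: 'e \<Rightarrow> 'f. (\<And>x. x \<in> S \<Longrightarrow> g x = g' x) \<Longrightarrow> Ck_on k S g \<Longrightarrow> Ck_on k S g'"
  shows "Ck_on (Suc k) S f"
proof -
  have eq: "frechet_derivative f (at x) = f' x" if "x \<in> S" for x
    using assms(1)[OF that] frechet_derivative_at by metis
  have "Ck_on k S (\<lambda>x. frechet_derivative f (at x) v)" for v
  proof (rule assms(3))
    show "Ck_on k S (\<lambda>x. f' x v)" by (rule assms(2))
  qed (simp add: eq)
  then show ?thesis using assms(1) by (auto simp: differentiable_def)
qed

lemma Ck_on_cong:
  fixes f g :: "'e::real_normed_vector \<Rightarrow> 'f::real_normed_vector"
  assumes "open S" "\<And>x. x \<in> S \<Longrightarrow> f x = g x" "Ck_on k S f"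
  shows "Ck_on k S g"
  using assms(2,3)
proof (induction k arbitrary: f g)
  case 0 then show ?case by (auto cong: continuous_on_cong)
next
  case (Suc k)
  show ?case
  proof (rule Ck_on_SucI)
    fix x assume x: "x \<in> S"
    then have "(f has_derivative frechet_derivative f (at x)) (at x)"
      using Suc.prems by (simp add: frechet_derivative_works)
    then show "(g has_derivative frechet_derivative f (at x)) (at x)"
      by (rule has_derivative_transform_within_open[OF _ assms(1) x]) (use Suc.prems in auto)
  next
    show "Ck_on k S (\<lambda>x. frechet_derivative f (at x) v)" for v using Suc.prems by simp
  next
    show "Ck_on k S h'" if "\<And>x. x \<in> S \<Longrightarrow> h x = h' x" "Ck_on k S h" for h h' :: "'e \<Rightarrow> 'f"
      by (rule Suc.IH[OF that])
  qed
qed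

lemma Ck_on_Suc_derivI:
  fixes f :: "'e::real_normed_vector \<Rightarrow> 'f::real_normed_vector"
  assumes "open S" "\<And>x. x \<in> S \<Longrightarrow> (f has_derivative f' x) (at x)" "\<And>v. Ck_on k S (\<lambda>x. f' x v)"
  shows "Ck_on (Suc k) S f"
proof (rule Ck_on_SucI)
  show "Ck_on k S g'" if "\<And>x. x \<in> S \<Longrightarrow> g x = g' x" "Ck_on k S g" for g g' :: "'e \<Rightarrow> 'f"
    by (rule Ck_on_cong[OF assms(1) that])
qed (fact assms(2), fact assms(3))

lemma Ck_on_Suc_has_derivative:
  "Ck_on (Suc k) S f \<Longrightarrow> x \<in> S \<Longrightarrow> (f has_derivative frechet_derivative f (at x)) (at x)"
  by (simp add: frechet_derivative_works)

lemma Ck_on_SucD: "Ck_on (Suc k) S f \<Longrightarrow> Ck_on k S f"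
proof (induction k arbitrary: f)
  case 0 then show ?case
    by (metis Ck_on.simps differentiable_at_withinI differentiable_imp_continuous_on differentiable_on_def)
qed auto

lemma Ck_on_local:
  assumes "open S" "\<And>x. x \<in> S \<Longrightarrow> \<exists>T. open T \<and> x \<in> T \<and> Ck_on k T f"
  shows "Ck_on k S f"
  using assms(2)
proof (induction k arbitrary: f)
  case 0
  have "isCont f x" if x: "x \<in> S" for x
    using 0[OF x] by (auto simp: continuous_on_eq_continuous_at)
  then show ?case by (simp add: continuous_at_imp_continuous_on)
next
  case (Suc k)
  have "f differentiable (at x)" if "x \<in> S" for x using Suc.prems[OF that] by auto
  moreover have "Ck_on k S (\<lambda>x. frechet_derivative f (at x) v)" for v
    by (rule Suc.IH) (use Suc.prems in fastforce)
  ultimately show ?case by simp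
qed

lemma Ck_on_const: "Ck_on k S (\<lambda>_. c)"
proof (induction k arbitrary: c)
  case (Suc k) then show ?case by (simp add: frechet_derivative_const)
qed simp

lemma Ck_on_add:
  assumes "open S" "Ck_on k S f" "Ck_on k S g"
  shows "Ck_on k S (\<lambda>x. f x + g x)"
  using assms(2,3)
proof (induction k arbitrary: f g)
  case 0 then show ?case by (auto intro: continuous_intros)
next
  case (Suc k)
  show ?case
  proof (rule Ck_on_Suc_derivI[OF assms(1)])
    fix x assume "x \<in> S"
    then show "((\<lambda>x. f x + g x) has_derivative
        (\<lambda>v. frechet_derivative f (at x) v + frechet_derivative g (at x) v)) (at x)"
      using Suc.prems by (intro has_derivative_add Ck_on_Suc_has_derivative)
  next
    show "Ck_on k S (\<lambda>x. frechet_derivative f (at x) v + frechet_derivative g (at x) v)" for v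
      using Suc.prems by (intro Suc.IH) auto
  qed
qed

lemma Ck_on_sum:
  assumes "open S" "\<And>i. i \<in> I \<Longrightarrow> Ck_on k S (f i)"
  shows "Ck_on k S (\<lambda>x. \<Sum>i\<in>I. f i x)"
  using assms(2)
proof (induction I rule: infinite_finite_induct)
  case (insert i I)
  then have "Ck_on k S (\<lambda>x. f i x + (\<Sum>i\<in>I. f i x))" by (intro Ck_on_add[OF assms(1)]) auto
  then show ?case using insert.hyps by simp
qed (simp_all add: Ck_on_const)

lemma Ck_on_bounded_linear:
  assumes "open S" "bounded_linear L" "Ck_on k S f"
  shows "Ck_on k S (\<lambda>x. L (f x))"
  using assms(3)
proof (induction k arbitrary: f)
  case 0 then show ?case using bounded_linear.continuous_on[OF assms(2)] by auto
next
  case (Suc k)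
  show ?case
  proof (rule Ck_on_Suc_derivI[OF assms(1)])
    fix x assume "x \<in> S"
    from Ck_on_Suc_has_derivative[OF Suc.prems this]
    show "((\<lambda>x. L (f x)) has_derivative (\<lambda>v. L (frechet_derivative f (at x) v))) (at x)"
      by (rule bounded_linear.has_derivative[OF assms(2)])
  next
    show "Ck_on k S (\<lambda>x. L (frechet_derivative f (at x) v))" for v
      using Suc.prems by (intro Suc.IH) auto
  qed
qed

lemma Ck_on_bilinear:
  assumes "open S" "bounded_bilinear bil" "Ck_on k S f" "Ck_on k S g"
  shows "Ck_on k S (\<lambda>x. bil (f x) (g x))"
  using assms(3,4)
proof (induction k arbitrary: f g)
  case 0 then show ?case using bounded_bilinear.continuous_on[OF assms(2)] by auto
next
  case (Suc k)
  show ?case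
  proof (rule Ck_on_Suc_derivI[OF assms(1)])
    fix x assume "x \<in> S"
    then show "((\<lambda>x. bil (f x) (g x)) has_derivative
        (\<lambda>v. bil (f x) (frechet_derivative g (at x) v) + bil (frechet_derivative f (at x) v) (g x))) (at x)"
      using Suc.prems by (intro bounded_bilinear.FDERIV[OF assms(2)] Ck_on_Suc_has_derivative)
  next
    fix v
    show "Ck_on k S (\<lambda>x. bil (f x) (frechet_derivative g (at x) v) + bil (frechet_derivative f (at x) v) (g x))"
      using Suc.prems Ck_on_SucD[OF Suc.prems(1)] Ck_on_SucD[OF Suc.prems(2)]
      by (intro Ck_on_add[OF assms(1)] Suc.IH) auto
  qed
qed

text \<open>
  A frame of the intermediate space turns the chain rule into a finite sum of products of a
  directional derivative of the outer map, to which the induction hypothesis applies, and a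
  coordinate of the derivative of the inner map.\<close>

lemma Ck_on_compose:
  fixes g :: "'b::real_inner \<Rightarrow> 'c::real_normed_vector"
  assumes "open S" "open T" "F ` S \<subseteq> T" "parseval_frame (C::'b set)" "Ck_on k T g" "Ck_on k S F"
  shows "Ck_on k S (g \<circ> F)"
  using assms(5,6)
proof (induction k arbitrary: g)
  case 0 then show ?case using assms(3) by (auto simp: o_def intro: continuous_on_compose2)
next
  case (Suc k)
  show ?case
  proof (rule Ck_on_Suc_derivI[OF assms(1)])
    fix x assume x: "x \<in> S"
    then have F: "(F has_derivative frechet_derivative F (at x)) (at x)"
      and g: "(g has_derivative frechet_derivative g (at (F x))) (at (F x))"
      using Suc.prems assms(3) Ck_on_Suc_has_derivative by blast+
    have "frechet_derivative g (at (F x)) w = (\<Sum>c\<in>C. (w \<bullet> c) *\<^sub>R frechet_derivative g (at (F x)) c)" for w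
      using g by (intro parseval_frame_linear[OF assms(4)] bounded_linear.linear has_derivative_bounded_linear)
    then have "frechet_derivative g (at (F x)) \<circ> frechet_derivative F (at x) =
        (\<lambda>v. \<Sum>c\<in>C. (frechet_derivative F (at x) v \<bullet> c) *\<^sub>R frechet_derivative g (at (F x)) c)"
      by (intro ext) (metis o_apply)
    then show "(g \<circ> F has_derivative (\<lambda>v. \<Sum>c\<in>C. (frechet_derivative F (at x) v \<bullet> c) *\<^sub>R
        frechet_derivative g (at (F x)) c)) (at x)"
      using diff_chain_at[OF F g] by metis
  next
    fix v
    have "Ck_on k S ((\<lambda>y. frechet_derivative g (at y) c) \<circ> F)" for c
      using Suc.prems(1) Ck_on_SucD[OF Suc.prems(2)] by (intro Suc.IH) auto
    then have "Ck_on k S (\<lambda>x. frechet_derivative g (at (F x)) c)" for c by (simp add: o_def)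
    then show "Ck_on k S (\<lambda>x. \<Sum>c\<in>C. (frechet_derivative F (at x) v \<bullet> c) *\<^sub>R
        frechet_derivative g (at (F x)) c)"
      using Suc.prems
      by (intro Ck_on_sum[OF assms(1)] Ck_on_bilinear[OF assms(1) bounded_bilinear_scaleR]
          Ck_on_bounded_linear[OF assms(1) bounded_linear_inner_left]) auto
  qed
qed

lemma smooth_on_subset: "smooth_on T f \<Longrightarrow> S \<subseteq> T \<Longrightarrow> smooth_on S f"
  by (auto simp: smooth_on_def intro: Ck_on_subset)

lemma smooth_on_cong: "open S \<Longrightarrow> (\<And>x. x \<in> S \<Longrightarrow> f x = g x) \<Longrightarrow> smooth_on S f \<Longrightarrow> smooth_on S g"
  unfolding smooth_on_def using Ck_on_cong by blast

lemma smooth_on_local: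
  "open S \<Longrightarrow> (\<And>x. x \<in> S \<Longrightarrow> \<exists>T. open T \<and> x \<in> T \<and> smooth_on T f) \<Longrightarrow> smooth_on S f"
  unfolding smooth_on_def using Ck_on_local by meson

lemma smooth_on_const: "smooth_on S (\<lambda>_. c)"
  by (simp add: smooth_on_def Ck_on_const)

lemma smooth_on_add: "open S \<Longrightarrow> smooth_on S f \<Longrightarrow> smooth_on S g \<Longrightarrow> smooth_on S (\<lambda>x. f x + g x)"
  by (simp add: smooth_on_def Ck_on_add)

lemma smooth_on_bounded_linear:
  "open S \<Longrightarrow> bounded_linear L \<Longrightarrow> smooth_on S f \<Longrightarrow> smooth_on S (\<lambda>x. L (f x))"
  by (simp add: smooth_on_def Ck_on_bounded_linear)

lemma smooth_on_bilinear:
  "open S \<Longrightarrow> bounded_bilinear bil \<Longrightarrow> smooth_on S f \<Longrightarrow> smooth_on S g \<Longrightarrow>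
    smooth_on S (\<lambda>x. bil (f x) (g x))"
  by (simp add: smooth_on_def Ck_on_bilinear)

lemma smooth_on_compose:
  fixes g :: "'b::real_inner \<Rightarrow> 'c::real_normed_vector"
  assumes "open S" "open T" "F ` S \<subseteq> T" "parseval_frame (C::'b set)" "smooth_on T g" "smooth_on S F"
  shows "smooth_on S (g \<circ> F)"
  using assms unfolding smooth_on_def by (blast intro: Ck_on_compose)

lemma smooth_on_id: "smooth_on S (\<lambda>x. x)"
proof -
  have "Ck_on k S (\<lambda>x. x)" for k
    by (cases k) (auto simp: frechet_derivative_ident Ck_on_const)
  then show ?thesis by (simp add: smooth_on_def)
qed

lemma smooth_on_has_derivative:
  "smooth_on S f \<Longrightarrow> x \<in> S \<Longrightarrow> (f has_derivative frechet_derivative f (at x)) (at x)"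
  unfolding smooth_on_def using Ck_on_Suc_has_derivative by blast

lemma smooth_on_directional_derivative:
  "smooth_on S f \<Longrightarrow> smooth_on S (\<lambda>x. frechet_derivative f (at x) v)"
  unfolding smooth_on_def using Ck_on.simps(2) by blast

lemma smooth_on_imp_continuous_on: "smooth_on S f \<Longrightarrow> continuous_on S f"
  unfolding smooth_on_def using Ck_on.simps(1) by blast

section \<open>Cut-off functions\<close>

text \<open>
  The functions \<open>x\<^sup>-\<^sup>n exp (- 1 / x)\<close>, extended by 0.  The one of interest is \<open>n = 0\<close>; up to linear
  combinations the whole family is closed under differentiation, so that its smoothness is an
  induction on the order of differentiability.\<close>

definition flat_power :: "nat \<Rightarrow> real \<Rightarrow> real" where
  "flat_power n x = (if x \<le> 0 then 0 else inverse x ^ n * exp (- inverse x))"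

lemma flat_power_tendsto_0: "(flat_power n \<longlongrightarrow> 0) (at 0)"
proof -
  have "((\<lambda>x. inverse x ^ n / exp (inverse x)) \<longlongrightarrow> (0::real)) (at_right 0)"
    by (rule filterlim_compose[OF tendsto_power_div_exp_0 filterlim_inverse_at_top_right])
  moreover have "\<forall>\<^sub>F x in at_right 0. inverse x ^ n / exp (inverse x) = flat_power n x"
    using eventually_at_right_less[of "0::real"]
    by eventually_elim (simp add: flat_power_def exp_minus divide_inverse)
  ultimately have r: "(flat_power n \<longlongrightarrow> 0) (at_right 0)"
    using tendsto_cong by force
  have "\<forall>\<^sub>F x in at_left (0::real). x < 0" by (simp add: eventually_at_filter)
  then have "\<forall>\<^sub>F x in at_left 0. 0 = flat_power n x"
    by eventually_elim (simp add: flat_power_def)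
  then have "(flat_power n \<longlongrightarrow> 0) (at_left 0)"
    using tendsto_const tendsto_cong by force
  then show ?thesis using r by (simp add: filterlim_split_at)
qed

text \<open>
  At 0 the difference quotient of \<open>flat_power n\<close> is \<open>flat_power (n + 1)\<close>, which tends to 0 because the
  exponential decay beats every power.\<close>

lemma flat_power_has_derivative:
  "(flat_power n has_real_derivative (flat_power (n + 2) x - real n * flat_power (n + 1) x)) (at x)"
proof (cases "x = 0")
  case True
  have "(\<lambda>y. (flat_power n y - flat_power n 0) / (y - 0)) = flat_power (n + 1)"
    by (auto simp: flat_power_def fun_eq_iff divide_inverse)
  then show ?thesis using flat_power_tendsto_0[of "n + 1"] True
    by (simp add: has_field_derivative_iff flat_power_def)
next
  case False
  show ?thesis
  proof (cases "x > 0")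
    case True
    have "((\<lambda>x. inverse x ^ n * exp (- inverse x)) has_real_derivative
        (flat_power (n + 2) x - real n * flat_power (n + 1) x)) (at x)"
      using True
      by (auto intro!: derivative_eq_intros simp: flat_power_def field_simps power2_eq_square)
         (cases n; simp add: field_simps)
    moreover have "\<forall>\<^sub>F y in nhds x. inverse y ^ n * exp (- inverse y) = flat_power n y"
      using eventually_nhds_in_open[of "{0<..}" x] True
      by (auto elim!: eventually_mono simp: flat_power_def)
    ultimately show ?thesis
      by (rule iffD1[OF DERIV_cong_ev[OF refl _ refl], rotated])
  next
    case neg: False
    have "((\<lambda>x. 0) has_real_derivative (flat_power (n + 2) x - real n * flat_power (n + 1) x)) (at x)"
      using neg by (simp add: flat_power_def)
    moreover have "\<forall>\<^sub>F y in nhds x. 0 = flat_power n y"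
      using eventually_nhds_in_open[of "{..<0}" x] False neg
      by (auto elim!: eventually_mono simp: flat_power_def)
    ultimately show ?thesis
      by (rule iffD1[OF DERIV_cong_ev[OF refl _ refl], rotated])
  qed
qed

lemma smooth_on_flat_power: "smooth_on UNIV (flat_power n)"
proof -
  have "Ck_on k UNIV (flat_power n)" for k
  proof (induction k arbitrary: n)
    case 0
    then show ?case
      using DERIV_isCont[OF flat_power_has_derivative] by (auto intro: continuous_at_imp_continuous_on)
  next
    case (Suc k)
    show ?case
    proof (rule Ck_on_Suc_derivI[OF open_UNIV])
      fix x :: real
      show "(flat_power n has_derivative (*) (flat_power (n + 2) x - real n * flat_power (n + 1) x)) (at x)"
        using flat_power_has_derivative by (simp add: has_field_derivative_def)
    next
      fix v :: real
      have "Ck_on k UNIV (\<lambda>x. v * flat_power (n + 2) x + (- real n * v) * flat_power (n + 1) x)"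
        by (intro Ck_on_add[OF open_UNIV] Ck_on_bounded_linear[OF open_UNIV bounded_linear_mult_right] Suc)
      then show "Ck_on k UNIV (\<lambda>x. (flat_power (n + 2) x - real n * flat_power (n + 1) x) * v)"
        by (rule Ck_on_cong[OF open_UNIV, rotated]) (simp add: algebra_simps)
    qed
  qed
  then show ?thesis by (simp add: smooth_on_def)
qed

text \<open>
  The derivative of the inverse is a product of inverses, so smoothness follows from closure under
  products by induction.\<close>

lemma smooth_on_inverse: "smooth_on (- {0}) (inverse :: real \<Rightarrow> real)"
proof -
  have op: "open (- {0::real})" by auto
  have "Ck_on k (- {0}) (inverse :: real \<Rightarrow> real)" for k
  proof (induction k)
    case 0 show ?case by (auto intro!: continuous_intros)
  next
    case (Suc k)
    show ?case
    proof (rule Ck_on_Suc_derivI[OF op])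
      fix x :: real assume "x \<in> - {0}"
      then show "(inverse has_derivative (\<lambda>v. - (inverse x * v * inverse x))) (at x)"
        by (auto intro: has_derivative_inverse')
    next
      fix v :: real
      have "Ck_on k (- {0}) (\<lambda>x. (- v) * (inverse x * inverse x))"
        by (intro Ck_on_bounded_linear[OF op bounded_linear_mult_right]
            Ck_on_bilinear[OF op bounded_bilinear_mult] Suc)
      then show "Ck_on k (- {0}) (\<lambda>x. - (inverse x * v * inverse x))"
        by (rule Ck_on_cong[OF op, rotated]) simp
    qed
  qed
  then show ?thesis by (simp add: smooth_on_def)
qed

lemma smooth_step_exists:
  obtains s :: "real \<Rightarrow> real"
  where "smooth_on UNIV s" "\<And>t. t \<le> 0 \<Longrightarrow> s t = 0" "\<And>t. 1 \<le> t \<Longrightarrow> s t = 1"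
proof
  \<comment> \<open>The step is \<open>e(t) / (e(t) + e(1 - t))\<close> with \<open>e = flat_power 0\<close>; at every t one of the two summands of the denominator is positive.\<close>
  define d where "d t = flat_power 0 t + flat_power 0 (1 - t)" for t
  have d: "d t \<noteq> 0" for t
    by (simp add: d_def flat_power_def add_nonneg_eq_0_iff)
  have "smooth_on UNIV (flat_power 0 \<circ> (\<lambda>t. 1 + (-1) *\<^sub>R t))"
    by (intro smooth_on_compose[OF open_UNIV open_UNIV _ parseval_frame_real] smooth_on_flat_power
        smooth_on_add smooth_on_const smooth_on_bounded_linear[OF _ bounded_linear_scaleR_right] smooth_on_id) auto
  then have "smooth_on UNIV d"
    unfolding d_def by (intro smooth_on_add smooth_on_flat_power) (auto simp: o_def)
  then have "smooth_on UNIV (inverse \<circ> d)"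
    by (intro smooth_on_compose[OF open_UNIV _ _ parseval_frame_real smooth_on_inverse]) (auto simp: d)
  then show "smooth_on UNIV (\<lambda>t. flat_power 0 t * (inverse \<circ> d) t)"
    by (intro smooth_on_bilinear[OF open_UNIV bounded_bilinear_mult] smooth_on_flat_power)
  show "flat_power 0 t * (inverse \<circ> d) t = 0" if "t \<le> 0" for t using that by (simp add: flat_power_def)
  show "flat_power 0 t * (inverse \<circ> d) t = 1" if "1 \<le> t" for t
    using that d[of t] by (simp add: d_def flat_power_def)
qed

lemma ball_cutoff_exists:
  fixes y0 :: "'e::real_inner"
  assumes "0 < e"
  obtains \<psi> :: "'e \<Rightarrow> real"
  where "smooth_on UNIV \<psi>" "\<And>y. y \<in> ball y0 e \<Longrightarrow> \<psi> y = 1" "\<And>y. y \<notin> cball y0 (2 * e) \<Longrightarrow> \<psi> y = 0"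
proof -
  obtain s :: "real \<Rightarrow> real"
    where s: "smooth_on UNIV s" "\<And>t. t \<le> 0 \<Longrightarrow> s t = 0" "\<And>t. 1 \<le> t \<Longrightarrow> s t = 1"
    using smooth_step_exists by metis
  \<comment> \<open>The step function is applied to \<open>2 - norm (y - y0)\<^sup>2 / e\<^sup>2\<close>, written so that smoothness is evident.\<close>
  define q where "q y = 2 + (- inverse (e\<^sup>2)) *\<^sub>R ((y + - y0) \<bullet> (y + - y0))" for y
  have q: "q y = 2 - (norm (y - y0))\<^sup>2 / e\<^sup>2" for y
    by (simp add: q_def power2_norm_eq_inner divide_inverse)
  have "smooth_on UNIV q" unfolding q_def
    by (intro smooth_on_add smooth_on_const smooth_on_bounded_linear[OF _ bounded_linear_scaleR_right]
        smooth_on_bilinear[OF _ bounded_bilinear_inner] smooth_on_id) auto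
  then have "smooth_on UNIV (s \<circ> q)"
    by (intro smooth_on_compose[OF open_UNIV open_UNIV _ parseval_frame_real s(1)]) auto
  moreover have "(s \<circ> q) y = 1" if "y \<in> ball y0 e" for y
  proof -
    have "(norm (y - y0))\<^sup>2 \<le> e\<^sup>2"
      using that by (intro power_mono) (auto simp: dist_norm norm_minus_commute)
    then show ?thesis using assms by (simp add: q s(3))
  qed
  moreover have "(s \<circ> q) y = 0" if "y \<notin> cball y0 (2 * e)" for y
  proof -
    have "(2 * e)\<^sup>2 \<le> (norm (y - y0))\<^sup>2"
      using that assms by (intro power_mono) (auto simp: dist_norm norm_minus_commute)
    then have "4 * e\<^sup>2 \<le> (norm (y - y0))\<^sup>2" by (simp add: power_mult_distrib)
    then have "2 * e\<^sup>2 \<le> (norm (y - y0))\<^sup>2" using zero_le_power2[of e] by linarith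
    then show ?thesis using assms by (simp add: q s(2) field_simps)
  qed
  ultimately show ?thesis using that by blast
qed

section \<open>Hadamard's lemma\<close>

text \<open>
  With \<open>m = 0\<close> and a directional derivative for H these are the coefficients in Hadamard's lemma.
  The weight is there because differentiating in y produces one more factor t.\<close>

definition ray_mean :: "nat \<Rightarrow> 'e::real_inner \<Rightarrow> ('e \<Rightarrow> complex) \<Rightarrow> 'e \<Rightarrow> complex" where
  "ray_mean m y0 H y = integral {0..1} (\<lambda>t. t ^ m *\<^sub>R H (y0 + t *\<^sub>R (y - y0)))"

lemma ray_in_cball:
  fixes y0 :: "'e::real_inner"
  assumes "y \<in> cball y0 r" "t \<in> {0..1}"
  shows "y0 + t *\<^sub>R (y - y0) \<in> cball y0 r"
proof -
  have "t * norm (y - y0) \<le> 1 * norm (y - y0)" using assms(2) by (intro mult_right_mono) auto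
  then show ?thesis using assms by (auto simp: dist_norm norm_minus_commute)
qed

lemma ray_in_ball:
  fixes y0 :: "'e::real_inner"
  assumes "y \<in> ball y0 r" "t \<in> {0..1}"
  shows "y0 + t *\<^sub>R (y - y0) \<in> ball y0 r"
proof -
  have "t * norm (y - y0) \<le> 1 * norm (y - y0)" using assms(2) by (intro mult_right_mono) auto
  then show ?thesis using assms by (auto simp: dist_norm norm_minus_commute)
qed

lemma continuous_on_ray:
  fixes y0 :: "'e::real_inner" and H :: "'e \<Rightarrow> complex"
  assumes "continuous_on (ball y0 r) H" "y \<in> ball y0 r"
  shows "continuous_on {0..1::real} (\<lambda>t. t ^ m *\<^sub>R H (y0 + t *\<^sub>R (y - y0)))"
  by (intro continuous_intros continuous_on_compose2[OF assms(1)])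
     (use ray_in_ball[OF assms(2)] in auto)

text \<open>
  On a compact set the finitely many derivatives along a frame are uniformly continuous, and they
  control the operator norm of the whole derivative.\<close>

lemma derivative_uniformly_close:
  fixes H :: "'e::real_inner \<Rightarrow> complex"
  assumes C: "parseval_frame (C::'e set)" and H: "smooth_on S H"
    and K: "compact K" "K \<subseteq> S" and "0 < e"
  shows "\<exists>d>0. \<forall>x\<in>K. \<forall>x'\<in>K. dist x x' < d \<longrightarrow>
    onorm (\<lambda>v. frechet_derivative H (at x) v - frechet_derivative H (at x') v) \<le> e"
proof -
  define D where "D x = frechet_derivative H (at x)" for x
  have fin: "finite C" using C by (simp add: parseval_frame_def)
  define M where "M = (\<Sum>c\<in>C. norm c)"
  have M: "0 \<le> M" unfolding M_def by (intro sum_nonneg) auto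
  define e' where "e' = e / (1 + M)"
  have e': "0 < e'" "M * e' \<le> e" using \<open>0 < e\<close> M by (auto simp: e'_def field_simps)
  have "uniformly_continuous_on K (\<lambda>x. D x c)" for c unfolding D_def
    by (intro compact_uniformly_continuous continuous_on_subset[OF _ K(2)]
        smooth_on_imp_continuous_on smooth_on_directional_derivative H K(1))
  then have "\<forall>c. \<exists>d>0. \<forall>x\<in>K. \<forall>x'\<in>K. dist x' x < d \<longrightarrow> dist (D x' c) (D x c) < e'"
    unfolding uniformly_continuous_on_def using e'(1) by blast
  then obtain d where d: "\<And>c. 0 < d c"
    "\<And>c x x'. x \<in> K \<Longrightarrow> x' \<in> K \<Longrightarrow> dist x' x < d c \<Longrightarrow> dist (D x' c) (D x c) < e'"
    by metis
  define d' where "d' = Min (insert 1 (d ` C))"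
  have d': "0 < d'" "\<And>c. c \<in> C \<Longrightarrow> d' \<le> d c" using fin d(1) by (auto simp: d'_def)
  have "onorm (\<lambda>v. D x v - D x' v) \<le> e" if x: "x \<in> K" "x' \<in> K" "dist x x' < d'" for x x'
  proof -
    have lin: "linear (D x)" "linear (D x')"
      unfolding D_def using smooth_on_has_derivative[OF H] x K(2)
      by (meson bounded_linear.linear has_derivative_bounded_linear subsetD)+
    have "norm (D x v - D x' v) \<le> e * norm v" for v
    proof -
      have "D x v - D x' v = (\<Sum>c\<in>C. (v \<bullet> c) *\<^sub>R (D x c - D x' c))"
        unfolding parseval_frame_linear[OF C lin(1), of v] parseval_frame_linear[OF C lin(2), of v]
        by (simp add: sum_subtractf scaleR_diff_right)
      also have "norm \<dots> \<le> (\<Sum>c\<in>C. (norm c * e') * norm v)"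
      proof (rule sum_norm_le)
        fix c assume c: "c \<in> C"
        have "\<bar>v \<bullet> c\<bar> * norm (D x c - D x' c) \<le> (norm v * norm c) * e'"
          using d(2)[of x' x c] d'(2)[OF c] x
          by (intro mult_mono Cauchy_Schwarz_ineq2) (auto simp: dist_norm)
        then show "norm ((v \<bullet> c) *\<^sub>R (D x c - D x' c)) \<le> (norm c * e') * norm v"
          by (simp add: mult_ac)
      qed
      also have "\<dots> = (M * e') * norm v" by (simp add: M_def sum_distrib_right)
      also have "\<dots> \<le> e * norm v" using e'(2) by (intro mult_right_mono) auto
      finally show ?thesis .
    qed
    then show ?thesis using \<open>0 < e\<close> by (intro onorm_bound) auto
  qed
  then show ?thesis using d'(1) unfolding D_def by blast
qed

text \<open>
  Differentiation under the integral sign.  The mean value inequality bounds the error of the linear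
  approximation of H at each point of the ray by a small multiple of \<open>norm (z - y)\<close>, uniformly in t,
  and the bound survives integration over the unit interval.\<close>

lemma ray_mean_has_derivative:
  fixes H :: "'e::real_inner \<Rightarrow> complex"
  assumes C: "parseval_frame (C::'e set)" and H: "smooth_on (ball y0 r) H" and y: "y \<in> ball y0 r"
  shows "(ray_mean m y0 H has_derivative
    (\<lambda>v. \<Sum>c\<in>C. (v \<bullet> c) *\<^sub>R ray_mean (Suc m) y0 (\<lambda>x. frechet_derivative H (at x) c) y)) (at y)"
    (is "(_ has_derivative ?L) _")
  unfolding has_derivative_at_alt
proof (intro conjI allI impI)
  show "bounded_linear ?L"
    by (intro bounded_linear_sum bounded_linear_scaleR_const bounded_linear_inner_left)
  fix e :: real assume e: "0 < e"
  obtain \<rho> where \<rho>: "dist y0 y < \<rho>" "\<rho> < r" using y dense by auto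
  have K: "compact (cball y0 \<rho>)" "cball y0 \<rho> \<subseteq> ball y0 r"
    using compact_cball_finite_dim[OF C] \<rho>(2) by auto
  obtain d where d: "0 < d" "\<And>x x'. x \<in> cball y0 \<rho> \<Longrightarrow> x' \<in> cball y0 \<rho> \<Longrightarrow> dist x x' < d \<Longrightarrow>
      onorm (\<lambda>v. frechet_derivative H (at x) v - frechet_derivative H (at x') v) \<le> e"
    using derivative_uniformly_close[OF C H K e] by blast
  have est: "norm (ray_mean m y0 H z - ray_mean m y0 H y - ?L (z - y)) \<le> e * norm (z - y)"
    if z: "norm (z - y) < min d (\<rho> - dist y0 y)" for z
  proof -
    have z\<rho>: "z \<in> cball y0 \<rho>" and y\<rho>: "y \<in> cball y0 \<rho>"
      using z \<rho>(1) dist_triangle[of y0 z y] by (auto simp: dist_norm norm_minus_commute)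
    define p where "p t = y0 + t *\<^sub>R (y - y0)" for t
    define q where "q t = y0 + t *\<^sub>R (z - y0)" for t
    have pq: "q t - p t = t *\<^sub>R (z - y)" for t by (simp add: p_def q_def algebra_simps)
    have cH: "continuous_on (ball y0 r) H" using H by (rule smooth_on_imp_continuous_on)
    have cD: "continuous_on (ball y0 r) (\<lambda>x. frechet_derivative H (at x) c)" for c
      by (intro smooth_on_imp_continuous_on smooth_on_directional_derivative H)
    have zr: "z \<in> ball y0 r" using z\<rho> K(2) by auto
    note cont = continuous_on_ray[OF cH y, of m] continuous_on_ray[OF cH zr, of m]
      continuous_on_ray[OF cD y, of "Suc m"]
    \<comment> \<open>The error of the linear approximation is the integral of f, which is estimated pointwise.\<close>
    define f where "f t = t ^ m *\<^sub>R H (q t) - t ^ m *\<^sub>R H (p t) -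
        (\<Sum>c\<in>C. ((z - y) \<bullet> c) *\<^sub>R (t ^ Suc m *\<^sub>R frechet_derivative H (at (p t)) c))" for t
    have contf: "continuous_on {0..1} f" unfolding f_def p_def q_def
      by (intro continuous_on_diff continuous_on_sum continuous_on_scaleR[OF continuous_on_const] cont)
    have "(f has_integral (ray_mean m y0 H z - ray_mean m y0 H y - ?L (z - y))) {0..1}"
      unfolding ray_mean_def f_def p_def q_def using C
      by (intro has_integral_diff has_integral_sum has_integral_cmul integrable_integral
          integrable_continuous_real cont) (simp add: parseval_frame_def)
    then have "ray_mean m y0 H z - ray_mean m y0 H y - ?L (z - y) = integral {0..1} f"
      by (simp add: integral_unique)
    also have "norm \<dots> \<le> (e * norm (z - y)) * (1 - 0)"
    proof (rule integral_bound[OF _ contf])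
      fix t :: real assume t: "t \<in> {0..1}"
      have pt: "p t \<in> cball y0 \<rho>" and qt: "q t \<in> cball y0 \<rho>"
        unfolding p_def q_def using ray_in_cball t y\<rho> z\<rho> by blast+
      define S where "S = cball y0 \<rho> \<inter> ball (p t) d"
      have tn: "t * norm (z - y) \<le> norm (z - y)"
        using t mult_right_mono[of t 1 "norm (z - y)"] by auto
      have nqp: "norm (q t - p t) < d" using tn z t unfolding pq by auto
      have 1: "p t + s *\<^sub>R (q t - p t) \<in> S" if s: "s \<in> {0..1}" for s
      proof -
        have "convex S" unfolding S_def by (intro convex_Int convex_cball convex_ball)
        moreover have "p t \<in> S" "q t \<in> S" using pt qt nqp d(1) by (auto simp: S_def dist_norm norm_minus_commute)
        ultimately have "(1 - s) *\<^sub>R p t + s *\<^sub>R q t \<in> S" using s by (auto simp: convex_alt)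
        then show ?thesis by (simp add: algebra_simps)
      qed
      have 2: "(H has_derivative frechet_derivative H (at x)) (at x within S)" if "x \<in> S" for x
        using smooth_on_has_derivative[OF H, of x] that K(2) has_derivative_at_withinI
        by (auto simp: S_def subset_iff)
      have 3: "onorm (frechet_derivative H (at x) - frechet_derivative H (at (p t))) \<le> e" if "x \<in> S" for x
        using d(2)[of x "p t"] that pt by (simp add: S_def dist_commute fun_diff_def)
      have 4: "p t \<in> S" using pt d(1) by (simp add: S_def)
      \<comment> \<open>The segment from \<open>p t\<close> to \<open>q t\<close> stays in S, where the derivative of H differs little from its value at \<open>p t\<close>.\<close>
    have bnd: "norm (H (q t) - H (p t) - frechet_derivative H (at (p t)) (q t - p t)) \<le> norm (q t - p t) * e"
        by (rule differentiable_bound_linearization[OF 1 2 3 4])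
      have lin: "linear (frechet_derivative H (at (p t)))"
        using 2[OF 4] has_derivative_bounded_linear bounded_linear.linear by blast
      have "f t = t ^ m *\<^sub>R (H (q t) - H (p t) - frechet_derivative H (at (p t)) (q t - p t))"
        unfolding f_def pq linear_scale[OF lin] parseval_frame_linear[OF C lin, of "z - y"]
        by (simp add: scaleR_diff_right scaleR_sum_right mult_ac)
      then have "norm (f t) = t ^ m * norm (H (q t) - H (p t) - frechet_derivative H (at (p t)) (q t - p t))"
        using t by simp
      also have "\<dots> \<le> 1 * (norm (q t - p t) * e)"
        using t bnd by (intro mult_mono power_le_one) auto
      also have "\<dots> \<le> e * norm (z - y)" unfolding pq using tn t e by (simp add: mult.commute)
      finally show "norm (f t) \<le> e * norm (z - y)" .
    qed simp
    finally show ?thesis by simp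
  qed
  show "\<exists>d>0. \<forall>z. norm (z - y) < d \<longrightarrow>
      norm (ray_mean m y0 H z - ray_mean m y0 H y - ?L (z - y)) \<le> e * norm (z - y)"
    using est d(1) \<rho>(1) by (intro exI[of _ "min d (\<rho> - dist y0 y)"]) auto
qed

text \<open>
  The derivative of a ray mean is again a combination of ray means of smooth functions, with the
  weight raised by one; hence the induction over all \<open>m\<close> and \<open>H\<close>.\<close>

lemma smooth_on_ray_mean:
  fixes H :: "'e::real_inner \<Rightarrow> complex"
  assumes C: "parseval_frame (C::'e set)" and H: "smooth_on (ball y0 r) H"
  shows "smooth_on (ball y0 r) (ray_mean m y0 H)"
proof -
  have "Ck_on k (ball y0 r) (ray_mean m y0 H)" for k
    using H
  proof (induction k arbitrary: m H)
    case 0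
    have "isCont (ray_mean m y0 H) y" if "y \<in> ball y0 r" for y
      using ray_mean_has_derivative[OF C 0 that] by (rule has_derivative_continuous)
    then show ?case by (simp add: continuous_at_imp_continuous_on)
  next
    case (Suc k)
    show ?case
    proof (rule Ck_on_Suc_derivI[OF open_ball])
      fix y assume "y \<in> ball y0 r"
      then show "(ray_mean m y0 H has_derivative (\<lambda>v. \<Sum>c\<in>C. (v \<bullet> c) *\<^sub>R
          ray_mean (Suc m) y0 (\<lambda>x. frechet_derivative H (at x) c) y)) (at y)"
        by (rule ray_mean_has_derivative[OF C Suc.prems])
    next
      show "Ck_on k (ball y0 r) (\<lambda>y. \<Sum>c\<in>C. (v \<bullet> c) *\<^sub>R
          ray_mean (Suc m) y0 (\<lambda>x. frechet_derivative H (at x) c) y)" for v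
        by (rule Ck_on_sum[OF open_ball], rule Ck_on_bounded_linear[OF open_ball bounded_linear_scaleR_right],
            rule Suc.IH, rule smooth_on_directional_derivative, rule Suc.prems)
    qed
  qed
  then show ?thesis by (simp add: smooth_on_def)
qed

text \<open>
  Integrate the derivative of F along the ray from \<open>y0\<close> to \<open>y\<close> and pull the coordinates of
  \<open>y - y0\<close> out of the integral.  The point of the lemma is that the remaining coefficients are
  smooth, so that they may be inserted into a derivation.\<close>

lemma hadamard:
  fixes F :: "'e::real_inner \<Rightarrow> complex"
  assumes C: "parseval_frame (C::'e set)" and F: "smooth_on (ball y0 r) F" and r: "0 < r"
  obtains g where "\<And>c. smooth_on (ball y0 r) (g c)" "\<And>c. g c y0 = frechet_derivative F (at y0) c"
    "\<And>y. y \<in> ball y0 r \<Longrightarrow> F y = F y0 + (\<Sum>c\<in>C. ((y - y0) \<bullet> c) *\<^sub>R g c y)"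
proof
  define g where "g c = ray_mean 0 y0 (\<lambda>x. frechet_derivative F (at x) c)" for c
  show "smooth_on (ball y0 r) (g c)" for c
    unfolding g_def by (intro smooth_on_ray_mean[OF C] smooth_on_directional_derivative F)
  show "g c y0 = frechet_derivative F (at y0) c" for c by (simp add: g_def ray_mean_def)
  fix y assume y: "y \<in> ball y0 r"
  define p where "p t = y0 + t *\<^sub>R (y - y0)" for t
  have "((\<lambda>t. F (p t)) has_vector_derivative frechet_derivative F (at (p t)) (y - y0)) (at t within {0..1})"
    if t: "t \<in> {0..1}" for t
  proof -
    have "(p has_vector_derivative (y - y0)) (at t within {0..1})"
      unfolding p_def by (auto intro!: derivative_eq_intros)
    moreover have "(F has_derivative frechet_derivative F (at (p t))) (at (p t) within p ` {0..1})"
      using smooth_on_has_derivative[OF F ray_in_ball[OF y t]] has_derivative_at_withinI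
      unfolding p_def by blast
    ultimately show ?thesis
      using vector_derivative_diff_chain_within[of p] by (simp add: o_def)
  qed
  then have "((\<lambda>t. frechet_derivative F (at (p t)) (y - y0)) has_integral (F (p 1) - F (p 0))) {0..1}"
    by (intro fundamental_theorem_of_calculus) auto
  then have "F y - F y0 = integral {0..1} (\<lambda>t. frechet_derivative F (at (p t)) (y - y0))"
    by (simp add: p_def integral_unique)
  also have "\<dots> = integral {0..1} (\<lambda>t. \<Sum>c\<in>C. ((y - y0) \<bullet> c) *\<^sub>R frechet_derivative F (at (p t)) c)"
  proof (rule integral_cong)
    fix t :: real assume "t \<in> {0..1}"
    then have "linear (frechet_derivative F (at (p t)))"
      using smooth_on_has_derivative[OF F ray_in_ball[OF y]] unfolding p_def
      by (blast intro: bounded_linear.linear has_derivative_bounded_linear)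
    then show "frechet_derivative F (at (p t)) (y - y0) = (\<Sum>c\<in>C. ((y - y0) \<bullet> c) *\<^sub>R frechet_derivative F (at (p t)) c)"
      by (rule parseval_frame_linear[OF C])
  qed
  also have "\<dots> = (\<Sum>c\<in>C. integral {0..1} (\<lambda>t. ((y - y0) \<bullet> c) *\<^sub>R frechet_derivative F (at (p t)) c))"
  proof (rule integral_sum)
    fix c
    have "continuous_on {0..1::real} (\<lambda>t. t ^ 0 *\<^sub>R frechet_derivative F (at (y0 + t *\<^sub>R (y - y0))) c)"
      by (rule continuous_on_ray[OF smooth_on_imp_continuous_on[OF smooth_on_directional_derivative[OF F]] y])
    then show "(\<lambda>t. ((y - y0) \<bullet> c) *\<^sub>R frechet_derivative F (at (p t)) c) integrable_on {0..1}"
      unfolding p_def by (intro integrable_cmul integrable_continuous_real) simp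
  qed (use C in \<open>simp add: parseval_frame_def\<close>)
  also have "\<dots> = (\<Sum>c\<in>C. ((y - y0) \<bullet> c) *\<^sub>R g c y)" by (simp add: g_def ray_mean_def p_def)
  finally show "F y = F y0 + (\<Sum>c\<in>C. ((y - y0) \<bullet> c) *\<^sub>R g c y)" by (simp add: algebra_simps)
qed

section \<open>Smooth functions on a manifold\<close>

lemma atlas_parseval_frame:
  fixes A :: "('m::{t2_space,second_countable_topology}, 'e::real_inner) chart set"
  assumes "smooth_atlas A"
  obtains C :: "'e set" where "parseval_frame C"
proof -
  obtain B :: "'e set" where "finite B" "span B = UNIV"
    using assms unfolding smooth_atlas_def by auto
  then show ?thesis using parseval_frame_exists that by metis
qed

lemma atlas_chart_at:
  assumes "smooth_atlas A"
  obtains U \<phi> where "(U, \<phi>) \<in> A" "p \<in> U"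
  using assms unfolding smooth_atlas_def by blast

lemma atlas_chart:
  assumes "smooth_atlas A" "(U, \<phi>) \<in> A"
  shows "open U" "open (\<phi> ` U)" "homeomorphism U (\<phi> ` U) \<phi> (inv_into U \<phi>)"
  using assms unfolding smooth_atlas_def is_chart_def by blast+

lemma chart_inv:
  assumes "smooth_atlas A" "(U, \<phi>) \<in> A" "x \<in> U"
  shows "inv_into U \<phi> (\<phi> x) = x"
  using atlas_chart(3)[OF assms(1,2)] assms(3) by (simp add: homeomorphism_def)

lemma chart_open_image:
  assumes "smooth_atlas A" "(U, \<phi>) \<in> A" "open W" "W \<subseteq> U"
  shows "open (\<phi> ` W)"
proof -
  have "openin (top_of_set U) W" using assms(3,4) by (simp add: open_subset)
  from homeomorphism_imp_open_map[OF atlas_chart(3)[OF assms(1,2)] this] show ?thesis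
    using atlas_chart(2)[OF assms(1,2)] openin_open_trans by blast
qed

lemma chart_open_vimage:
  assumes "smooth_atlas A" "(U, \<phi>) \<in> A" "open T"
  shows "open {x \<in> U. \<phi> x \<in> T}"
proof -
  have "continuous_on U \<phi>" using atlas_chart(3)[OF assms(1,2)] by (simp add: homeomorphism_def)
  then have "open (\<phi> -` T \<inter> U)"
    using continuous_on_open_vimage atlas_chart(1)[OF assms(1,2)] assms(3) by blast
  moreover have "\<phi> -` T \<inter> U = {x \<in> U. \<phi> x \<in> T}" by auto
  ultimately show ?thesis by simp
qed

lemma smooth_function_in_chart:
  "a \<in> smooth_functions A \<Longrightarrow> (U, \<phi>) \<in> A \<Longrightarrow> smooth_on (\<phi> ` U) (a \<circ> inv_into U \<phi>)"
  by (auto simp: smooth_functions_def)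

text \<open>
  Smoothness is required in all charts by definition, but by smoothness of the transition maps it can
  be checked near each point in one chart of choice.\<close>

lemma smooth_functionsI:
  fixes A :: "('m::{t2_space,second_countable_topology}, 'e::real_inner) chart set"
  assumes A: "smooth_atlas A"
    and loc: "\<And>p. \<exists>U \<phi> W. (U, \<phi>) \<in> A \<and> open W \<and> p \<in> W \<and> W \<subseteq> U \<and> smooth_on (\<phi> ` W) (a \<circ> inv_into U \<phi>)"
  shows "a \<in> smooth_functions A"
  unfolding smooth_functions_def
proof (clarify)
  fix V \<psi> assume V: "(V, \<psi>) \<in> A"
  obtain C :: "'e set" where C: "parseval_frame C" using atlas_parseval_frame[OF A] .
  show "smooth_on (\<psi> ` V) (a \<circ> inv_into V \<psi>)"
  proof (rule smooth_on_local[OF atlas_chart(2)[OF A V]])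
    fix y assume "y \<in> \<psi> ` V"
    then obtain p where p: "p \<in> V" "y = \<psi> p" by blast
    obtain U \<phi> W where W: "(U, \<phi>) \<in> A" "open W" "p \<in> W" "W \<subseteq> U" "smooth_on (\<phi> ` W) (a \<circ> inv_into U \<phi>)"
      using loc by blast
    define T where "T = \<psi> ` (V \<inter> W)"
    have T: "open T" unfolding T_def
      using atlas_chart(1)[OF A V] W(2) by (intro chart_open_image[OF A V]) auto
    have "smooth_on (\<psi> ` (V \<inter> U)) (\<phi> \<circ> inv_into V \<psi>)"
      using A V W(1) unfolding smooth_atlas_def by blast
    then have "smooth_on T (\<phi> \<circ> inv_into V \<psi>)"
      by (rule smooth_on_subset) (use W(4) in \<open>auto simp: T_def\<close>)
    then have "smooth_on T ((a \<circ> inv_into U \<phi>) \<circ> (\<phi> \<circ> inv_into V \<psi>))"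
      by (intro smooth_on_compose[OF T chart_open_image[OF A W(1,2,4)] _ C W(5)])
         (auto simp: T_def chart_inv[OF A V])
    then have "smooth_on T (a \<circ> inv_into V \<psi>)"
    proof (rule smooth_on_cong[OF T, rotated])
      fix x assume "x \<in> T"
      then show "((a \<circ> inv_into U \<phi>) \<circ> (\<phi> \<circ> inv_into V \<psi>)) x = (a \<circ> inv_into V \<psi>) x"
        using W(4) by (auto simp: T_def chart_inv[OF A V] chart_inv[OF A W(1)])
    qed
    then show "\<exists>T. open T \<and> y \<in> T \<and> smooth_on T (a \<circ> inv_into V \<psi>)"
      using T p W(3) by (intro exI[of _ T]) (auto simp: T_def)
  qed
qed

lemma smooth_functions_local:
  assumes A: "smooth_atlas A"
    and "\<And>p. \<exists>W g. open W \<and> p \<in> W \<and> g \<in> smooth_functions A \<and> (\<forall>x\<in>W. a x = g x)"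
  shows "a \<in> smooth_functions A"
proof (rule smooth_functionsI[OF A])
  fix p
  obtain W g where W: "open W" "p \<in> W" "g \<in> smooth_functions A" "\<forall>x\<in>W. a x = g x"
    using assms(2) by blast
  obtain U \<phi> where U: "(U, \<phi>) \<in> A" "p \<in> U" using atlas_chart_at[OF A] .
  have op: "open (W \<inter> U)" using W(1) atlas_chart(1)[OF A U(1)] by auto
  have "smooth_on (\<phi> ` (W \<inter> U)) (g \<circ> inv_into U \<phi>)"
    using smooth_function_in_chart[OF W(3) U(1)] by (rule smooth_on_subset) auto
  then have "smooth_on (\<phi> ` (W \<inter> U)) (a \<circ> inv_into U \<phi>)"
    by (rule smooth_on_cong[OF chart_open_image[OF A U(1) op], rotated 2])
       (use W(4) in \<open>auto simp: chart_inv[OF A U(1)]\<close>)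
  then show "\<exists>U \<phi> W. (U, \<phi>) \<in> A \<and> open W \<and> p \<in> W \<and> W \<subseteq> U \<and> smooth_on (\<phi> ` W) (a \<circ> inv_into U \<phi>)"
    using U W(2) op by blast
qed

lemma smooth_functions_const: "(\<lambda>_. c) \<in> smooth_functions A"
  by (auto simp: smooth_functions_def o_def smooth_on_const)

lemma smooth_functions_0: "0 \<in> smooth_functions A" and smooth_functions_1: "1 \<in> smooth_functions A"
  using smooth_functions_const[of 0] smooth_functions_const[of 1] by (simp_all add: zero_fun_def one_fun_def)

lemma smooth_functions_add:
  assumes "smooth_atlas A" "a \<in> smooth_functions A" "b \<in> smooth_functions A"
  shows "a + b \<in> smooth_functions A"
  unfolding smooth_functions_def
proof clarify
  fix U \<phi> assume U: "(U, \<phi>) \<in> A"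
  have "smooth_on (\<phi> ` U) (\<lambda>y. (a \<circ> inv_into U \<phi>) y + (b \<circ> inv_into U \<phi>) y)"
    by (intro smooth_on_add atlas_chart(2)[OF assms(1) U] smooth_function_in_chart[OF _ U] assms)
  then show "smooth_on (\<phi> ` U) (a + b \<circ> inv_into U \<phi>)" by (simp add: o_def)
qed

lemma smooth_functions_mult:
  assumes "smooth_atlas A" "a \<in> smooth_functions A" "b \<in> smooth_functions A"
  shows "a * b \<in> smooth_functions A"
  unfolding smooth_functions_def
proof clarify
  fix U \<phi> assume U: "(U, \<phi>) \<in> A"
  have "smooth_on (\<phi> ` U) (\<lambda>y. (a \<circ> inv_into U \<phi>) y * (b \<circ> inv_into U \<phi>) y)"
    by (intro smooth_on_bilinear[OF _ bounded_bilinear_mult] atlas_chart(2)[OF assms(1) U]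
        smooth_function_in_chart[OF _ U] assms)
  then show "smooth_on (\<phi> ` U) (a * b \<circ> inv_into U \<phi>)" by (simp add: o_def)
qed

lemma smooth_functions_uminus:
  assumes "smooth_atlas A" "a \<in> smooth_functions A"
  shows "- a \<in> smooth_functions A"
proof -
  have "(\<lambda>_. -1) * a \<in> smooth_functions A"
    by (intro smooth_functions_mult smooth_functions_const assms)
  moreover have "(\<lambda>_. -1) * a = - a" by (auto simp: fun_eq_iff)
  ultimately show ?thesis by simp
qed

lemma smooth_functions_diff:
  assumes "smooth_atlas A" "a \<in> smooth_functions A" "b \<in> smooth_functions A"
  shows "a - b \<in> smooth_functions A"
  using smooth_functions_add[OF assms(1,2) smooth_functions_uminus[OF assms(1,3)]] by simp

lemma sum_fun_apply: "(\<Sum>i\<in>I. f i) x = (\<Sum>i\<in>I. f i x :: complex)"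
  by (induction I rule: infinite_finite_induct) simp_all

lemma smooth_functions_sum:
  assumes "smooth_atlas A" "\<And>i. i \<in> I \<Longrightarrow> f i \<in> smooth_functions A"
  shows "(\<Sum>i\<in>I. f i) \<in> smooth_functions A"
  using assms(2)
  by (induction I rule: infinite_finite_induct)
     (simp_all add: smooth_functions_0 smooth_functions_add[OF assms(1)])

lemma smooth_functions_pullback:
  fixes AM :: "('m::{t2_space,second_countable_topology}, 'e::real_inner) chart set"
    and AP :: "('p::{t2_space,second_countable_topology}, 'f::real_inner) chart set"
  assumes AM: "smooth_atlas AM" and AP: "smooth_atlas AP" and F: "smooth_map AP AM F"
    and a: "a \<in> smooth_functions AM"
  shows "a \<circ> F \<in> smooth_functions AP"
proof (rule smooth_functionsI[OF AP])
  fix q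
  obtain C :: "'e set" where C: "parseval_frame C" using atlas_parseval_frame[OF AM] .
  obtain V \<psi> where V: "(V, \<psi>) \<in> AP" "q \<in> V" using atlas_chart_at[OF AP] .
  obtain U \<phi> where U: "(U, \<phi>) \<in> AM" "F q \<in> U" using atlas_chart_at[OF AM] .
  define W where "W = V \<inter> F -` U"
  have "open (F -` U)"
    using F atlas_chart(1)[OF AM U(1)] unfolding smooth_map_def by (simp add: open_vimage)
  then have W: "open W" "W \<subseteq> V" using atlas_chart(1)[OF AP V(1)] by (auto simp: W_def)
  have op: "open (\<psi> ` W)" by (rule chart_open_image[OF AP V(1) W])
  have "smooth_on (\<psi> ` W) (\<phi> \<circ> F \<circ> inv_into V \<psi>)"
    using F V(1) U(1) unfolding smooth_map_def W_def by blast
  then have "smooth_on (\<psi> ` W) ((a \<circ> inv_into U \<phi>) \<circ> (\<phi> \<circ> F \<circ> inv_into V \<psi>))"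
    by (intro smooth_on_compose[OF op atlas_chart(2)[OF AM U(1)] _ C smooth_function_in_chart[OF a U(1)]])
       (auto simp: W_def chart_inv[OF AP V(1)])
  then have "smooth_on (\<psi> ` W) (a \<circ> F \<circ> inv_into V \<psi>)"
    by (rule smooth_on_cong[OF op, rotated])
       (auto simp: W_def chart_inv[OF AP V(1)] chart_inv[OF AM U(1)])
  then show "\<exists>V \<psi> W. (V, \<psi>) \<in> AP \<and> open W \<and> q \<in> W \<and> W \<subseteq> V \<and> smooth_on (\<psi> ` W) (a \<circ> F \<circ> inv_into V \<psi>)"
    using V U W by (intro exI[of _ V] exI[of _ \<psi>] exI[of _ W]) (auto simp: W_def)
qed

text \<open>
  This is how functions given by a formula in one chart become global smooth functions: near a point
  outside the closed set \<open>K\<close> the function vanishes identically.\<close>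

lemma smooth_extension_by_zero:
  assumes A: "smooth_atlas A" and U: "(U, \<phi>) \<in> A" and W: "open W" "W \<subseteq> U"
    and K: "closed K" "K \<subseteq> W"
    and a: "smooth_on (\<phi> ` W) (a \<circ> inv_into U \<phi>)" "\<And>x. x \<notin> K \<Longrightarrow> a x = 0"
  shows "a \<in> smooth_functions A"
proof (rule smooth_functionsI[OF A])
  fix p
  show "\<exists>U \<phi> W. (U, \<phi>) \<in> A \<and> open W \<and> p \<in> W \<and> W \<subseteq> U \<and> smooth_on (\<phi> ` W) (a \<circ> inv_into U \<phi>)"
  proof (cases "p \<in> K")
    case True
    then show ?thesis using U W K(2) a(1) by blast
  next
    case False
    obtain V \<psi> where V: "(V, \<psi>) \<in> A" "p \<in> V" using atlas_chart_at[OF A] .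
    have op: "open (V - K)" using atlas_chart(1)[OF A V(1)] K(1) by auto
    have "smooth_on (\<psi> ` (V - K)) (a \<circ> inv_into V \<psi>)"
      by (rule smooth_on_cong[OF chart_open_image[OF A V(1) op] _ smooth_on_const[of _ 0]])
         (auto simp: chart_inv[OF A V(1)] a(2))
    then show ?thesis using V False op by blast
  qed
qed

text \<open>
  Transport of a cut-off function from the model space.  The set \<open>K\<close> is the preimage of a closed
  ball; it is closed in the manifold because it is compact and the manifold is Hausdorff.\<close>

lemma chart_cutoff:
  fixes A :: "('m::{t2_space,second_countable_topology}, 'e::real_inner) chart set"
  assumes A: "smooth_atlas A" and U: "(U, \<phi>) \<in> A" and N: "open N" and p: "p \<in> U" "p \<in> N"
  obtains \<eta> K e where "0 < e" "\<eta> \<in> smooth_functions A" "closed K" "K \<subseteq> U \<inter> N"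
    "\<And>x. x \<notin> K \<Longrightarrow> \<eta> x = 0" "\<And>x. x \<in> U \<Longrightarrow> \<phi> x \<in> ball (\<phi> p) e \<Longrightarrow> \<eta> x = 1"
proof -
  obtain C :: "'e set" where C: "parseval_frame C" using atlas_parseval_frame[OF A] .
  have hom: "homeomorphism U (\<phi> ` U) \<phi> (inv_into U \<phi>)" by (rule atlas_chart(3)[OF A U])
  have "open (\<phi> ` (U \<inter> N))"
    using atlas_chart(1)[OF A U] N by (intro chart_open_image[OF A U]) auto
  then obtain r where r: "0 < r" "cball (\<phi> p) r \<subseteq> \<phi> ` (U \<inter> N)"
    using p open_contains_cball by (metis IntI image_eqI)
  define e where "e = r / 2"
  have e: "0 < e" "cball (\<phi> p) (2 * e) \<subseteq> \<phi> ` (U \<inter> N)" using r by (auto simp: e_def)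
  obtain \<psi> :: "'e \<Rightarrow> real" where \<psi>: "smooth_on UNIV \<psi>" "\<And>y. y \<in> ball (\<phi> p) e \<Longrightarrow> \<psi> y = 1"
    "\<And>y. y \<notin> cball (\<phi> p) (2 * e) \<Longrightarrow> \<psi> y = 0"
    using ball_cutoff_exists[OF e(1), of "\<phi> p"] by metis
  define K where "K = inv_into U \<phi> ` cball (\<phi> p) (2 * e)"
  have "continuous_on (cball (\<phi> p) (2 * e)) (inv_into U \<phi>)"
    by (rule continuous_on_subset[OF homeomorphism_cont2[OF hom]]) (use e(2) in auto)
  then have K1: "closed K" unfolding K_def
    using compact_cball_finite_dim[OF C] by (intro compact_imp_closed compact_continuous_image)
  have K2: "K \<subseteq> U \<inter> N"
  proof
    fix x assume "x \<in> K"
    then obtain z where "z \<in> U \<inter> N" "x = inv_into U \<phi> (\<phi> z)" using e(2) by (auto simp: K_def)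
    then show "x \<in> U \<inter> N" by (simp add: chart_inv[OF A U])
  qed
  define \<eta> where "\<eta> x = (if x \<in> U then complex_of_real (\<psi> (\<phi> x)) else 0)" for x
  have 0: "\<eta> x = 0" if "x \<notin> K" for x
  proof (cases "x \<in> U")
    case True
    then have "\<phi> x \<notin> cball (\<phi> p) (2 * e)"
      using that chart_inv[OF A U True] unfolding K_def by (metis image_eqI)
    then show ?thesis using \<psi>(3) by (simp add: \<eta>_def)
  qed (simp add: \<eta>_def)
  have "smooth_on (\<phi> ` U) (\<lambda>y. complex_of_real (\<psi> y))"
    by (intro smooth_on_bounded_linear[OF _ bounded_linear_of_real] atlas_chart(2)[OF A U]
        smooth_on_subset[OF \<psi>(1)]) auto
  then have "smooth_on (\<phi> ` U) (\<eta> \<circ> inv_into U \<phi>)"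
    by (rule smooth_on_cong[OF atlas_chart(2)[OF A U], rotated]) (auto simp: \<eta>_def chart_inv[OF A U])
  then have "\<eta> \<in> smooth_functions A"
    using K1 K2 by (intro smooth_extension_by_zero[OF A U atlas_chart(1)[OF A U] order_refl, of K] 0) auto
  moreover have "\<eta> x = 1" if "x \<in> U" "\<phi> x \<in> ball (\<phi> p) e" for x
    using that \<psi>(2) by (simp add: \<eta>_def)
  ultimately show ?thesis using that e(1) K1 K2 0 by blast
qed

lemma bump_function:
  assumes A: "smooth_atlas A" and "open N" "p \<in> N"
  obtains \<eta> where "\<eta> \<in> smooth_functions A" "\<eta> p = 1" "\<And>x. x \<notin> N \<Longrightarrow> \<eta> x = 0"
proof -
  obtain U \<phi> where U: "(U, \<phi>) \<in> A" "p \<in> U" using atlas_chart_at[OF A] .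
  obtain \<eta> K e where "0 < e" "\<eta> \<in> smooth_functions A" "closed K" "K \<subseteq> U \<inter> N"
    "\<And>x. x \<notin> K \<Longrightarrow> \<eta> x = 0" "\<And>x. x \<in> U \<Longrightarrow> \<phi> x \<in> ball (\<phi> p) e \<Longrightarrow> \<eta> x = 1"
    by (rule chart_cutoff[OF A U(1) assms(2) U(2) assms(3)]) (rule that)
  then show ?thesis using that[of \<eta>] U(2) by auto
qed

section \<open>Point derivations and local frames\<close>

definition point_derivation ::
    "('m::topological_space, 'e::real_inner) chart set \<Rightarrow> 'm \<Rightarrow> (('m \<Rightarrow> complex) \<Rightarrow> complex) \<Rightarrow> bool" where
  "point_derivation A p D \<longleftrightarrow>
     (\<forall>a\<in>smooth_functions A. \<forall>b\<in>smooth_functions A. D (a + b) = D a + D b) \<and>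
     (\<forall>c. \<forall>a\<in>smooth_functions A. D ((\<lambda>_. c) * a) = c * D a) \<and>
     (\<forall>a\<in>smooth_functions A. \<forall>b\<in>smooth_functions A. D (a * b) = D a * b p + a p * D b)"

context
  fixes A :: "('m::{t2_space,second_countable_topology}, 'e::real_inner) chart set" and p D
  assumes A: "smooth_atlas A" and D: "point_derivation A p D"
begin

lemma point_derivation_add:
  "a \<in> smooth_functions A \<Longrightarrow> b \<in> smooth_functions A \<Longrightarrow> D (a + b) = D a + D b"
  using D by (simp add: point_derivation_def)

lemma point_derivation_scale:
  "a \<in> smooth_functions A \<Longrightarrow> D ((\<lambda>_. c) * a) = c * D a"
  using D by (simp add: point_derivation_def)

lemma point_derivation_mult:
  "a \<in> smooth_functions A \<Longrightarrow> b \<in> smooth_functions A \<Longrightarrow> D (a * b) = D a * b p + a p * D b"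
  using D by (simp add: point_derivation_def)

lemma point_derivation_const: "D (\<lambda>_. c) = 0"
proof -
  have "D 1 = D 1 * 1 + 1 * D 1"
    using point_derivation_mult[OF smooth_functions_1 smooth_functions_1] by simp
  then have "D 1 = 0" by simp
  moreover have "(\<lambda>_. c) = (\<lambda>_. c) * (1 :: 'm \<Rightarrow> complex)" by (simp add: fun_eq_iff)
  ultimately show ?thesis using point_derivation_scale[OF smooth_functions_1] by (metis mult_zero_right)
qed

lemma point_derivation_0: "D 0 = 0"
  using point_derivation_const[of 0] by (simp add: zero_fun_def)

lemma point_derivation_diff_const:
  assumes "a \<in> smooth_functions A" shows "D (a - (\<lambda>_. c)) = D a"
proof -
  have eq: "a - (\<lambda>_. c) = a + (\<lambda>_. - c)" by (simp add: fun_eq_iff)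
  show ?thesis
    by (simp only: eq point_derivation_add[OF assms smooth_functions_const] point_derivation_const add_0_right)
qed

lemma point_derivation_sum:
  assumes "\<And>i. i \<in> I \<Longrightarrow> f i \<in> smooth_functions A"
  shows "D (\<Sum>i\<in>I. f i) = (\<Sum>i\<in>I. D (f i))"
  using assms
  by (induction I rule: infinite_finite_induct)
     (simp_all add: point_derivation_0 point_derivation_add smooth_functions_sum[OF A])

end

text \<open>
  Both uses of this lemma come from the freedom in D.  With \<open>Y a p\<close> for \<open>D a\<close> it says that
  the \<open>E i\<close> span the vector fields near \<open>p0\<close>, with coefficients \<open>Y (\<xi> i)\<close>; for an arbitrary derivation at
  \<open>p\<close> it says that \<open>D a\<close> depends only on the differential of \<open>a\<close> at \<open>p\<close>.

  The \<open>\<xi> i\<close> and \<open>E i\<close> are the coordinates of a chart and the partial derivatives, cut off so as to be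
  defined globally, and N is the region where the cut-off function is 1.  The expansion of D is
  Hadamard's lemma at \<open>p\<close>: in \<open>a = a(p) + \<Sum>\<^sub>c (\<xi>\<^sub>c - \<xi>\<^sub>c(p)) g\<^sub>c\<close>, the Leibniz rule leaves only
  \<open>D(\<xi>\<^sub>c) g\<^sub>c(p)\<close>, and \<open>g\<^sub>c(p)\<close> is the partial derivative of \<open>a\<close>.\<close>

lemma local_frame:
  fixes A :: "('m::{t2_space,second_countable_topology}, 'e::real_inner) chart set"
  assumes A: "smooth_atlas A"
  obtains I :: "'e set" and \<xi> E N where "finite I" "open N" "p0 \<in> N"
    "\<And>i. \<xi> i \<in> smooth_functions A" "\<And>i. E i \<in> vector_fields A"
    "\<And>p D a. p \<in> N \<Longrightarrow> point_derivation A p D \<Longrightarrow> a \<in> smooth_functions A \<Longrightarrow>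
       D a = (\<Sum>i\<in>I. E i a p * D (\<xi> i))"
proof -
  obtain C :: "'e set" where C: "parseval_frame C" using atlas_parseval_frame[OF A] .
  have fin: "finite C" using C by (simp add: parseval_frame_def)
  obtain U \<phi> where U: "(U, \<phi>) \<in> A" "p0 \<in> U" using atlas_chart_at[OF A] .
  note inv = chart_inv[OF A U(1)] and opU = atlas_chart(1,2)[OF A U(1)]
  obtain \<eta> K e where \<eta>: "0 < e" "\<eta> \<in> smooth_functions A" "closed K" "K \<subseteq> U \<inter> UNIV"
    "\<And>x. x \<notin> K \<Longrightarrow> \<eta> x = 0" "\<And>x. x \<in> U \<Longrightarrow> \<phi> x \<in> ball (\<phi> p0) e \<Longrightarrow> \<eta> x = 1"
    by (rule chart_cutoff[OF A U(1) open_UNIV U(2) UNIV_I]) (rule that)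
  have KU: "K \<subseteq> U" using \<eta>(4) by simp
  then have off: "\<eta> x = 0" if "x \<notin> U" for x using \<eta>(5) that by blast
  define N where "N = {x \<in> U. \<phi> x \<in> ball (\<phi> p0) e}"
  have N: "open N" "p0 \<in> N" "N \<subseteq> U" "\<And>x. x \<in> N \<Longrightarrow> \<eta> x = 1"
    using chart_open_vimage[OF A U(1) open_ball] U(2) \<eta>(1,6) by (auto simp: N_def)
  define \<xi> where "\<xi> c x = \<eta> x * complex_of_real (\<phi> x \<bullet> c)" for c x
  have \<xi>: "\<xi> c \<in> smooth_functions A" for c
  proof (rule smooth_extension_by_zero[OF A U(1) opU(1) order_refl \<eta>(3) KU])
    have "smooth_on (\<phi> ` U) (\<lambda>y. (\<eta> \<circ> inv_into U \<phi>) y * complex_of_real (y \<bullet> c))"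
      by (intro smooth_on_bilinear[OF _ bounded_bilinear_mult] smooth_function_in_chart[OF \<eta>(2) U(1)]
          smooth_on_bounded_linear[OF _ bounded_linear_of_real]
          smooth_on_bounded_linear[OF _ bounded_linear_inner_left] smooth_on_id opU)
    then show "smooth_on (\<phi> ` U) (\<xi> c \<circ> inv_into U \<phi>)"
      by (rule smooth_on_cong[OF opU(2), rotated]) (auto simp: \<xi>_def inv)
  qed (simp add: \<xi>_def \<eta>(5))
  define \<delta> where "\<delta> c a x = frechet_derivative (a \<circ> inv_into U \<phi>) (at (\<phi> x)) c" for c :: 'e and a :: "'m \<Rightarrow> complex" and x
  define E where "E c a = (if a \<in> smooth_functions A then (\<lambda>x. \<eta> x * \<delta> c a x) else 0)" for c a
  have dF: "(a \<circ> inv_into U \<phi> has_derivative (\<lambda>c. \<delta> c a x)) (at (\<phi> x))"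
    if "a \<in> smooth_functions A" "x \<in> U" for a x
    using smooth_on_has_derivative[OF smooth_function_in_chart[OF that(1) U(1)]] that(2)
    by (auto simp: \<delta>_def)
  have \<delta>_eq: "\<delta> c a x = L c" if "(a \<circ> inv_into U \<phi> has_derivative L) (at (\<phi> x))" for a x L c
    using frechet_derivative_at[OF that] by (simp add: \<delta>_def)
  have \<delta>_add: "\<delta> c (a + b) x = \<delta> c a x + \<delta> c b x"
    if "a \<in> smooth_functions A" "b \<in> smooth_functions A" "x \<in> U" for c a b x
    using has_derivative_add[OF dF[OF that(1,3)] dF[OF that(2,3)]]
    by (intro \<delta>_eq) (simp add: o_def)
  have \<delta>_scale: "\<delta> c ((\<lambda>_. z) * a) x = z * \<delta> c a x"
    if "a \<in> smooth_functions A" "x \<in> U" for c a x z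
    using has_derivative_mult_right[OF dF[OF that]]
    by (intro \<delta>_eq) (simp add: o_def)
  have \<delta>_mult: "\<delta> c (a * b) x = \<delta> c a x * b x + a x * \<delta> c b x"
    if "a \<in> smooth_functions A" "b \<in> smooth_functions A" "x \<in> U" for c a b x
    using has_derivative_mult[OF dF[OF that(1,3)] dF[OF that(2,3)]] inv[OF that(3)]
    by (intro \<delta>_eq) (simp add: o_def add.commute)
  have E: "E c \<in> vector_fields A" for c
    unfolding vector_fields_def
  proof (intro CollectI conjI ballI allI impI)
    fix a assume a: "a \<in> smooth_functions A"
    show "E c a \<in> smooth_functions A"
    proof (rule smooth_extension_by_zero[OF A U(1) opU(1) order_refl \<eta>(3) KU])
      have "smooth_on (\<phi> ` U) (\<lambda>y. (\<eta> \<circ> inv_into U \<phi>) y *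
          frechet_derivative (a \<circ> inv_into U \<phi>) (at y) c)"
        by (intro smooth_on_bilinear[OF _ bounded_bilinear_mult] smooth_on_directional_derivative
            smooth_function_in_chart[OF _ U(1)] a \<eta>(2) opU)
      then show "smooth_on (\<phi> ` U) (E c a \<circ> inv_into U \<phi>)"
        by (rule smooth_on_cong[OF opU(2), rotated]) (auto simp: E_def \<delta>_def inv a)
    qed (simp add: E_def a \<eta>(5))
    show "E c ((\<lambda>_. z) * a) = (\<lambda>_. z) * E c a" for z
    proof
      fix x show "E c ((\<lambda>_. z) * a) x = ((\<lambda>_. z) * E c a) x"
        by (cases "x \<in> U")
           (use off[of x] in \<open>auto simp: E_def a smooth_functions_mult[OF A smooth_functions_const] \<delta>_scale\<close>)
    qed
    fix b assume b: "b \<in> smooth_functions A"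
    show "E c (a + b) = E c a + E c b"
    proof
      fix x show "E c (a + b) x = (E c a + E c b) x"
        by (cases "x \<in> U")
           (use off[of x] in \<open>auto simp: E_def a b smooth_functions_add[OF A] \<delta>_add algebra_simps\<close>)
    qed
    show "E c (a * b) = E c a * b + a * E c b"
    proof
      fix x show "E c (a * b) x = (E c a * b + a * E c b) x"
        by (cases "x \<in> U")
           (use off[of x] in \<open>auto simp: E_def a b smooth_functions_mult[OF A] \<delta>_mult algebra_simps\<close>)
    qed
  qed (simp add: E_def)
  have expand: "D a = (\<Sum>c\<in>C. E c a p * D (\<xi> c))"
    if p: "p \<in> N" and D: "point_derivation A p D" and a: "a \<in> smooth_functions A" for p D a
  proof -
    define y0 where "y0 = \<phi> p"
    have pU: "p \<in> U" using p N(3) by blast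
    have "open (\<phi> ` N)" by (rule chart_open_image[OF A U(1) N(1,3)])
    then obtain r where r: "0 < r" "ball y0 r \<subseteq> \<phi> ` N"
      using p open_contains_ball unfolding y0_def by blast
    have "smooth_on (ball y0 r) (a \<circ> inv_into U \<phi>)"
      using smooth_function_in_chart[OF a U(1)] by (rule smooth_on_subset) (use r(2) N(3) in blast)
    then obtain g where g: "\<And>c. smooth_on (ball y0 r) (g c)"
      "\<And>c. g c y0 = frechet_derivative (a \<circ> inv_into U \<phi>) (at y0) c"
      "\<And>y. y \<in> ball y0 r \<Longrightarrow> (a \<circ> inv_into U \<phi>) y = (a \<circ> inv_into U \<phi>) y0 + (\<Sum>c\<in>C. ((y - y0) \<bullet> c) *\<^sub>R g c y)"
      using hadamard[OF C _ r(1)] by blast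
    define N' where "N' = {x \<in> U. \<phi> x \<in> ball y0 r}"
    have N': "open N'" "p \<in> N'" "N' \<subseteq> U"
      using chart_open_vimage[OF A U(1) open_ball] pU r(1) by (auto simp: N'_def y0_def)
    have N'N: "N' \<subseteq> N"
    proof
      fix x assume x: "x \<in> N'"
      then obtain z where "z \<in> N" "\<phi> x = \<phi> z" using r(2) by (auto simp: N'_def)
      then show "x \<in> N" using x inv N(3) by (metis N'(3) subsetD)
    qed
    obtain \<rho> K' e' where \<rho>: "0 < e'" "\<rho> \<in> smooth_functions A" "closed K'" "K' \<subseteq> U \<inter> N'"
      "\<And>x. x \<notin> K' \<Longrightarrow> \<rho> x = 0" "\<And>x. x \<in> U \<Longrightarrow> \<phi> x \<in> ball (\<phi> p) e' \<Longrightarrow> \<rho> x = 1"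
      by (rule chart_cutoff[OF A U(1) N'(1) pU N'(2)]) (rule that)
    have \<rho>p: "\<rho> p = 1" using \<rho>(1,6) pU by simp
    \<comment> \<open>Hadamard's identity holds only near p.  Multiplied by \<open>\<rho>\<^sup>2\<close> it becomes global, one factor \<open>\<rho>\<close> for each of the two functions in every product; D does not see the factor since \<open>\<rho> p = 1\<close>.\<close>
    define h where "h c x = \<rho> x * g c (\<phi> x)" for c x
    define l where "l c = \<rho> * (\<xi> c - (\<lambda>_. complex_of_real (y0 \<bullet> c)))" for c
    have h: "h c \<in> smooth_functions A" for c
    proof (rule smooth_extension_by_zero[OF A U(1) N'(1,3) \<rho>(3)])
      have op: "open (\<phi> ` N')" by (rule chart_open_image[OF A U(1) N'(1,3)])
      have "smooth_on (\<phi> ` N') (\<lambda>y. (\<rho> \<circ> inv_into U \<phi>) y * g c y)"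
        by (intro smooth_on_bilinear[OF op bounded_bilinear_mult] smooth_on_subset[OF g(1)]
            smooth_on_subset[OF smooth_function_in_chart[OF \<rho>(2) U(1)]]) (auto simp: N'_def)
      then show "smooth_on (\<phi> ` N') (h c \<circ> inv_into U \<phi>)"
        by (rule smooth_on_cong[OF op, rotated]) (use N'(3) in \<open>auto simp: h_def inv\<close>)
    qed (use \<rho>(4,5) in \<open>auto simp: h_def\<close>)
    have \<xi>c: "\<xi> c - (\<lambda>_. complex_of_real (y0 \<bullet> c)) \<in> smooth_functions A" for c
      by (intro smooth_functions_diff[OF A] \<xi> smooth_functions_const)
    have l: "l c \<in> smooth_functions A" for c
      unfolding l_def by (intro smooth_functions_mult[OF A] \<rho>(2) \<xi>c)
    have eq: "\<rho> * \<rho> * (a - (\<lambda>_. a p)) = (\<Sum>c\<in>C. l c * h c)"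
    proof
      fix x
      show "(\<rho> * \<rho> * (a - (\<lambda>_. a p))) x = (\<Sum>c\<in>C. l c * h c) x"
      proof (cases "x \<in> K'")
        case True
        then have x: "x \<in> N'" "x \<in> U" "x \<in> N" using \<rho>(4) N'N by auto
        then have "a x = a p + (\<Sum>c\<in>C. ((\<phi> x - y0) \<bullet> c) *\<^sub>R g c (\<phi> x))"
          using g(3)[of "\<phi> x"] by (simp add: N'_def y0_def inv pU)
        then have "(\<rho> * \<rho> * (a - (\<lambda>_. a p))) x
            = (\<Sum>c\<in>C. \<rho> x * \<rho> x * (((\<phi> x - y0) \<bullet> c) *\<^sub>R g c (\<phi> x)))"
          by (simp add: sum_distrib_left)
        also have "\<dots> = (\<Sum>c\<in>C. l c x * h c x)"
          by (rule sum.cong[OF refl])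
             (simp add: l_def h_def \<xi>_def N(4)[OF x(3)] inner_diff_left scaleR_conv_of_real algebra_simps)
        also have "\<dots> = (\<Sum>c\<in>C. l c * h c) x" by (simp add: sum_fun_apply)
        finally show ?thesis .
      qed (simp add: l_def h_def \<rho>(5) sum_fun_apply)
    qed
    have ap: "a - (\<lambda>_. a p) \<in> smooth_functions A"
      by (intro smooth_functions_diff[OF A] a smooth_functions_const)
    have "D (\<rho> * \<rho> * (a - (\<lambda>_. a p))) = D a"
      using point_derivation_mult[OF A D smooth_functions_mult[OF A \<rho>(2) \<rho>(2)] ap]
        point_derivation_diff_const[OF A D a] by (simp add: \<rho>p)
    moreover have "D (\<Sum>c\<in>C. l c * h c) = (\<Sum>c\<in>C. E c a p * D (\<xi> c))"
    proof -
      have "D (l c * h c) = E c a p * D (\<xi> c)" for c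
      proof -
        have 0: "(\<xi> c - (\<lambda>_. complex_of_real (y0 \<bullet> c))) p = 0"
          by (simp add: \<xi>_def N(4)[OF p] y0_def)
        then have "D (l c) = D (\<xi> c)" "l c p = 0" unfolding l_def
          using point_derivation_mult[OF A D \<rho>(2) \<xi>c] point_derivation_diff_const[OF A D \<xi>] by (auto simp: \<rho>p)
        moreover have "h c p = E c a p"
          by (simp add: h_def \<rho>p E_def a N(4)[OF p] \<delta>_def y0_def[symmetric] g(2))
        ultimately show ?thesis using point_derivation_mult[OF A D l h, of c c] by simp
      qed
      then show ?thesis
        using point_derivation_sum[OF A D, of C "\<lambda>c. l c * h c"] smooth_functions_mult[OF A l h] by simp
    qed
    ultimately show ?thesis using eq by simp
  qed
  show ?thesis
    by (rule that[of C N \<xi> E]) (fact fin N(1) N(2) \<xi> E expand)+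
qed

section \<open>Vector fields and tensoriality\<close>

lemma vf_scale_apply: "vf_scale a X b = a * X b"
  by (simp add: vf_scale_def)

lemma lie_bracket_apply: "lie_bracket X Y a = X (Y a) - Y (X a)"
  by (simp add: lie_bracket_def)

lemma vf_scale_minus1: "vf_scale (\<lambda>_. -1) X = - X"
  by (auto simp: vf_scale_def fun_eq_iff)

context
  fixes A :: "('m::{t2_space,second_countable_topology}, 'e::real_inner) chart set"
  assumes A: "smooth_atlas A"
begin

lemma vf_closed: "X \<in> vector_fields A \<Longrightarrow> a \<in> smooth_functions A \<Longrightarrow> X a \<in> smooth_functions A"
  and vf_additive: "X \<in> vector_fields A \<Longrightarrow> a \<in> smooth_functions A \<Longrightarrow> b \<in> smooth_functions A \<Longrightarrow>
    X (a + b) = X a + X b"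
  and vf_homogeneous: "X \<in> vector_fields A \<Longrightarrow> a \<in> smooth_functions A \<Longrightarrow> X ((\<lambda>_. c) * a) = (\<lambda>_. c) * X a"
  and vf_leibniz: "X \<in> vector_fields A \<Longrightarrow> a \<in> smooth_functions A \<Longrightarrow> b \<in> smooth_functions A \<Longrightarrow>
    X (a * b) = X a * b + a * X b"
  and vf_nonsmooth: "X \<in> vector_fields A \<Longrightarrow> a \<notin> smooth_functions A \<Longrightarrow> X a = 0"
  by (simp_all add: vector_fields_def)

lemma vf_point_derivation:
  assumes "X \<in> vector_fields A"
  shows "point_derivation A p (\<lambda>a. X a p)"
  using vf_additive[OF assms] vf_homogeneous[OF assms] vf_leibniz[OF assms]
  by (simp add: point_derivation_def)

lemma vf_eqI:
  assumes "X \<in> vector_fields A" "Y \<in> vector_fields A"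
    and "\<And>a x. a \<in> smooth_functions A \<Longrightarrow> X a x = Y a x"
  shows "X = Y"
proof (intro ext)
  fix a x show "X a x = Y a x"
    using assms(3) vf_nonsmooth[OF assms(1)] vf_nonsmooth[OF assms(2)]
    by (cases "a \<in> smooth_functions A") simp_all
qed

lemma vf_of_0: "X \<in> vector_fields A \<Longrightarrow> X 0 = 0"
  using vf_homogeneous[OF _ smooth_functions_0, of X 0] by (simp add: zero_fun_def[symmetric])

lemma vector_fields_add:
  assumes "X \<in> vector_fields A" "Y \<in> vector_fields A"
  shows "X + Y \<in> vector_fields A"
  using assms unfolding vector_fields_def
  by (auto simp: algebra_simps intro: smooth_functions_add[OF A])

lemma vector_fields_scale:
  assumes "a \<in> smooth_functions A" "X \<in> vector_fields A"
  shows "vf_scale a X \<in> vector_fields A"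
  using assms unfolding vector_fields_def vf_scale_def
  by (auto simp: algebra_simps intro: smooth_functions_mult[OF A])

lemma vector_fields_uminus:
  "X \<in> vector_fields A \<Longrightarrow> - X \<in> vector_fields A"
  using vector_fields_scale[OF smooth_functions_const, of X "-1"] by (simp add: vf_scale_minus1)

lemma vector_fields_diff:
  "X \<in> vector_fields A \<Longrightarrow> Y \<in> vector_fields A \<Longrightarrow> X - Y \<in> vector_fields A"
  using vector_fields_add[OF _ vector_fields_uminus] by fastforce

lemma vector_fields_0: "0 \<in> vector_fields A"
  by (auto simp: vector_fields_def smooth_functions_0)

lemma vector_fields_sum:
  assumes "\<And>i. i \<in> I \<Longrightarrow> X i \<in> vector_fields A"
  shows "(\<Sum>i\<in>I. X i) \<in> vector_fields A"
  using assms
  by (induction I rule: infinite_finite_induct) (simp_all add: vector_fields_0 vector_fields_add)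

lemma vector_fields_lie_bracket:
  assumes X: "X \<in> vector_fields A" and Y: "Y \<in> vector_fields A"
  shows "lie_bracket X Y \<in> vector_fields A"
  unfolding vector_fields_def lie_bracket_def
proof (intro CollectI conjI ballI allI impI)
  note simps = vf_closed[OF X] vf_closed[OF Y] vf_additive[OF X] vf_additive[OF Y]
    vf_homogeneous[OF X] vf_homogeneous[OF Y] vf_leibniz[OF X] vf_leibniz[OF Y]
    smooth_functions_mult[OF A] smooth_functions_diff[OF A]
  fix a assume a: "a \<in> smooth_functions A"
  show "X (Y a) - Y (X a) \<in> smooth_functions A" by (simp add: simps a)
  show "X (Y ((\<lambda>_. c) * a)) - Y (X ((\<lambda>_. c) * a)) = (\<lambda>_. c) * (X (Y a) - Y (X a))" for c
    by (simp add: simps a right_diff_distrib)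
  fix b assume b: "b \<in> smooth_functions A"
  show "X (Y (a + b)) - Y (X (a + b)) = X (Y a) - Y (X a) + (X (Y b) - Y (X b))"
    by (simp add: simps a b)
  show "X (Y (a * b)) - Y (X (a * b)) = (X (Y a) - Y (X a)) * b + a * (X (Y b) - Y (X b))"
    by (simp add: simps a b algebra_simps)
qed (simp add: vf_nonsmooth[OF X] vf_nonsmooth[OF Y] vf_of_0[OF X] vf_of_0[OF Y])

text \<open>
  The reason why uniqueness and flatness can be tested on Hamiltonian vector fields: a map on
  vector fields that is linear over functions, in the weak sense of evaluating them at \<open>p\<close>, sees only
  the tangent vector at \<open>p\<close>.  If \<open>Z = X - Y\<close> vanishes at \<open>p\<close>, then near \<open>p\<close> it is a combination of the
  frame fields whose coefficients \<open>Z (\<xi> i)\<close> vanish at \<open>p\<close>.\<close>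

lemma tensorial_at_point:
  fixes T :: "'m vfield \<Rightarrow> complex"
  assumes T_add: "\<And>X Y. X \<in> vector_fields A \<Longrightarrow> Y \<in> vector_fields A \<Longrightarrow> T (X + Y) = T X + T Y"
    and T_scale: "\<And>a X. a \<in> smooth_functions A \<Longrightarrow> X \<in> vector_fields A \<Longrightarrow> T (vf_scale a X) = a p * T X"
    and X: "X \<in> vector_fields A" and Y: "Y \<in> vector_fields A"
    and eq: "\<And>a. a \<in> smooth_functions A \<Longrightarrow> X a p = Y a p"
  shows "T X = T Y"
proof -
  define Z where "Z = X - Y"
  have Z: "Z \<in> vector_fields A" unfolding Z_def by (rule vector_fields_diff[OF X Y])
  obtain I :: "'e set" and \<xi> E N where F: "finite I" "open N" "p \<in> N"
    "\<And>i. \<xi> i \<in> smooth_functions A" "\<And>i. E i \<in> vector_fields A"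
    "\<And>p D a. p \<in> N \<Longrightarrow> point_derivation A p D \<Longrightarrow> a \<in> smooth_functions A \<Longrightarrow>
       D a = (\<Sum>i\<in>I. E i a p * D (\<xi> i))"
    by (rule local_frame[OF A, of p]) (rule that)
  obtain \<eta> where \<eta>: "\<eta> \<in> smooth_functions A" "\<eta> p = 1" "\<And>x. x \<notin> N \<Longrightarrow> \<eta> x = 0"
    by (rule bump_function[OF A F(2,3)]) (rule that)
  have coeff: "\<eta> * Z (\<xi> i) \<in> smooth_functions A" for i
    by (intro smooth_functions_mult[OF A] \<eta>(1) vf_closed[OF Z] F(4))
  have T_0: "T 0 = 0" using T_add[OF vector_fields_0 vector_fields_0] by simp
  have T_sum: "T (\<Sum>i\<in>J. V i) = (\<Sum>i\<in>J. T (V i))" if "\<And>i. V i \<in> vector_fields A" for V and J :: "'e set"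
  proof (induction J rule: infinite_finite_induct)
    case (insert i J)
    have "sum V J \<in> vector_fields A" by (rule vector_fields_sum) (rule that)
    from T_add[OF that this] show ?case
      by (simp only: sum.insert[OF insert.hyps] insert.IH)
  qed (simp_all only: sum.infinite sum.empty T_0 not_False_eq_True)
  \<comment> \<open>The cut-off function makes the local expansion of Z a global identity without changing the value of T.\<close>
  have "vf_scale \<eta> Z = (\<Sum>i\<in>I. vf_scale (\<eta> * Z (\<xi> i)) (E i))"
  proof (rule vf_eqI)
    fix a x assume a: "a \<in> smooth_functions A"
    have "(\<Sum>i\<in>J. vf_scale (\<eta> * Z (\<xi> i)) (E i)) a x = (\<Sum>i\<in>J. \<eta> x * (E i a x * Z (\<xi> i) x))" for J
      by (induction J rule: infinite_finite_induct) (simp_all add: vf_scale_def mult_ac)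
    moreover have "\<eta> x * Z a x = \<eta> x * (\<Sum>i\<in>I. E i a x * Z (\<xi> i) x)"
      using F(6)[OF _ vf_point_derivation[OF Z] a, of x] \<eta>(3)[of x] by (cases "x \<in> N") auto
    ultimately show "vf_scale \<eta> Z a x = (\<Sum>i\<in>I. vf_scale (\<eta> * Z (\<xi> i)) (E i)) a x"
      by (simp add: vf_scale_def sum_distrib_left)
  qed (intro vector_fields_scale vector_fields_sum \<eta>(1) Z coeff F(5))+
  then have "T (vf_scale \<eta> Z) = (\<Sum>i\<in>I. T (vf_scale (\<eta> * Z (\<xi> i)) (E i)))"
    using T_sum[OF vector_fields_scale[OF coeff F(5)]] by simp
  also have "\<dots> = 0"
  proof (rule sum.neutral, rule ballI)
    show "T (vf_scale (\<eta> * Z (\<xi> i)) (E i)) = 0" for i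
      unfolding T_scale[OF coeff F(5)] using eq[OF F(4), of i] by (simp add: Z_def)
  qed
  finally have "T Z = 0" using T_scale[OF \<eta>(1) Z] \<eta>(2) by simp
  moreover have "T X = T Z + T Y" using T_add[OF Z Y] by (simp add: Z_def)
  ultimately show ?thesis by simp
qed

end

section \<open>Hamiltonian vector fields of a symplectic form\<close>

text \<open>
  The relation between form and bracket inside \<open>symplectic_bracket\<close>, with the form named.\<close>

definition bracket_of_form ::
    "('m::topological_space, 'e::real_inner) chart set \<Rightarrow> ('m vfield \<Rightarrow> 'm vfield \<Rightarrow> ('m \<Rightarrow> complex)) \<Rightarrow>
     (('m \<Rightarrow> complex) \<Rightarrow> ('m \<Rightarrow> complex) \<Rightarrow> ('m \<Rightarrow> complex)) \<Rightarrow> bool" where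
  "bracket_of_form A \<omega> br \<longleftrightarrow> symplectic_form A \<omega> \<and>
     (\<forall>a\<in>smooth_functions A. hamiltonian_vf A br a \<in> vector_fields A \<and>
        (\<forall>Y\<in>vector_fields A. \<omega> (hamiltonian_vf A br a) Y = Y a))"

text \<open>
  The covector that the form associates with X at \<open>p\<close> is the differential of \<open>b\<close>.  By nondegeneracy
  this means that X and the Hamiltonian vector field of \<open>b\<close> agree at \<open>p\<close> (\<open>potential_bracket\<close>).\<close>

definition potential_at ::
    "('m::topological_space, 'e::real_inner) chart set \<Rightarrow> ('m vfield \<Rightarrow> 'm vfield \<Rightarrow> ('m \<Rightarrow> complex)) \<Rightarrow>
     'm \<Rightarrow> 'm vfield \<Rightarrow> ('m \<Rightarrow> complex) \<Rightarrow> bool" where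
  "potential_at A \<omega> p X b \<longleftrightarrow> b \<in> smooth_functions A \<and> (\<forall>Y\<in>vector_fields A. Y b p = \<omega> X Y p)"

context
  fixes A :: "('m::{t2_space,second_countable_topology}, 'e::real_inner) chart set" and \<omega> br
  assumes A: "smooth_atlas A" and \<omega>: "bracket_of_form A \<omega> br"
begin

lemma hamiltonian_vector_field: "a \<in> smooth_functions A \<Longrightarrow> hamiltonian_vf A br a \<in> vector_fields A"
  and form_hamiltonian: "a \<in> smooth_functions A \<Longrightarrow> Y \<in> vector_fields A \<Longrightarrow> \<omega> (hamiltonian_vf A br a) Y = Y a"
  using \<omega> unfolding bracket_of_form_def by blast+

lemma form_closed: "X \<in> vector_fields A \<Longrightarrow> Y \<in> vector_fields A \<Longrightarrow> \<omega> X Y \<in> smooth_functions A"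
  and form_add: "X \<in> vector_fields A \<Longrightarrow> Y \<in> vector_fields A \<Longrightarrow> Z \<in> vector_fields A \<Longrightarrow>
     \<omega> (X + Y) Z = \<omega> X Z + \<omega> Y Z"
  and form_scale: "a \<in> smooth_functions A \<Longrightarrow> X \<in> vector_fields A \<Longrightarrow> Y \<in> vector_fields A \<Longrightarrow>
     \<omega> (vf_scale a X) Y = a * \<omega> X Y"
  and form_antisym: "X \<in> vector_fields A \<Longrightarrow> Y \<in> vector_fields A \<Longrightarrow> \<omega> X Y = - \<omega> Y X"
  and form_nondegenerate: "X \<in> vector_fields A \<Longrightarrow> (\<And>Y. Y \<in> vector_fields A \<Longrightarrow> \<omega> X Y p = 0) \<Longrightarrow>
     a \<in> smooth_functions A \<Longrightarrow> X a p = 0"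
  using \<omega> unfolding bracket_of_form_def symplectic_form_def by blast+

lemma form_diff:
  assumes "X \<in> vector_fields A" "Y \<in> vector_fields A" "Z \<in> vector_fields A"
  shows "\<omega> (X - Y) Z = \<omega> X Z - \<omega> Y Z"
  using form_add[OF vector_fields_diff[OF A assms(1,2)] assms(2,3)] by simp

text \<open>
  At \<open>p\<close> the field Y agrees with the combination of the \<open>E i\<close> with constant coefficients \<open>Y (\<xi> i) p\<close>, and
  \<open>\<omega> X\<close> is tensorial.\<close>

lemma form_in_frame:
  assumes "finite I" "\<And>i. \<xi> i \<in> smooth_functions A" "\<And>i. E i \<in> vector_fields A"
    and expand: "\<And>D a. point_derivation A p D \<Longrightarrow> a \<in> smooth_functions A \<Longrightarrow> D a = (\<Sum>i\<in>I. E i a p * D (\<xi> i))"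
    and X: "X \<in> vector_fields A" and Y: "Y \<in> vector_fields A"
  shows "\<omega> X Y p = (\<Sum>i\<in>I. Y (\<xi> i) p * \<omega> X (E i) p)"
proof -
  define V where "V J = (\<Sum>i\<in>J. vf_scale (\<lambda>_. Y (\<xi> i) p) (E i))" for J
  have sc: "vf_scale (\<lambda>_. Y (\<xi> i) p) (E i) \<in> vector_fields A" for i
    by (intro vector_fields_scale[OF A] smooth_functions_const assms)
  have V: "V J \<in> vector_fields A" for J unfolding V_def by (intro vector_fields_sum[OF A] sc)
  have VI: "V {} = 0" "finite J \<Longrightarrow> i \<notin> J \<Longrightarrow> V (insert i J) = vf_scale (\<lambda>_. Y (\<xi> i) p) (E i) + V J" for i J
    by (simp_all add: V_def)
  have V_apply: "V J a p = (\<Sum>i\<in>J. Y (\<xi> i) p * E i a p)" if "finite J" for J a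
    using that by (induction J) (simp_all add: VI vf_scale_def)
  \<comment> \<open>Linearity over functions is available in the first argument of the form, so its arguments are swapped.\<close>
  have "- \<omega> Y X p = - \<omega> (V I) X p"
  proof (rule tensorial_at_point[OF A, where T = "\<lambda>Y. - \<omega> Y X p", OF _ _ Y V])
    show "Y a p = V I a p" if "a \<in> smooth_functions A" for a
      using expand[OF vf_point_derivation[OF A Y] that] by (simp add: V_apply[OF assms(1)] mult.commute)
  qed (simp_all add: form_add form_scale X)
  also have "- \<omega> (V J) X p = (\<Sum>i\<in>J. Y (\<xi> i) p * \<omega> X (E i) p)" if "finite J" for J
    using that
  proof (induction J)
    case empty
    have "\<omega> (0 + 0) X = \<omega> 0 X + \<omega> 0 X" by (rule form_add[OF vector_fields_0[OF A] vector_fields_0[OF A] X])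
    then have "\<omega> 0 X = 0" by (simp only: add_0_left add_cancel_right_right)
    then have "\<omega> (V {}) X p = 0" by (simp only: VI zero_fun_apply)
    then show ?case by simp
  next
    case (insert i J)
    have "\<omega> (V (insert i J)) X = (\<lambda>_. Y (\<xi> i) p) * \<omega> (E i) X + \<omega> (V J) X"
      by (simp only: VI(2)[OF insert.hyps] form_add[OF sc V X] form_scale[OF smooth_functions_const assms(3) X])
    then show ?case
      using insert form_antisym[OF X assms(3), of i] by simp
  qed
  finally show ?thesis using form_antisym[OF X Y] assms(1) by simp
qed

text \<open>
  The one-form \<open>\<omega> X\<close> at \<open>p\<close> is the combination of the differentials of the \<open>\<xi> i\<close> with coefficients
  \<open>\<omega> X (E i) p\<close>.  This potential is explicit, and its coefficients depend smoothly on \<open>p\<close>; that is what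
  makes the lifted vector field smooth.\<close>

lemma frame_potential:
  assumes I: "finite I" and \<xi>: "\<And>i. \<xi> i \<in> smooth_functions A" and E: "\<And>i. E i \<in> vector_fields A"
    and expand: "\<And>D a. point_derivation A p D \<Longrightarrow> a \<in> smooth_functions A \<Longrightarrow> D a = (\<Sum>i\<in>I. E i a p * D (\<xi> i))"
    and X: "X \<in> vector_fields A"
  shows "potential_at A \<omega> p X (\<Sum>i\<in>I. (\<lambda>_. \<omega> X (E i) p) * \<xi> i)"
  unfolding potential_at_def
proof (intro conjI ballI)
  have coef: "(\<lambda>_. \<omega> X (E i) p) * \<xi> i \<in> smooth_functions A" for i
    by (intro smooth_functions_mult[OF A] smooth_functions_const \<xi>)
  then show "(\<Sum>i\<in>I. (\<lambda>_. \<omega> X (E i) p) * \<xi> i) \<in> smooth_functions A"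
    by (intro smooth_functions_sum[OF A])
  fix Y assume Y: "Y \<in> vector_fields A"
  note D = vf_point_derivation[OF A Y, of p]
  show "Y (\<Sum>i\<in>I. (\<lambda>_. \<omega> X (E i) p) * \<xi> i) p = \<omega> X Y p"
    using point_derivation_sum[OF A D coef, of "\<lambda>i. i" I] point_derivation_scale[OF A D \<xi>]
    by (simp add: form_in_frame[OF I \<xi> E expand X Y]) (simp add: mult.commute)
qed

lemma potential_exists:
  assumes "X \<in> vector_fields A"
  obtains b where "potential_at A \<omega> p X b"
proof -
  obtain I :: "'e set" and \<xi> E N where F: "finite I" "open N" "p \<in> N"
    "\<And>i. \<xi> i \<in> smooth_functions A" "\<And>i. E i \<in> vector_fields A"
    "\<And>p D a. p \<in> N \<Longrightarrow> point_derivation A p D \<Longrightarrow> a \<in> smooth_functions A \<Longrightarrow>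
       D a = (\<Sum>i\<in>I. E i a p * D (\<xi> i))"
    by (rule local_frame[OF A, of p]) (rule that)
  show ?thesis by (rule that, rule frame_potential[OF F(1,4,5) F(6)[OF F(3)] assms])
qed

lemma potential_of_hamiltonian:
  "a \<in> smooth_functions A \<Longrightarrow> potential_at A \<omega> p (hamiltonian_vf A br a) a"
  by (simp add: potential_at_def form_hamiltonian)

text \<open>
  The difference of X and the Hamiltonian vector field of \<open>b\<close> pairs to 0 at \<open>p\<close> with every vector field,
  hence vanishes at \<open>p\<close> by nondegeneracy.\<close>

lemma potential_bracket:
  assumes X: "X \<in> vector_fields A" and b: "potential_at A \<omega> p X b" and a: "a \<in> smooth_functions A"
  shows "X a p = br b a p"
proof -
  have bs: "b \<in> smooth_functions A" using b by (simp add: potential_at_def)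
  note H = hamiltonian_vector_field[OF bs] form_hamiltonian[OF bs]
  have "(X - hamiltonian_vf A br b) a p = 0"
  proof (rule form_nondegenerate[OF vector_fields_diff[OF A X H(1)] _ a])
    show "\<omega> (X - hamiltonian_vf A br b) Y p = 0" if "Y \<in> vector_fields A" for Y
      using b that by (simp add: form_diff[OF X H(1)] H(2) potential_at_def)
  qed
  then show ?thesis using a by (simp add: hamiltonian_vf_def)
qed

end

section \<open>The connection of a natural semi-Poisson bracket\<close>

text \<open>
  At each point X is replaced by a Hamiltonian vector field with the same value there.  A new
  potential is chosen for every point, because \<open>\<omega> X\<close> has no common potential near a point unless it is
  closed; the result is independent of the choices by \<open>lift_eq\<close>.\<close>

definition hamiltonian_lift ::
    "('m::topological_space, 'e::real_inner) chart set \<Rightarrow> ('p::topological_space, 'f::real_inner) chart set \<Rightarrow>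
     ('p \<Rightarrow> 'm) \<Rightarrow> ('m vfield \<Rightarrow> 'm vfield \<Rightarrow> ('m \<Rightarrow> complex)) \<Rightarrow>
     (('m \<Rightarrow> complex) \<Rightarrow> ('p \<Rightarrow> complex) \<Rightarrow> ('p \<Rightarrow> complex)) \<Rightarrow> 'm vfield \<Rightarrow> 'p vfield" where
  "hamiltonian_lift AM AP pr \<omega> sb X f =
     (if X \<in> vector_fields AM \<and> f \<in> smooth_functions AP
      then (\<lambda>q. sb (SOME b. potential_at AM \<omega> (pr q) X b) f q) else 0)"

context
  fixes AM :: "('m::{t2_space,second_countable_topology}, 'e::real_inner) chart set"
    and AP :: "('p::{t2_space,second_countable_topology}, 'f::real_inner) chart set"
    and pr :: "'p \<Rightarrow> 'm" and br sb \<omega>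
  assumes AM: "smooth_atlas AM" and AP: "smooth_atlas AP"
    and pr_smooth: "smooth_map AP AM pr" and pr_surj: "surj pr"
    and \<omega>: "bracket_of_form AM \<omega> br"
    and semi: "semi_poisson_bracket AM AP pr br sb" and nat: "natural_bracket AM AP sb"
begin

lemma sb_closed: "a \<in> smooth_functions AM \<Longrightarrow> f \<in> smooth_functions AP \<Longrightarrow> sb a f \<in> smooth_functions AP"
  and sb_add_left: "a \<in> smooth_functions AM \<Longrightarrow> b \<in> smooth_functions AM \<Longrightarrow> f \<in> smooth_functions AP \<Longrightarrow>
     sb (a + b) f = sb a f + sb b f"
  and sb_add_right: "a \<in> smooth_functions AM \<Longrightarrow> f \<in> smooth_functions AP \<Longrightarrow> g \<in> smooth_functions AP \<Longrightarrow>
     sb a (f + g) = sb a f + sb a g"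
  and sb_scale_left: "a \<in> smooth_functions AM \<Longrightarrow> f \<in> smooth_functions AP \<Longrightarrow> sb ((\<lambda>_. z) * a) f = (\<lambda>_. z) * sb a f"
  and sb_scale_right: "a \<in> smooth_functions AM \<Longrightarrow> f \<in> smooth_functions AP \<Longrightarrow> sb a ((\<lambda>_. z) * f) = (\<lambda>_. z) * sb a f"
  and sb_leibniz_left: "a \<in> smooth_functions AM \<Longrightarrow> b \<in> smooth_functions AM \<Longrightarrow> f \<in> smooth_functions AP \<Longrightarrow>
     sb (a * b) f = (a \<circ> pr) * sb b f + (b \<circ> pr) * sb a f"
  and sb_leibniz_pullback: "a \<in> smooth_functions AM \<Longrightarrow> b \<in> smooth_functions AM \<Longrightarrow> f \<in> smooth_functions AP \<Longrightarrow>
     sb a ((b \<circ> pr) * f) = (br a b \<circ> pr) * f + (b \<circ> pr) * sb a f"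
  and sb_jacobi: "a \<in> smooth_functions AM \<Longrightarrow> b \<in> smooth_functions AM \<Longrightarrow> f \<in> smooth_functions AP \<Longrightarrow>
     sb a (sb b f) - sb b (sb a f) = sb (br a b) f"
  using semi unfolding semi_poisson_bracket_def right_minus_eq by blast+

lemma sb_natural: "a \<in> smooth_functions AM \<Longrightarrow> f \<in> smooth_functions AP \<Longrightarrow> g \<in> smooth_functions AP \<Longrightarrow>
     sb a (f * g) = sb a f * g + sb a g * f"
  using nat unfolding natural_bracket_def by blast

lemma pullback_smooth: "a \<in> smooth_functions AM \<Longrightarrow> a \<circ> pr \<in> smooth_functions AP"
  by (rule smooth_functions_pullback[OF AM AP pr_smooth])

text \<open>
  By naturality \<open>sb a\<close> is a derivation, so it annihilates 1, and the rule for products with pull-backs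
  applies with \<open>f = 1\<close>.\<close>

lemma sb_pullback:
  assumes a: "a \<in> smooth_functions AM" and b: "b \<in> smooth_functions AM"
  shows "sb a (b \<circ> pr) = br a b \<circ> pr"
proof -
  have "sb a 1 = sb a 1 + sb a 1" using sb_natural[OF a smooth_functions_1 smooth_functions_1] by simp
  then have "sb a 1 = 0" by (metis add_cancel_right_right)
  then show ?thesis using sb_leibniz_pullback[OF a b smooth_functions_1] by simp
qed

lemma bracket_closed: "a \<in> smooth_functions AM \<Longrightarrow> b \<in> smooth_functions AM \<Longrightarrow> br a b \<in> smooth_functions AM"
  using vf_closed[OF AM hamiltonian_vector_field[OF AM \<omega>], of a b] by (simp add: hamiltonian_vf_def)

text \<open>
  The third rule of a semi-Poisson bracket, applied to pull-backs, contains the Jacobi identity of the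
  base, because functions on the base can be compared after pulling them back along the surjective
  projection.\<close>

lemma hamiltonian_lie_bracket:
  assumes a: "a \<in> smooth_functions AM" and b: "b \<in> smooth_functions AM"
  shows "lie_bracket (hamiltonian_vf AM br a) (hamiltonian_vf AM br b) = hamiltonian_vf AM br (br a b)"
proof (rule vf_eqI[OF AM])
  show "lie_bracket (hamiltonian_vf AM br a) (hamiltonian_vf AM br b) \<in> vector_fields AM"
    by (intro vector_fields_lie_bracket[OF AM] hamiltonian_vector_field[OF AM \<omega>] a b)
  show "hamiltonian_vf AM br (br a b) \<in> vector_fields AM" by (intro hamiltonian_vector_field[OF AM \<omega>] bracket_closed a b)
  fix c x assume c: "c \<in> smooth_functions AM"
  obtain q where q: "x = pr q" using pr_surj by blast
  have "(sb a (sb b (c \<circ> pr)) - sb b (sb a (c \<circ> pr))) q = sb (br a b) (c \<circ> pr) q"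
    using sb_jacobi[OF a b pullback_smooth[OF c]] by simp
  then have "br a (br b c) x - br b (br a c) x = br (br a b) c x"
    by (simp add: sb_pullback a b c bracket_closed q)
  then show "lie_bracket (hamiltonian_vf AM br a) (hamiltonian_vf AM br b) c x = hamiltonian_vf AM br (br a b) c x"
    by (simp add: lie_bracket_def hamiltonian_vf_def a b c bracket_closed)
qed

lemma sb_point_derivation:
  assumes "f \<in> smooth_functions AP"
  shows "point_derivation AM (pr q) (\<lambda>a. sb a f q)"
  using assms by (simp add: point_derivation_def sb_add_left sb_scale_left sb_leibniz_left)

lemma sb_depends_on_differential:
  assumes a: "a \<in> smooth_functions AM" and b: "b \<in> smooth_functions AM" and f: "f \<in> smooth_functions AP"
    and eq: "\<And>Y. Y \<in> vector_fields AM \<Longrightarrow> Y a (pr q) = Y b (pr q)"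
  shows "sb a f q = sb b f q"
proof -
  obtain I :: "'e set" and \<xi> E N where F: "finite I" "open N" "pr q \<in> N"
    "\<And>i. \<xi> i \<in> smooth_functions AM" "\<And>i. E i \<in> vector_fields AM"
    "\<And>p D a. p \<in> N \<Longrightarrow> point_derivation AM p D \<Longrightarrow> a \<in> smooth_functions AM \<Longrightarrow>
       D a = (\<Sum>i\<in>I. E i a p * D (\<xi> i))"
    by (rule local_frame[OF AM, of "pr q"]) (rule that)
  note expand = F(6)[OF F(3) sb_point_derivation[OF f]]
  show ?thesis using expand[OF a] expand[OF b] eq[OF F(5)] by simp
qed

abbreviation lift :: "'m vfield \<Rightarrow> 'p vfield" where
  "lift \<equiv> hamiltonian_lift AM AP pr \<omega> sb"

lemma lift_eq:
  assumes X: "X \<in> vector_fields AM" and f: "f \<in> smooth_functions AP"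
    and b: "potential_at AM \<omega> (pr q) X b"
  shows "lift X f q = sb b f q"
proof -
  define b' where "b' = (SOME b. potential_at AM \<omega> (pr q) X b)"
  have b': "potential_at AM \<omega> (pr q) X b'" unfolding b'_def by (rule someI[of "potential_at AM \<omega> (pr q) X", OF b])
  have "sb b' f q = sb b f q"
    by (rule sb_depends_on_differential) (use b b' f in \<open>auto simp: potential_at_def\<close>)
  then show ?thesis by (simp add: hamiltonian_lift_def X f b'_def)
qed

text \<open>
  In a local frame the explicit potentials give \<open>\<Sum>\<^sub>i pr\<^sup>*(\<omega> X (E i)) {\<xi> i | f}\<close>, with the bracket
  written in braces.\<close>

lemma lift_smooth:
  assumes X: "X \<in> vector_fields AM" and f: "f \<in> smooth_functions AP"
  shows "lift X f \<in> smooth_functions AP"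
proof (rule smooth_functions_local[OF AP])
  fix q0
  obtain I :: "'e set" and \<xi> E N where F: "finite I" "open N" "pr q0 \<in> N"
    "\<And>i. \<xi> i \<in> smooth_functions AM" "\<And>i. E i \<in> vector_fields AM"
    "\<And>p D a. p \<in> N \<Longrightarrow> point_derivation AM p D \<Longrightarrow> a \<in> smooth_functions AM \<Longrightarrow>
       D a = (\<Sum>i\<in>I. E i a p * D (\<xi> i))"
    by (rule local_frame[OF AM, of "pr q0"]) (rule that)
  define g where "g = (\<Sum>i\<in>I. (\<omega> X (E i) \<circ> pr) * sb (\<xi> i) f)"
  have "g \<in> smooth_functions AP" unfolding g_def
    by (intro smooth_functions_sum[OF AP] smooth_functions_mult[OF AP] pullback_smooth sb_closed F(4) f
        form_closed[OF AM \<omega> X F(5)])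
  moreover have "open (pr -` N)"
    using pr_smooth F(2) unfolding smooth_map_def by (simp add: open_vimage)
  moreover have "lift X f q = g q" if "q \<in> pr -` N" for q
  proof -
    have q: "pr q \<in> N" using that by simp
    note D = sb_point_derivation[OF f, of q]
    have coef: "(\<lambda>_. \<omega> X (E i) (pr q)) * \<xi> i \<in> smooth_functions AM" for i
      by (intro smooth_functions_mult[OF AM] smooth_functions_const F(4))
    have "lift X f q = sb (\<Sum>i\<in>I. (\<lambda>_. \<omega> X (E i) (pr q)) * \<xi> i) f q"
      by (rule lift_eq[OF X f frame_potential[OF AM \<omega> F(1,4,5) F(6)[OF q] X]])
    also have "\<dots> = (\<Sum>i\<in>I. \<omega> X (E i) (pr q) * sb (\<xi> i) f q)"
      using point_derivation_sum[OF AM D coef, of "\<lambda>i. i" I] point_derivation_scale[OF AM D F(4)] by simp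
    also have "\<dots> = g q" by (simp add: g_def sum_fun_apply)
    finally show ?thesis .
  qed
  ultimately show "\<exists>W g. open W \<and> q0 \<in> W \<and> g \<in> smooth_functions AP \<and> (\<forall>x\<in>W. lift X f x = g x)"
    using F(3) by (intro exI[of _ "pr -` N"] exI[of _ g]) auto
qed

lemma lift_vector_field:
  assumes X: "X \<in> vector_fields AM"
  shows "lift X \<in> vector_fields AP"
proof -
  have ex: "\<exists>b. potential_at AM \<omega> (pr q) X b \<and> b \<in> smooth_functions AM \<and>
      (\<forall>f\<in>smooth_functions AP. lift X f q = sb b f q)" for q
    using potential_exists[OF AM \<omega> X, of "pr q"] lift_eq[OF X] potential_at_def by metis
  show ?thesis unfolding vector_fields_def
  proof (intro CollectI conjI ballI allI impI)
    fix f assume f: "f \<in> smooth_functions AP"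
    show "lift X f \<in> smooth_functions AP" by (rule lift_smooth[OF X f])
    show "lift X ((\<lambda>_. z) * f) = (\<lambda>_. z) * lift X f" for z
    proof
      fix q obtain b where "b \<in> smooth_functions AM" "\<forall>f\<in>smooth_functions AP. lift X f q = sb b f q"
        using ex by blast
      then show "lift X ((\<lambda>_. z) * f) q = ((\<lambda>_. z) * lift X f) q"
        using f smooth_functions_mult[OF AP smooth_functions_const f] by (simp add: sb_scale_right)
    qed
    fix g assume g: "g \<in> smooth_functions AP"
    show "lift X (f + g) = lift X f + lift X g"
    proof
      fix q obtain b where "b \<in> smooth_functions AM" "\<forall>f\<in>smooth_functions AP. lift X f q = sb b f q"
        using ex by blast
      then show "lift X (f + g) q = (lift X f + lift X g) q"
        using f g smooth_functions_add[OF AP f g] by (simp add: sb_add_right)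
    qed
    show "lift X (f * g) = lift X f * g + f * lift X g"
    proof
      fix q obtain b where "b \<in> smooth_functions AM" "\<forall>f\<in>smooth_functions AP. lift X f q = sb b f q"
        using ex by blast
      then show "lift X (f * g) q = (lift X f * g + f * lift X g) q"
        using f g smooth_functions_mult[OF AP f g] by (simp add: sb_natural mult.commute)
    qed
  qed (simp add: hamiltonian_lift_def)
qed

lemma lift_eqI:
  assumes "X \<in> vector_fields AM" "V \<in> vector_fields AP"
    and "\<And>f q b. f \<in> smooth_functions AP \<Longrightarrow> potential_at AM \<omega> (pr q) X b \<Longrightarrow> sb b f q = V f q"
  shows "lift X = V"
proof (rule vf_eqI[OF AP lift_vector_field[OF assms(1)] assms(2)])
  fix f q assume f: "f \<in> smooth_functions AP"
  obtain b where b: "potential_at AM \<omega> (pr q) X b" using potential_exists[OF AM \<omega> assms(1)] .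
  show "lift X f q = V f q" using lift_eq[OF assms(1) f b] assms(3)[OF f b] by simp
qed

text \<open>
  Each property is checked at one point, where a potential of the left-hand side is assembled from
  potentials of the constituents; horizontality is \<open>potential_bracket\<close>.\<close>

lemma lift_horizontal: "horizontal_lift AM AP pr lift"
  unfolding horizontal_lift_def
proof (intro conjI ballI allI impI)
  fix X assume X: "X \<in> vector_fields AM"
  show "lift X \<in> vector_fields AP" by (rule lift_vector_field[OF X])
  show "lift (X + Y) = lift X + lift Y" if Y: "Y \<in> vector_fields AM" for Y
  proof (rule lift_eqI[OF vector_fields_add[OF AM X Y]])
    show "lift X + lift Y \<in> vector_fields AP"
      by (intro vector_fields_add[OF AP] lift_vector_field X Y)
    fix f q c assume f: "f \<in> smooth_functions AP" and c: "potential_at AM \<omega> (pr q) (X + Y) c"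
    obtain a b where a: "potential_at AM \<omega> (pr q) X a" and b: "potential_at AM \<omega> (pr q) Y b"
      using potential_exists[OF AM \<omega>] X Y by metis
    have s: "a \<in> smooth_functions AM" "b \<in> smooth_functions AM" using a b by (simp_all add: potential_at_def)
    have "sb c f q = sb (a + b) f q"
      by (rule sb_depends_on_differential)
         (use a b c f s in \<open>auto simp: potential_at_def vf_additive[OF AM] form_add[OF AM \<omega> X Y] smooth_functions_add[OF AM]\<close>)
    then show "sb c f q = (lift X + lift Y) f q"
      by (simp add: lift_eq[OF X f a] lift_eq[OF Y f b] sb_add_left s f)
  qed
  fix a assume a: "a \<in> smooth_functions AM"
  show "lift X (a \<circ> pr) = X a \<circ> pr"
  proof
    fix q
    obtain b where b: "potential_at AM \<omega> (pr q) X b" using potential_exists[OF AM \<omega> X] .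
    then have "b \<in> smooth_functions AM" by (simp add: potential_at_def)
    then show "lift X (a \<circ> pr) q = (X a \<circ> pr) q"
      using potential_bracket[OF AM \<omega> X b a] by (simp add: lift_eq[OF X pullback_smooth[OF a] b] sb_pullback a)
  qed
next
  fix a X assume a: "a \<in> smooth_functions AM" and X: "X \<in> vector_fields AM"
  show "lift (vf_scale a X) = vf_scale (a \<circ> pr) (lift X)"
  proof (rule lift_eqI[OF vector_fields_scale[OF AM a X]])
    show "vf_scale (a \<circ> pr) (lift X) \<in> vector_fields AP"
      by (intro vector_fields_scale[OF AP] lift_vector_field X pullback_smooth a)
    fix f q c assume f: "f \<in> smooth_functions AP" and c: "potential_at AM \<omega> (pr q) (vf_scale a X) c"
    obtain b where b: "potential_at AM \<omega> (pr q) X b" using potential_exists[OF AM \<omega> X] .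
    have s: "b \<in> smooth_functions AM" using b by (simp add: potential_at_def)
    have "sb c f q = sb ((\<lambda>_. a (pr q)) * b) f q"
      by (rule sb_depends_on_differential)
         (use b c f s in \<open>auto simp: potential_at_def vf_homogeneous[OF AM] form_scale[OF AM \<omega> a X]
            smooth_functions_mult[OF AM smooth_functions_const]\<close>)
    then show "sb c f q = vf_scale (a \<circ> pr) (lift X) f q"
      by (simp add: lift_eq[OF X f b] sb_scale_left s f vf_scale_def)
  qed
qed (auto simp: hamiltonian_lift_def fun_eq_iff)

lemma lift_lifts_hamiltonians: "lifts_hamiltonians AM AP br sb lift"
  unfolding lifts_hamiltonians_def
  by (auto simp: fun_eq_iff intro!: lift_eq potential_of_hamiltonian[OF AM \<omega>] hamiltonian_vector_field[OF AM \<omega>])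

context
  fixes h
  assumes h: "horizontal_lift AM AP pr h"
begin

lemma hlift_vector_field: "X \<in> vector_fields AM \<Longrightarrow> h X \<in> vector_fields AP"
  and hlift_add: "X \<in> vector_fields AM \<Longrightarrow> Y \<in> vector_fields AM \<Longrightarrow> h (X + Y) = h X + h Y"
  and hlift_scale: "a \<in> smooth_functions AM \<Longrightarrow> X \<in> vector_fields AM \<Longrightarrow> h (vf_scale a X) = vf_scale (a \<circ> pr) (h X)"
  and hlift_pullback: "X \<in> vector_fields AM \<Longrightarrow> b \<in> smooth_functions AM \<Longrightarrow> h X (b \<circ> pr) = X b \<circ> pr"
  and hlift_outside: "X \<notin> vector_fields AM \<Longrightarrow> h X = 0"
  using h unfolding horizontal_lift_def by blast+

lemma hlift_uminus: "X \<in> vector_fields AM \<Longrightarrow> h (- X) = - h X"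
  using hlift_scale[OF smooth_functions_const, of X "-1"] by (simp add: vf_scale_minus1 o_def)

lemma curvature_antisym:
  assumes "X \<in> vector_fields AM" "Y \<in> vector_fields AM"
  shows "curvature h Y X = - curvature h X Y"
proof -
  have "lie_bracket Y X = - lie_bracket X Y" "lie_bracket (h Y) (h X) = - lie_bracket (h X) (h Y)"
    by (auto simp: lie_bracket_def fun_eq_iff)
  then show ?thesis
    by (simp add: curvature_def hlift_uminus[OF vector_fields_lie_bracket[OF AM assms]])
qed

lemma curvature_vector_field:
  "X \<in> vector_fields AM \<Longrightarrow> Y \<in> vector_fields AM \<Longrightarrow> curvature h X Y \<in> vector_fields AP"
  unfolding curvature_def
  by (intro vector_fields_diff[OF AP] vector_fields_lie_bracket[OF AP] hlift_vector_field vector_fields_lie_bracket[OF AM])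

lemma curvature_add:
  assumes X: "X \<in> vector_fields AM" and X': "X' \<in> vector_fields AM" and Y: "Y \<in> vector_fields AM"
  shows "curvature h (X + X') Y = curvature h X Y + curvature h X' Y"
proof (rule vf_eqI[OF AP])
  have "lie_bracket (X + X') Y = lie_bracket X Y + lie_bracket X' Y"
  proof (rule vf_eqI[OF AM])
    fix a x assume a: "a \<in> smooth_functions AM"
    show "lie_bracket (X + X') Y a x = (lie_bracket X Y + lie_bracket X' Y) a x"
      by (simp add: lie_bracket_apply vf_additive[OF AM Y] vf_closed[OF AM X a] vf_closed[OF AM X' a])
  qed (intro vector_fields_lie_bracket[OF AM] vector_fields_add[OF AM] X X' Y)+
  then have eq: "h (lie_bracket (X + X') Y) = h (lie_bracket X Y) + h (lie_bracket X' Y)"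
    by (simp only: hlift_add vector_fields_lie_bracket[OF AM] X X' Y)
  fix f q assume f: "f \<in> smooth_functions AP"
  show "curvature h (X + X') Y f q = (curvature h X Y + curvature h X' Y) f q"
    using vf_additive[OF AP hlift_vector_field[OF Y], of "h X f" "h X' f"]
      vf_closed[OF AP hlift_vector_field[OF X] f] vf_closed[OF AP hlift_vector_field[OF X'] f]
    by (simp add: curvature_def eq hlift_add[OF X X'] lie_bracket_apply)
qed (intro curvature_vector_field vector_fields_add[OF AP] vector_fields_add[OF AM] X X' Y)+

text \<open>
  The term of \<open>[a X, Y] = a [X, Y] - Y(a) X\<close> that contains a derivative of the function is lifted to
  \<open>pr\<^sup>*(Y(a))\<close> times the lift of X, and so cancels the one that the Leibniz rule of the lift of Y
  produces upstairs.\<close>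

lemma curvature_scale:
  assumes a: "a \<in> smooth_functions AM" and X: "X \<in> vector_fields AM" and Y: "Y \<in> vector_fields AM"
  shows "curvature h (vf_scale a X) Y = vf_scale (a \<circ> pr) (curvature h X Y)"
proof (rule vf_eqI[OF AP])
  note L = vector_fields_lie_bracket[OF AM X Y]
  have Ya: "- Y a \<in> smooth_functions AM" by (intro smooth_functions_uminus[OF AM] vf_closed[OF AM Y a])
  have "lie_bracket (vf_scale a X) Y = vf_scale a (lie_bracket X Y) + vf_scale (- Y a) X"
  proof (rule vf_eqI[OF AM])
    fix b x assume b: "b \<in> smooth_functions AM"
    show "lie_bracket (vf_scale a X) Y b x = (vf_scale a (lie_bracket X Y) + vf_scale (- Y a) X) b x"
      by (simp add: lie_bracket_apply vf_scale_apply vf_leibniz[OF AM Y a vf_closed[OF AM X b]] algebra_simps)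
  qed (intro vector_fields_lie_bracket[OF AM] vector_fields_add[OF AM] vector_fields_scale[OF AM] X Y a Ya)+
  then have eq: "h (lie_bracket (vf_scale a X) Y)
      = vf_scale (a \<circ> pr) (h (lie_bracket X Y)) + vf_scale (- Y a \<circ> pr) (h X)"
    by (simp only: hlift_add[OF vector_fields_scale[OF AM a L] vector_fields_scale[OF AM Ya X]]
        hlift_scale[OF a L] hlift_scale[OF Ya X])
  fix f q assume f: "f \<in> smooth_functions AP"
  show "curvature h (vf_scale a X) Y f q = vf_scale (a \<circ> pr) (curvature h X Y) f q"
    using vf_leibniz[OF AP hlift_vector_field[OF Y] pullback_smooth[OF a] vf_closed[OF AP hlift_vector_field[OF X] f]]
    by (simp add: curvature_def eq hlift_scale[OF a X] lie_bracket_apply vf_scale_apply hlift_pullback[OF Y a] algebra_simps)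
qed (intro curvature_vector_field vector_fields_scale[OF AP] vector_fields_scale[OF AM] pullback_smooth a X Y)+

lemma hamiltonian_at_point:
  assumes X: "X \<in> vector_fields AM"
  obtains b where "b \<in> smooth_functions AM"
    "\<And>c. c \<in> smooth_functions AM \<Longrightarrow> X c p = hamiltonian_vf AM br b c p"
proof -
  obtain b where b: "potential_at AM \<omega> p X b" using potential_exists[OF AM \<omega> X] .
  then have "b \<in> smooth_functions AM" by (simp add: potential_at_def)
  then show ?thesis
    using that potential_bracket[OF AM \<omega> X b] by (simp add: hamiltonian_vf_def)
qed

lemma hlift_pointwise:
  assumes "X \<in> vector_fields AM" "Y \<in> vector_fields AM"
    and "\<And>c. c \<in> smooth_functions AM \<Longrightarrow> X c (pr q) = Y c (pr q)"
  shows "h X f q = h Y f q"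
  by (rule tensorial_at_point[OF AM, where T = "\<lambda>X. h X f q" and p = "pr q"])
     (simp_all add: assms hlift_add hlift_scale vf_scale_apply)

lemma curvature_pointwise:
  assumes "X \<in> vector_fields AM" "X' \<in> vector_fields AM" "Y \<in> vector_fields AM"
    and "\<And>c. c \<in> smooth_functions AM \<Longrightarrow> X c (pr q) = X' c (pr q)"
  shows "curvature h X Y f q = curvature h X' Y f q"
  by (rule tensorial_at_point[OF AM, where T = "\<lambda>X. curvature h X Y f q" and p = "pr q"])
     (simp_all add: assms curvature_add curvature_scale vf_scale_apply)

context
  assumes lifts: "lifts_hamiltonians AM AP br sb h"
begin

lemma hlift_hamiltonian:
  "a \<in> smooth_functions AM \<Longrightarrow> f \<in> smooth_functions AP \<Longrightarrow> h (hamiltonian_vf AM br a) f = sb a f"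
  using lifts unfolding lifts_hamiltonians_def by blast

text \<open>
  The third rule of a semi-Poisson bracket says that \<open>a \<mapsto> {a | _}\<close> turns the Poisson bracket into a
  commutator, and \<open>a \<mapsto> X\<^sub>a\<close> does the same on the base.\<close>

lemma curvature_hamiltonian:
  assumes a: "a \<in> smooth_functions AM" and b: "b \<in> smooth_functions AM" and f: "f \<in> smooth_functions AP"
  shows "curvature h (hamiltonian_vf AM br a) (hamiltonian_vf AM br b) f = 0"
  using sb_jacobi[OF a b f]
  by (simp add: curvature_def lie_bracket_apply hamiltonian_lie_bracket[OF a b]
      hlift_hamiltonian a b f sb_closed bracket_closed)

lemma hlift_flat: "flat_connection AM h"
  unfolding flat_connection_def
proof (intro ballI)
  fix X Y assume X: "X \<in> vector_fields AM" and Y: "Y \<in> vector_fields AM"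
  show "curvature h X Y = 0"
  proof (rule vf_eqI[OF AP curvature_vector_field[OF X Y] vector_fields_0[OF AP]])
    fix f q assume f: "f \<in> smooth_functions AP"
    obtain a where a: "a \<in> smooth_functions AM"
      "\<And>c. c \<in> smooth_functions AM \<Longrightarrow> X c (pr q) = hamiltonian_vf AM br a c (pr q)"
      by (rule hamiltonian_at_point[OF X]) (rule that)
    obtain b where b: "b \<in> smooth_functions AM"
      "\<And>c. c \<in> smooth_functions AM \<Longrightarrow> Y c (pr q) = hamiltonian_vf AM br b c (pr q)"
      by (rule hamiltonian_at_point[OF Y]) (rule that)
    note Xa = hamiltonian_vector_field[OF AM \<omega> a(1)] and Xb = hamiltonian_vector_field[OF AM \<omega> b(1)]
    have "curvature h X Y f q = curvature h (hamiltonian_vf AM br a) Y f q"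
      by (rule curvature_pointwise[OF X Xa Y a(2)])
    also have "\<dots> = - curvature h Y (hamiltonian_vf AM br a) f q"
      by (simp add: curvature_antisym[OF Y Xa])
    also have "\<dots> = - curvature h (hamiltonian_vf AM br b) (hamiltonian_vf AM br a) f q"
      by (simp add: curvature_pointwise[OF Y Xb Xa b(2)])
    finally show "curvature h X Y f q = 0 f q" by (simp add: curvature_hamiltonian[OF b(1) a(1) f])
  qed
qed

lemma hlift_unique: "h = lift"
proof
  fix X show "h X = lift X"
  proof (cases "X \<in> vector_fields AM")
    case X: True
    show ?thesis
    proof (rule vf_eqI[OF AP hlift_vector_field[OF X] lift_vector_field[OF X]])
      fix f q assume f: "f \<in> smooth_functions AP"
      obtain b where b: "potential_at AM \<omega> (pr q) X b" using potential_exists[OF AM \<omega> X] .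
      then have bs: "b \<in> smooth_functions AM" by (simp add: potential_at_def)
      have "h X f q = h (hamiltonian_vf AM br b) f q"
        by (rule hlift_pointwise[OF X hamiltonian_vector_field[OF AM \<omega> bs]])
           (simp add: potential_bracket[OF AM \<omega> X b] hamiltonian_vf_def)
      then show "h X f q = lift X f q"
        using lift_eq[OF X f b] hlift_hamiltonian[OF bs f] by simp
    qed
  next
    case False
    then show ?thesis by (auto simp: hlift_outside hamiltonian_lift_def fun_eq_iff)
  qed
qed

end

end

end

theorem natural_semi_poisson_flat_connection:
  fixes AM :: "('m::{t2_space,second_countable_topology}, 'e::real_inner) chart set"
    and AP :: "('p::{t2_space,second_countable_topology}, 'f::real_inner) chart set"
  assumes fib: "fibered_manifold AM AP pr" and symp: "symplectic_bracket AM br"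
    and semi: "semi_poisson_bracket AM AP pr br sb" and nat: "natural_bracket AM AP sb"
  shows "\<exists>!h. horizontal_lift AM AP pr h \<and> lifts_hamiltonians AM AP br sb h"
    and "horizontal_lift AM AP pr h \<Longrightarrow> lifts_hamiltonians AM AP br sb h \<Longrightarrow> flat_connection AM h"
proof -
  have M: "smooth_atlas AM" "smooth_atlas AP" "smooth_map AP AM pr" "surj pr"
    using fib by (auto simp: fibered_manifold_def submersion_def)
  obtain \<omega> where \<omega>: "bracket_of_form AM \<omega> br"
    using symp unfolding symplectic_bracket_def bracket_of_form_def by blast
  note facts = M \<omega> semi nat
  show "\<exists>!h. horizontal_lift AM AP pr h \<and> lifts_hamiltonians AM AP br sb h"
    using lift_horizontal[OF facts] lift_lifts_hamiltonians[OF facts] hlift_unique[OF facts] by blast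
  show "flat_connection AM h" if "horizontal_lift AM AP pr h" "lifts_hamiltonians AM AP br sb h"
    using hlift_flat[OF facts that] .
qed

section \<open>The semi-Poisson bracket of a bimodule deformation\<close>

lemma formal_functions_nth: "f \<in> formal_functions A \<Longrightarrow> fps_nth f n \<in> smooth_functions A"
  by (simp add: formal_functions_def)

lemma formal_functions_const: "a \<in> smooth_functions A \<Longrightarrow> fps_const a \<in> formal_functions A"
  by (simp add: formal_functions_def smooth_functions_0)

lemma formal_functions_shift: "f \<in> formal_functions A \<Longrightarrow> fps_shift n f \<in> formal_functions A"
  by (simp add: formal_functions_def)

lemma formal_functions_diff:
  "smooth_atlas A \<Longrightarrow> f \<in> formal_functions A \<Longrightarrow> g \<in> formal_functions A \<Longrightarrow> f - g \<in> formal_functions A"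
  by (simp add: formal_functions_def smooth_functions_diff)

lemma formal_scalar_fps_X: "formal_scalar fps_X = fps_X"
  by (rule fps_ext) (simp add: formal_scalar_def fps_X_nth zero_fun_def one_fun_def)

lemma formal_scalar_const: "formal_scalar (fps_const z) = fps_const (\<lambda>_. z)"
  by (rule fps_ext) (simp add: formal_scalar_def zero_fun_def)

lemma formal_functions_X: "f \<in> formal_functions A \<Longrightarrow> fps_X * f \<in> formal_functions A"
  by (simp add: formal_functions_def fps_X_mult_nth smooth_functions_0)

lemma fps_split_X: "f = fps_const (fps_nth f 0) + fps_X * fps_shift 1 (f :: ('m \<Rightarrow> complex) fps)"
  by (rule fps_ext) (simp add: fps_X_mult_nth)

context
  fixes A :: "('m::{t2_space,second_countable_topology}, 'e::real_inner) chart set"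
    and B :: "('n::{t2_space,second_countable_topology}, 'f::real_inner) chart set"
    and D :: "('k::{t2_space,second_countable_topology}, 'g::real_inner) chart set" and m
  assumes A: "smooth_atlas A" and B: "smooth_atlas B"
    and m: "formal_bilinear (formal_functions A) (formal_functions B) (formal_functions D) m"
begin

lemma bilinear_closed: "a \<in> formal_functions A \<Longrightarrow> f \<in> formal_functions B \<Longrightarrow> m a f \<in> formal_functions D"
  and bilinear_add_left: "a \<in> formal_functions A \<Longrightarrow> b \<in> formal_functions A \<Longrightarrow> f \<in> formal_functions B \<Longrightarrow>
     m (a + b) f = m a f + m b f"
  and bilinear_add_right: "a \<in> formal_functions A \<Longrightarrow> f \<in> formal_functions B \<Longrightarrow> g \<in> formal_functions B \<Longrightarrow>
     m a (f + g) = m a f + m a g"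
  and bilinear_scalar_left: "a \<in> formal_functions A \<Longrightarrow> f \<in> formal_functions B \<Longrightarrow>
     m (formal_scalar z * a) f = formal_scalar z * m a f"
  and bilinear_scalar_right: "a \<in> formal_functions A \<Longrightarrow> f \<in> formal_functions B \<Longrightarrow>
     m a (formal_scalar z * f) = formal_scalar z * m a f"
  using m unfolding formal_bilinear_def by blast+

lemma bilinear_diff_left:
  assumes "a \<in> formal_functions A" "b \<in> formal_functions A" "f \<in> formal_functions B"
  shows "m (a - b) f = m a f - m b f"
  using bilinear_add_left[OF formal_functions_diff[OF A assms(1,2)] assms(2,3)] by simp

lemma bilinear_diff_right:
  assumes "a \<in> formal_functions A" "f \<in> formal_functions B" "g \<in> formal_functions B"
  shows "m a (f - g) = m a f - m a g"
  using bilinear_add_right[OF assms(1) formal_functions_diff[OF B assms(2,3)] assms(3)] by simp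

lemma bilinear_X_left: "a \<in> formal_functions A \<Longrightarrow> f \<in> formal_functions B \<Longrightarrow> m (fps_X * a) f = fps_X * m a f"
  and bilinear_X_right: "a \<in> formal_functions A \<Longrightarrow> f \<in> formal_functions B \<Longrightarrow> m a (fps_X * f) = fps_X * m a f"
  using bilinear_scalar_left[of a f fps_X] bilinear_scalar_right[of a f fps_X] by (simp_all add: formal_scalar_fps_X)

lemma order_term_closed:
  "a \<in> smooth_functions A \<Longrightarrow> f \<in> smooth_functions B \<Longrightarrow> order_term m k a f \<in> smooth_functions D"
  unfolding order_term_def by (intro formal_functions_nth bilinear_closed formal_functions_const)

lemma order_term_add_left:
  assumes "a \<in> smooth_functions A" "b \<in> smooth_functions A" "f \<in> smooth_functions B"
  shows "order_term m k (a + b) f = order_term m k a f + order_term m k b f"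
  using bilinear_add_left[OF formal_functions_const[OF assms(1)] formal_functions_const[OF assms(2)]
      formal_functions_const[OF assms(3)]]
  by (simp add: order_term_def)

lemma order_term_add_right:
  assumes "a \<in> smooth_functions A" "f \<in> smooth_functions B" "g \<in> smooth_functions B"
  shows "order_term m k a (f + g) = order_term m k a f + order_term m k a g"
  using bilinear_add_right[OF formal_functions_const[OF assms(1)] formal_functions_const[OF assms(2)]
      formal_functions_const[OF assms(3)]]
  by (simp add: order_term_def)

lemma order_term_scale:
  assumes "a \<in> smooth_functions A" "f \<in> smooth_functions B"
  shows "order_term m k ((\<lambda>_. z) * a) f = (\<lambda>_. z) * order_term m k a f"
    and "order_term m k a ((\<lambda>_. z) * f) = (\<lambda>_. z) * order_term m k a f"
  using bilinear_scalar_left[OF formal_functions_const[OF assms(1)] formal_functions_const[OF assms(2)], of "fps_const z"]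
    bilinear_scalar_right[OF formal_functions_const[OF assms(1)] formal_functions_const[OF assms(2)], of "fps_const z"]
  by (simp_all add: order_term_def formal_scalar_const)

lemma order_term_0:
  assumes "a \<in> smooth_functions A" "f \<in> smooth_functions B"
  shows "order_term m k 0 f = 0" "order_term m k a 0 = 0"
  using order_term_add_left[OF smooth_functions_0 smooth_functions_0 assms(2), of k]
    order_term_add_right[OF assms(1) smooth_functions_0 smooth_functions_0, of k]
  by (simp_all only: add_0_left add_cancel_right_right)

text \<open>
  A formal bilinear map is compatible with finite sums and formal scalars, but not a priori with the
  infinite sum that makes up a power series; so coefficients of \<open>m a f\<close> are computed by splitting
  off one constant term at a time.\<close>

lemma bilinear_split:
  assumes a: "a \<in> formal_functions A" and f: "f \<in> formal_functions B"
  shows "m a f = m (fps_const (fps_nth a 0)) (fps_const (fps_nth f 0))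
    + fps_X * (m (fps_shift 1 a) f + m (fps_const (fps_nth a 0)) (fps_shift 1 f))"
proof -
  note ca = formal_functions_const[OF formal_functions_nth[OF a, of 0]] formal_functions_shift[OF a, of 1]
  note cf = formal_functions_const[OF formal_functions_nth[OF f, of 0]] formal_functions_shift[OF f, of 1]
  have "m a f = m (fps_const (fps_nth a 0) + fps_X * fps_shift 1 a) f"
    using fps_split_X[of a] by simp
  also have "\<dots> = m (fps_const (fps_nth a 0)) f + fps_X * m (fps_shift 1 a) f"
    by (simp only: bilinear_add_left[OF ca(1) formal_functions_X[OF ca(2)] f] bilinear_X_left[OF ca(2) f])
  also have "m (fps_const (fps_nth a 0)) f = m (fps_const (fps_nth a 0)) (fps_const (fps_nth f 0) + fps_X * fps_shift 1 f)"
    using fps_split_X[of f] by simp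
  also have "\<dots> = m (fps_const (fps_nth a 0)) (fps_const (fps_nth f 0))
      + fps_X * m (fps_const (fps_nth a 0)) (fps_shift 1 f)"
    by (simp only: bilinear_add_right[OF ca(1) cf(1) formal_functions_X[OF cf(2)]] bilinear_X_right[OF ca(1) cf(2)])
  finally show ?thesis by (simp add: algebra_simps)
qed

lemma bilinear_nth_0:
  assumes "a \<in> formal_functions A" "f \<in> formal_functions B"
  shows "fps_nth (m a f) 0 = order_term m 0 (fps_nth a 0) (fps_nth f 0)"
  by (subst bilinear_split[OF assms]) (simp add: order_term_def)

lemma bilinear_nth_1:
  assumes a: "a \<in> formal_functions A" and f: "f \<in> formal_functions B"
  shows "fps_nth (m a f) 1 = order_term m 1 (fps_nth a 0) (fps_nth f 0)
    + order_term m 0 (fps_nth a 1) (fps_nth f 0) + order_term m 0 (fps_nth a 0) (fps_nth f 1)"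
proof -
  note ca = formal_functions_const[OF formal_functions_nth[OF a, of 0]] formal_functions_shift[OF a, of 1]
  note cf = formal_functions_shift[OF f, of 1]
  show ?thesis
    by (subst bilinear_split[OF a f])
       (simp add: order_term_def[of m 1] fps_X_mult_nth bilinear_nth_0[OF ca(2) f] bilinear_nth_0[OF ca(1) cf]
         del: One_nat_def)
qed

end

context
  fixes AM :: "('m::{t2_space,second_countable_topology}, 'e::real_inner) chart set"
    and AP :: "('p::{t2_space,second_countable_topology}, 'f::real_inner) chart set"
    and pr :: "'p \<Rightarrow> 'm" and star lact ract
  assumes AM: "smooth_atlas AM" and AP: "smooth_atlas AP"
    and star: "star_product AM star" and bim: "bimodule_deformation AM AP pr star lact ract"
begin

lemma star_bilinear: "formal_bilinear (formal_functions AM) (formal_functions AM) (formal_functions AM) star"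
  and star_order_0: "a \<in> smooth_functions AM \<Longrightarrow> b \<in> smooth_functions AM \<Longrightarrow> order_term star 0 a b = a * b"
  using star unfolding star_product_def by blast+

lemma lact_bilinear: "formal_bilinear (formal_functions AM) (formal_functions AP) (formal_functions AP) lact"
  and ract_bilinear: "formal_bilinear (formal_functions AP) (formal_functions AM) (formal_functions AP) ract"
  and lact_star: "a \<in> formal_functions AM \<Longrightarrow> b \<in> formal_functions AM \<Longrightarrow> f \<in> formal_functions AP \<Longrightarrow>
     lact (star a b) f = lact a (lact b f)"
  and ract_star: "a \<in> formal_functions AM \<Longrightarrow> b \<in> formal_functions AM \<Longrightarrow> f \<in> formal_functions AP \<Longrightarrow>
     ract f (star a b) = ract (ract f a) b"
  and act_commute: "a \<in> formal_functions AM \<Longrightarrow> b \<in> formal_functions AM \<Longrightarrow> f \<in> formal_functions AP \<Longrightarrow>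
     ract (lact a f) b = lact a (ract f b)"
  using bim unfolding bimodule_deformation_def by blast+

lemma lact_order_0: "a \<in> smooth_functions AM \<Longrightarrow> f \<in> smooth_functions AP \<Longrightarrow> order_term lact 0 a f = (a \<circ> pr) * f"
  and ract_order_0: "a \<in> smooth_functions AM \<Longrightarrow> f \<in> smooth_functions AP \<Longrightarrow> order_term ract 0 f a = (a \<circ> pr) * f"
  using bim unfolding bimodule_deformation_def by blast+

lemmas star_closed = bilinear_closed[OF AM AM star_bilinear]
  and lact_closed = bilinear_closed[OF AM AP lact_bilinear]
  and ract_closed = bilinear_closed[OF AP AM ract_bilinear]

lemmas lact_diff = bilinear_diff_left[OF AM AP lact_bilinear] bilinear_diff_right[OF AM AP lact_bilinear]
  and ract_diff = bilinear_diff_left[OF AP AM ract_bilinear] bilinear_diff_right[OF AP AM ract_bilinear]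

text \<open>
  The commutator with \<open>a\<close> of the bimodule.  As the left and right actions agree in order 0, it begins
  in order 1, with a coefficient that is the semi-Poisson bracket up to the factor \<open>\<i> / 2\<close>.  The
  three rules of a semi-Poisson bracket are the leading orders of three commutator identities, which
  hold in every bimodule.\<close>

definition act_comm :: "('m \<Rightarrow> complex) fps \<Rightarrow> ('p \<Rightarrow> complex) fps \<Rightarrow> ('p \<Rightarrow> complex) fps" where
  "act_comm a f = lact a f - ract f a"

definition act_comm_1 :: "('m \<Rightarrow> complex) \<Rightarrow> ('p \<Rightarrow> complex) \<Rightarrow> ('p \<Rightarrow> complex)" where
  "act_comm_1 a f = order_term lact 1 a f - order_term ract 1 f a"

lemma act_comm_closed: "a \<in> formal_functions AM \<Longrightarrow> f \<in> formal_functions AP \<Longrightarrow> act_comm a f \<in> formal_functions AP"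
  unfolding act_comm_def by (intro formal_functions_diff[OF AP] lact_closed ract_closed)

lemma act_comm_nth:
  assumes a: "a \<in> formal_functions AM" and f: "f \<in> formal_functions AP"
  shows "fps_nth (act_comm a f) 0 = 0"
    and "fps_nth (act_comm a f) 1 = act_comm_1 (fps_nth a 0) (fps_nth f 0)"
  using formal_functions_nth[OF a] formal_functions_nth[OF f]
  by (simp_all add: act_comm_def act_comm_1_def bilinear_nth_0[OF AM AP lact_bilinear a f]
      bilinear_nth_0[OF AP AM ract_bilinear f a] bilinear_nth_1[OF AM AP lact_bilinear a f]
      bilinear_nth_1[OF AP AM ract_bilinear f a] lact_order_0 ract_order_0 algebra_simps del: One_nat_def)

lemma act_comm_X:
  assumes a: "a \<in> formal_functions AM" and f: "f \<in> formal_functions AP"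
  shows "act_comm (fps_X * a) f = fps_X * act_comm a f" "act_comm a (fps_X * f) = fps_X * act_comm a f"
  by (simp_all add: act_comm_def bilinear_X_left[OF AM AP lact_bilinear a f] bilinear_X_right[OF AM AP lact_bilinear a f]
      bilinear_X_left[OF AP AM ract_bilinear f a] bilinear_X_right[OF AP AM ract_bilinear f a] right_diff_distrib)

lemma act_comm_star:
  assumes a: "a \<in> formal_functions AM" and b: "b \<in> formal_functions AM" and f: "f \<in> formal_functions AP"
  shows "act_comm (star a b) f = lact a (act_comm b f) + ract (act_comm a f) b"
  by (simp add: act_comm_def lact_diff ract_diff lact_closed ract_closed lact_star ract_star act_commute a b f)

lemma act_comm_lact:
  assumes a: "a \<in> formal_functions AM" and b: "b \<in> formal_functions AM" and f: "f \<in> formal_functions AP"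
  shows "act_comm a (lact b f) = lact (star a b - star b a) f + lact b (act_comm a f)"
  by (simp add: act_comm_def lact_diff lact_closed ract_closed star_closed lact_star act_commute a b f)

lemma act_comm_commutator:
  assumes a: "a \<in> formal_functions AM" and b: "b \<in> formal_functions AM" and f: "f \<in> formal_functions AP"
  shows "act_comm a (act_comm b f) - act_comm b (act_comm a f) = act_comm (star a b - star b a) f"
  by (simp add: act_comm_def lact_diff ract_diff lact_closed ract_closed star_closed lact_star ract_star act_commute a b f)

lemma star_commutator_nth:
  assumes a: "a \<in> smooth_functions AM" and b: "b \<in> smooth_functions AM"
  shows "fps_nth (star (fps_const a) (fps_const b) - star (fps_const b) (fps_const a)) 0 = 0"
    and "fps_nth (star (fps_const a) (fps_const b) - star (fps_const b) (fps_const a)) 1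
      = order_term star 1 a b - order_term star 1 b a"
  using star_order_0[OF a b] star_order_0[OF b a] by (simp_all add: order_term_def mult.commute del: One_nat_def)

text \<open>
  The coefficient of order 1 in \<open>act_comm_star\<close>; the coefficient of order 0 of \<open>star a b\<close> is \<open>a * b\<close>.\<close>

lemma act_comm_1_mult:
  assumes a: "a \<in> smooth_functions AM" and b: "b \<in> smooth_functions AM" and f: "f \<in> smooth_functions AP"
  shows "act_comm_1 (a * b) f = (a \<circ> pr) * act_comm_1 b f + (b \<circ> pr) * act_comm_1 a f"
proof -
  let ?a = "fps_const a" and ?b = "fps_const b" and ?f = "fps_const f"
  note c = formal_functions_const[OF a] formal_functions_const[OF b] formal_functions_const[OF f]
  note Ca = act_comm_closed[OF c(1,3)] and Cb = act_comm_closed[OF c(2,3)]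
  note n = act_comm_nth[OF c(1,3)] act_comm_nth[OF c(2,3)]
  note s = formal_functions_nth[OF Ca, of 1] formal_functions_nth[OF Cb, of 1]
  have "act_comm_1 (a * b) f = fps_nth (act_comm (star ?a ?b) ?f) 1"
    using star_order_0[OF a b]
    by (simp only: act_comm_nth(2)[OF star_closed[OF c(1,2)] c(3)] order_term_def fps_nth_fps_const if_True simp_thms)
  also have "\<dots> = fps_nth (lact ?a (act_comm ?b ?f)) 1 + fps_nth (ract (act_comm ?a ?f) ?b) 1"
    by (simp add: act_comm_star[OF c])
  also have "fps_nth (lact ?a (act_comm ?b ?f)) 1 = (a \<circ> pr) * act_comm_1 b f"
    using s(2) by (simp add: bilinear_nth_1[OF AM AP lact_bilinear c(1) Cb] n
        order_term_0[OF AM AP lact_bilinear a smooth_functions_0] lact_order_0 a smooth_functions_0 del: One_nat_def)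
  also have "fps_nth (ract (act_comm ?a ?f) ?b) 1 = (b \<circ> pr) * act_comm_1 a f"
    using s(1) by (simp add: bilinear_nth_1[OF AP AM ract_bilinear Ca c(2)] n
        order_term_0[OF AP AM ract_bilinear smooth_functions_0 b] ract_order_0 b smooth_functions_0 del: One_nat_def)
  finally show ?thesis .
qed

text \<open>
  The coefficient of order 1 in \<open>act_comm_lact\<close>, where the commutator of \<open>a\<close> and \<open>b\<close> starts in order 1.\<close>

lemma act_comm_1_pullback:
  assumes a: "a \<in> smooth_functions AM" and b: "b \<in> smooth_functions AM" and f: "f \<in> smooth_functions AP"
  shows "act_comm_1 a ((b \<circ> pr) * f)
    = ((order_term star 1 a b - order_term star 1 b a) \<circ> pr) * f + (b \<circ> pr) * act_comm_1 a f"
proof -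
  let ?a = "fps_const a" and ?b = "fps_const b" and ?f = "fps_const f"
  let ?c = "star ?a ?b - star ?b ?a"
  note c = formal_functions_const[OF a] formal_functions_const[OF b] formal_functions_const[OF f]
  note Ca = act_comm_closed[OF c(1,3)]
  note n = act_comm_nth[OF c(1,3)] star_commutator_nth[OF a b]
  have C: "?c \<in> formal_functions AM"
    by (intro formal_functions_diff[OF AM] star_closed c)
  note s = formal_functions_nth[OF Ca, of 1] formal_functions_nth[OF C, of 1]
  have "act_comm_1 a ((b \<circ> pr) * f) = fps_nth (act_comm ?a (lact ?b ?f)) 1"
    using lact_order_0[OF b f]
    by (simp only: act_comm_nth(2)[OF c(1) lact_closed[OF c(2,3)]] order_term_def fps_nth_fps_const if_True simp_thms)
  also have "\<dots> = fps_nth (lact ?c ?f) 1 + fps_nth (lact ?b (act_comm ?a ?f)) 1"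
    by (simp add: act_comm_lact[OF c])
  also have "fps_nth (lact ?c ?f) 1 = ((order_term star 1 a b - order_term star 1 b a) \<circ> pr) * f"
    unfolding bilinear_nth_1[OF AM AP lact_bilinear C c(3)] n(3,4)
    using s(2)[unfolded n(4)] by (simp add: order_term_0[OF AM AP lact_bilinear smooth_functions_0 f]
        lact_order_0 f smooth_functions_0 del: One_nat_def)
  also have "fps_nth (lact ?b (act_comm ?a ?f)) 1 = (b \<circ> pr) * act_comm_1 a f"
    using s(1) by (simp add: bilinear_nth_1[OF AM AP lact_bilinear c(2) Ca] n(1,2)
        order_term_0[OF AM AP lact_bilinear b smooth_functions_0] lact_order_0 b smooth_functions_0 del: One_nat_def)
  finally show ?thesis .
qed

lemma act_comm_1_closed:
  "a \<in> smooth_functions AM \<Longrightarrow> f \<in> smooth_functions AP \<Longrightarrow> act_comm_1 a f \<in> smooth_functions AP"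
  unfolding act_comm_1_def
  by (intro smooth_functions_diff[OF AP] order_term_closed[OF AM AP lact_bilinear] order_term_closed[OF AP AM ract_bilinear])

text \<open>
  Dividing by \<open>fps_X\<close> reduces the coefficient of order 2 to one of order 1.\<close>

lemma act_comm_nth_2:
  assumes a: "a \<in> smooth_functions AM" and f: "f \<in> formal_functions AP" and 0: "fps_nth f 0 = 0"
  shows "fps_nth (act_comm (fps_const a) f) 2 = act_comm_1 a (fps_nth f 1)"
proof -
  note g = formal_functions_shift[OF f, of 1] and ca = formal_functions_const[OF a]
  have "f = fps_X * fps_shift 1 f" using fps_split_X[of f] 0 by simp
  then have "act_comm (fps_const a) f = fps_X * act_comm (fps_const a) (fps_shift 1 f)"
    using act_comm_X(2)[OF ca g] by simp
  then show ?thesis using act_comm_nth(2)[OF ca g] by (simp add: fps_X_mult_nth One_nat_def[symmetric] del: One_nat_def)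
qed

text \<open>
  The coefficient of order 2 in \<open>act_comm_commutator\<close>: both nested commutators, and the commutator with
  \<open>[a, b]\<close>, start in that order.\<close>

lemma act_comm_1_jacobi:
  assumes a: "a \<in> smooth_functions AM" and b: "b \<in> smooth_functions AM" and f: "f \<in> smooth_functions AP"
  shows "act_comm_1 a (act_comm_1 b f) - act_comm_1 b (act_comm_1 a f)
    = act_comm_1 (order_term star 1 a b - order_term star 1 b a) f"
proof -
  let ?a = "fps_const a" and ?b = "fps_const b" and ?f = "fps_const f"
  let ?c = "star ?a ?b - star ?b ?a"
  note c = formal_functions_const[OF a] formal_functions_const[OF b] formal_functions_const[OF f]
  have C: "?c \<in> formal_functions AM"
    by (intro formal_functions_diff[OF AM] star_closed c)
  have "act_comm_1 a (act_comm_1 b f) - act_comm_1 b (act_comm_1 a f)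
      = fps_nth (act_comm ?a (act_comm ?b ?f) - act_comm ?b (act_comm ?a ?f)) 2"
    by (simp add: act_comm_nth_2 a b act_comm_closed c act_comm_nth del: One_nat_def)
  also have "\<dots> = fps_nth (act_comm ?c ?f) 2" by (simp only: act_comm_commutator[OF c])
  also have "act_comm ?c ?f = fps_X * act_comm (fps_shift 1 ?c) ?f"
  proof -
    have "?c = fps_X * fps_shift 1 ?c" using fps_split_X[of ?c] star_commutator_nth(1)[OF a b] by simp
    then show ?thesis using act_comm_X(1)[OF formal_functions_shift[OF C, of 1] c(3)] by simp
  qed
  also have "fps_nth \<dots> 2 = act_comm_1 (order_term star 1 a b - order_term star 1 b a) f"
    using act_comm_nth(2)[OF formal_functions_shift[OF C, of 1] c(3)] star_commutator_nth(2)[OF a b]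
    by (simp add: fps_X_mult_nth One_nat_def[symmetric] del: One_nat_def)
  finally show ?thesis .
qed

lemma bimodule_bracket_semi_poisson:
  "semi_poisson_bracket AM AP pr (star_bracket star) (bimodule_bracket lact ract)"
proof -
  have bb: "bimodule_bracket lact ract = (\<lambda>a f. (\<lambda>_. \<i> / 2) * act_comm_1 a f)"
    by (simp add: bimodule_bracket_def act_comm_1_def fun_eq_iff)
  have C: "order_term star 1 a b - order_term star 1 b a \<in> smooth_functions AM"
    if "a \<in> smooth_functions AM" "b \<in> smooth_functions AM" for a b
    by (intro smooth_functions_diff[OF AM] order_term_closed[OF AM AM star_bilinear] that)
  have add_left: "act_comm_1 (a + b) f = act_comm_1 a f + act_comm_1 b f"
    and add_right: "act_comm_1 a (f + g) = act_comm_1 a f + act_comm_1 a g"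
    and scale_left: "act_comm_1 ((\<lambda>_. z) * a) f = (\<lambda>_. z) * act_comm_1 a f"
    and scale_right: "act_comm_1 a ((\<lambda>_. z) * f) = (\<lambda>_. z) * act_comm_1 a f"
    if "a \<in> smooth_functions AM" "b \<in> smooth_functions AM" "f \<in> smooth_functions AP" "g \<in> smooth_functions AP"
    for a b f g z
    using that unfolding act_comm_1_def
    by (simp_all only: order_term_add_left[OF AM AP lact_bilinear] order_term_add_right[OF AM AP lact_bilinear]
        order_term_add_left[OF AP AM ract_bilinear] order_term_add_right[OF AP AM ract_bilinear]
        order_term_scale[OF AM AP lact_bilinear] order_term_scale[OF AP AM ract_bilinear]
        right_diff_distrib add_diff_add)
  show ?thesis
    unfolding semi_poisson_bracket_def bb star_bracket_def
  proof (intro conjI ballI allI)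
    fix a assume a: "a \<in> smooth_functions AM"
    fix f assume f: "f \<in> smooth_functions AP"
    note sc = scale_left[OF a a f f] scale_right[OF a a f f]
    show "(\<lambda>_. \<i> / 2) * act_comm_1 a f \<in> smooth_functions AP"
      by (intro smooth_functions_mult[OF AP] smooth_functions_const act_comm_1_closed a f)
    show "(\<lambda>_. \<i> / 2) * act_comm_1 ((\<lambda>_. z) * a) f = (\<lambda>_. z) * ((\<lambda>_. \<i> / 2) * act_comm_1 a f)" for z
      unfolding sc by (rule mult.left_commute)
    show "(\<lambda>_. \<i> / 2) * act_comm_1 a ((\<lambda>_. z) * f) = (\<lambda>_. z) * ((\<lambda>_. \<i> / 2) * act_comm_1 a f)" for z
      unfolding sc by (rule mult.left_commute)
    show "(\<lambda>_. \<i> / 2) * act_comm_1 a (f + g) = (\<lambda>_. \<i> / 2) * act_comm_1 a f + (\<lambda>_. \<i> / 2) * act_comm_1 a g"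
      if g: "g \<in> smooth_functions AP" for g
      by (simp only: add_right[OF a a f g] distrib_left)
  next
    fix a b f assume a: "a \<in> smooth_functions AM" and b: "b \<in> smooth_functions AM" and f: "f \<in> smooth_functions AP"
    show "(\<lambda>_. \<i> / 2) * act_comm_1 (a + b) f = (\<lambda>_. \<i> / 2) * act_comm_1 a f + (\<lambda>_. \<i> / 2) * act_comm_1 b f"
      by (simp only: add_left[OF a b f f] distrib_left)
    show "(\<lambda>_. \<i> / 2) * act_comm_1 (a * b) f
        = (a \<circ> pr) * ((\<lambda>_. \<i> / 2) * act_comm_1 b f) + (b \<circ> pr) * ((\<lambda>_. \<i> / 2) * act_comm_1 a f)"
      by (simp only: act_comm_1_mult[OF a b f] distrib_left mult.left_commute)
    show "(\<lambda>_. \<i> / 2) * act_comm_1 a ((b \<circ> pr) * f)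
        = ((\<lambda>_. \<i> / 2) * (order_term star 1 a b - order_term star 1 b a) \<circ> pr) * f
          + (b \<circ> pr) * ((\<lambda>_. \<i> / 2) * act_comm_1 a f)"
      unfolding act_comm_1_pullback[OF a b f] by (simp add: fun_eq_iff algebra_simps)
    have sc: "act_comm_1 x ((\<lambda>_. \<i> / 2) * act_comm_1 y f) = (\<lambda>_. \<i> / 2) * act_comm_1 x (act_comm_1 y f)"
      if "x \<in> smooth_functions AM" "y \<in> smooth_functions AM" for x y
      by (rule scale_right[OF that(1,1) act_comm_1_closed[OF that(2) f] f])
    show "(\<lambda>_. \<i> / 2) * act_comm_1 a ((\<lambda>_. \<i> / 2) * act_comm_1 b f)
        - (\<lambda>_. \<i> / 2) * act_comm_1 b ((\<lambda>_. \<i> / 2) * act_comm_1 a f)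
        - (\<lambda>_. \<i> / 2) * act_comm_1 ((\<lambda>_. \<i> / 2) * (order_term star 1 a b - order_term star 1 b a)) f = 0"
      unfolding sc[OF a b] sc[OF b a] scale_left[OF C[OF a b] a f f] act_comm_1_jacobi[OF a b f, symmetric]
      by (simp only: right_diff_distrib diff_self)
  qed
qed

end

theorem theorem2p20:
  fixes AM :: "('m::{t2_space,second_countable_topology}, 'e::real_inner) chart set"
    and AP :: "('p::{t2_space,second_countable_topology}, 'f::real_inner) chart set"
    and pr :: "'p \<Rightarrow> 'm"
  assumes "fibered_manifold AM AP pr"
  shows
    "(\<forall>br sb. poisson_bracket AM br \<and> symplectic_bracket AM br \<and>
        semi_poisson_bracket AM AP pr br sb \<and> natural_bracket AM AP sb \<longrightarrow>
        (\<exists>!h. horizontal_lift AM AP pr h \<and> lifts_hamiltonians AM AP br sb h) \<and>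
        (\<forall>h. horizontal_lift AM AP pr h \<and> lifts_hamiltonians AM AP br sb h \<longrightarrow>
           flat_connection AM h)) \<and>
     ((\<exists>star lact ract. star_product AM star \<and> symplectic_bracket AM (star_bracket star) \<and>
        bimodule_deformation AM AP pr star lact ract \<and>
        natural_bracket AM AP (bimodule_bracket lact ract)) \<longrightarrow>
        (\<exists>h. horizontal_lift AM AP pr h \<and> flat_connection AM h))"
proof (intro conjI allI impI)
  fix br sb
  assume *: "poisson_bracket AM br \<and> symplectic_bracket AM br \<and>
    semi_poisson_bracket AM AP pr br sb \<and> natural_bracket AM AP sb"
  then show "\<exists>!h. horizontal_lift AM AP pr h \<and> lifts_hamiltonians AM AP br sb h"
    using natural_semi_poisson_flat_connection(1)[OF assms] by blast
  show "flat_connection AM h" if "horizontal_lift AM AP pr h \<and> lifts_hamiltonians AM AP br sb h" for h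
    using * that natural_semi_poisson_flat_connection(2)[OF assms] by blast
next
  assume "\<exists>star lact ract. star_product AM star \<and> symplectic_bracket AM (star_bracket star) \<and>
    bimodule_deformation AM AP pr star lact ract \<and> natural_bracket AM AP (bimodule_bracket lact ract)"
  then obtain star lact ract where s: "star_product AM star" "symplectic_bracket AM (star_bracket star)"
    "bimodule_deformation AM AP pr star lact ract" "natural_bracket AM AP (bimodule_bracket lact ract)"
    by blast
  have atlas: "smooth_atlas AM" "smooth_atlas AP" using assms by (auto simp: fibered_manifold_def)
  note semi = bimodule_bracket_semi_poisson[OF atlas s(1,3)]
  show "\<exists>h. horizontal_lift AM AP pr h \<and> flat_connection AM h"
    using natural_semi_poisson_flat_connection[OF assms s(2) semi s(4)] by blast
qed

end
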